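(* Let $p$ and $r$ be primes and suppose that an elementary abelian $r$-group $A$ of order $r^2$ acts by automorphisms on a finite $p$-solvable group $G$, that this action is good, and that $C_G(a)$ is $p$-nilpotent for each nonidentity $a\in A$. Then $G$ is $p$-nilpotent by $p$-nilpotent, i.e. $G$ has a $p$-nilpotent normal subgroup $N$ with $G/N$ $p$-nilpotent.
   Context: All groups are finite. If a group $A$ acts on a group $G$ by automorphisms, the action is called good if $H=[H,B]C_H(B)$ for every subgroup $B\le A$ and every $B$-invariant subgroup $H\le G$. *)

theory Defs
  imports "HOL-Algebra.Algebra"
begin

definition aut_action :: "('b, 'c) monoid_scheme \<Rightarrow> ('a, 'd) monoid_scheme \<Rightarrow> ('b \<Rightarrow> 'a \<Rightarrow> 'a) \<Rightarrow> bool" where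
  "aut_action A G phi \<longleftrightarrow>
     (\<forall>a\<in>carrier A. phi a \<in> iso G G) \<and>
     (\<forall>x\<in>carrier G. phi \<one>\<^bsub>A\<^esub> x = x) \<and>
     (\<forall>a\<in>carrier A. \<forall>b\<in>carrier A. \<forall>x\<in>carrier G. phi (a \<otimes>\<^bsub>A\<^esub> b) x = phi a (phi b x))"

definition comm_act :: "('a, 'd) monoid_scheme \<Rightarrow> ('b \<Rightarrow> 'a \<Rightarrow> 'a) \<Rightarrow> 'a set \<Rightarrow> 'b set \<Rightarrow> 'a set" where
  "comm_act G phi H B = generate G {inv\<^bsub>G\<^esub> h \<otimes>\<^bsub>G\<^esub> phi b h | h b. h \<in> H \<and> b \<in> B}"

definition fixed_by :: "('b \<Rightarrow> 'a \<Rightarrow> 'a) \<Rightarrow> 'a set \<Rightarrow> 'b set \<Rightarrow> 'a set" where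
  "fixed_by phi H B = {h \<in> H. \<forall>b\<in>B. phi b h = h}"

definition good_action :: "('b, 'c) monoid_scheme \<Rightarrow> ('a, 'd) monoid_scheme \<Rightarrow> ('b \<Rightarrow> 'a \<Rightarrow> 'a) \<Rightarrow> bool" where
  "good_action A G phi \<longleftrightarrow>
     (\<forall>B H. subgroup B A \<longrightarrow> subgroup H G \<longrightarrow> (\<forall>b\<in>B. phi b ` H \<subseteq> H) \<longrightarrow>
        H = comm_act G phi H B <#>\<^bsub>G\<^esub> fixed_by phi H B)"

definition elementary_abelian :: "nat \<Rightarrow> ('b, 'c) monoid_scheme \<Rightarrow> bool" where
  "elementary_abelian r A \<longleftrightarrow> comm_group A \<and> (\<forall>x\<in>carrier A. x [^]\<^bsub>A\<^esub> r = \<one>\<^bsub>A\<^esub>)"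

definition is_p_group :: "nat \<Rightarrow> ('a, 'd) monoid_scheme \<Rightarrow> bool" where
  "is_p_group p H \<longleftrightarrow> (\<exists>k. order H = p ^ k)"

definition is_p'_group :: "nat \<Rightarrow> ('a, 'd) monoid_scheme \<Rightarrow> bool" where
  "is_p'_group p H \<longleftrightarrow> \<not> p dvd order H"

definition p_solvable :: "nat \<Rightarrow> ('a, 'd) monoid_scheme \<Rightarrow> bool" where
  "p_solvable p G \<longleftrightarrow>
     (\<exists>n S. S 0 = {\<one>\<^bsub>G\<^esub>} \<and> S n = carrier G \<and> (\<forall>i\<le>n. subgroup (S i) G) \<and>
        (\<forall>i<n. S i \<lhd> G\<lparr>carrier := S (Suc i)\<rparr> \<and>
           (is_p_group p (G\<lparr>carrier := S (Suc i)\<rparr> Mod S i) \<or>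
            is_p'_group p (G\<lparr>carrier := S (Suc i)\<rparr> Mod S i))))"

definition p_nilpotent :: "nat \<Rightarrow> ('a, 'd) monoid_scheme \<Rightarrow> bool" where
  "p_nilpotent p G \<longleftrightarrow>
     (\<exists>K. K \<lhd> G \<and> \<not> p dvd card K \<and> (\<exists>k. order G = card K * p ^ k))"

end

theory Submission
  imports Defs
begin

text \<open>
  Passing to \<open>G / O\<^sub>p\<^sub>'(G)\<close> one may assume \<open>O\<^sub>p\<^sub>'(G) = 1\<close>, so that \<open>P = O\<^sub>p(G)\<close> contains its centralizer.
  If \<open>p = r\<close>, then \<open>A\<close> acts trivially on \<open>P\<close>, since \<open>[H,A] < H\<close> for nontrivial \<open>H\<close> whereas the
  action is good; hence \<open>[G,A] \<le> C\<^sub>G(P) \<le> P\<close> and \<open>G / P\<close> is covered by the \<open>p\<close>-nilpotent group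
  \<open>C\<^sub>G(A)\<close>.

  Let \<open>p \<noteq> r\<close>. A fixed element of order \<open>r\<close> would commute with every \<open>C\<^sub>P(x)\<close>, hence with \<open>P\<close>, because
  an \<open>r'\<close>-group is generated by the centralizers of the nonidentity elements of \<open>A\<close>; so \<open>G\<close> is an
  \<open>r'\<close>-group. Let \<open>K / P = O\<^sub>p\<^sub>'(G / P)\<close>, let \<open>T\<close> be an \<open>A\<close>-invariant Sylow \<open>q\<close>-subgroup of \<open>K\<close>
  with \<open>q \<noteq> p\<close>, and \<open>N = N\<^sub>G(T)\<close>, so that \<open>G = K N\<close>. The heart of the matter is that the intersection \<open>J\<close> of
  all \<open>[N,x]\<close> centralizes \<open>T\<close>. On an abelian section \<open>V\<close> of \<open>P\<close> this comes from a minimal invariant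
  subgroup \<open>Z\<close> of \<open>T\<close> acting nontrivially: Frobenius-type averaging over \<open>C\<^sub>Z(x)\<close> shows that
  \<open>[V, C\<^sub>Z(x)]\<close> lies in \<open>C\<^sub>V([Z,x])\<close>, that \<open>C\<^sub>V([Z,x])\<close> is \<open>N\<close>-invariant, and hence that \<open>[N,x]\<close> and \<open>T\<close>
  commute modulo the kernel of \<open>T\<close> on the part of \<open>[V,Z]\<close> belonging to \<open>x\<close>.

  Since the action is good, \<open>N / [N,x]\<close> is an image of \<open>C\<^sub>N(x)\<close> and therefore \<open>p\<close>-nilpotent, and so is
  \<open>N / J\<close>. Hence \<open>G / M\<close> is \<open>p\<close>-nilpotent for the intersection \<open>M\<close> of the groups \<open>K C\<^sub>G(T)\<close>, and \<open>M = K\<close>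
  because a normal \<open>p\<close>-section above \<open>K\<close> centralizing all these Sylow subgroups would already lie in
  \<open>P\<close>. Thus \<open>G / P\<close> is \<open>p\<close>-nilpotent.
\<close>

section \<open>Fixed points of p-group actions\<close>

text \<open>Goodness takes its place, mostly in the form of \<open>good_gen\<close>: a group lies in
  D as soon as its displacements under one element and the fixed points of that element do. Applied
  to the elements fixed modulo a normal subgroup, this lifts fixed points from quotients; and since
  goodness passes to invariant subgroups and to quotients, all reductions stay inside the
  hypotheses.

  The intersection over all x is forced: [N,x] is controlled only on the part of V belonging to x,
  and V is spanned by these parts together with the fixed points of Z. Passing to N makes T normal,
  so that Z can be chosen normal as well and its fixed points form a smaller module for an
  induction. The averaging extracts roots of degree the order of a subgroup of T, which is possible
  because that order is prime to the order of V.\<close>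

lemma group_actionI:
  fixes A :: "('b, 'c) monoid_scheme" and f :: "'b \<Rightarrow> 'e \<Rightarrow> 'e"
  assumes "group A"
    and cl: "\<And>a e. a \<in> carrier A \<Longrightarrow> e \<in> E \<Longrightarrow> f a e \<in> E"
    and one: "\<And>e. e \<in> E \<Longrightarrow> f \<one>\<^bsub>A\<^esub> e = e"
    and comp: "\<And>a b e. a \<in> carrier A \<Longrightarrow> b \<in> carrier A \<Longrightarrow> e \<in> E \<Longrightarrow> f (a \<otimes>\<^bsub>A\<^esub> b) e = f a (f b e)"
  shows "group_action A E (\<lambda>a. \<lambda>e\<in>E. f a e)"
proof -
  interpret A: group A by fact
  define g where "g a = (\<lambda>e\<in>E. f a e)" for a
  have inv_f: "f (inv\<^bsub>A\<^esub> a) (f a e) = e" "f a (f (inv\<^bsub>A\<^esub> a) e) = e"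
    if "a \<in> carrier A" "e \<in> E" for a e
    using that comp[of "inv\<^bsub>A\<^esub> a" a e] comp[of a "inv\<^bsub>A\<^esub> a" e] one by auto
  have bij: "bij_betw (f a) E E" if a: "a \<in> carrier A" for a
    by (rule bij_betw_byWitness[where f' = "f (inv\<^bsub>A\<^esub> a)"]) (use a inv_f cl in auto)
  have gB: "g a \<in> Bij E" if "a \<in> carrier A" for a
    using bij[OF that] unfolding Bij_def g_def by (auto simp: bij_betw_def inj_on_def)
  have hom: "g \<in> hom A (BijGroup E)"
  proof (rule homI)
    show "g a \<in> carrier (BijGroup E)" if "a \<in> carrier A" for a
      using gB[OF that] by (simp add: BijGroup_def)
    show "g (a \<otimes>\<^bsub>A\<^esub> b) = g a \<otimes>\<^bsub>BijGroup E\<^esub> g b" if "a \<in> carrier A" "b \<in> carrier A" for a b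
      using gB that comp cl by (auto simp: BijGroup_def g_def compose_def fun_eq_iff restrict_def)
  qed
  show ?thesis
    unfolding group_action_def group_hom_def group_hom_axioms_def
    using \<open>group A\<close> hom group_BijGroup unfolding g_def by blast
qed

text \<open>Orbit sizes divide \<open>r ^ k\<close>, so modulo \<open>r\<close> only the singleton
  orbits count. The action is a bare function because it is used for elements, for cosets and for
  Sylow subgroups alike.\<close>

lemma fixed_points_mod_prime:
  fixes A :: "('b, 'c) monoid_scheme" and f :: "'b \<Rightarrow> 'e \<Rightarrow> 'e"
  assumes "group A" and r: "Factorial_Ring.prime (r::nat)" and ord: "order A = r ^ k" and fin: "finite E"
    and cl: "\<And>a e. a \<in> carrier A \<Longrightarrow> e \<in> E \<Longrightarrow> f a e \<in> E"
    and one: "\<And>e. e \<in> E \<Longrightarrow> f \<one>\<^bsub>A\<^esub> e = e"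
    and comp: "\<And>a b e. a \<in> carrier A \<Longrightarrow> b \<in> carrier A \<Longrightarrow> e \<in> E \<Longrightarrow> f (a \<otimes>\<^bsub>A\<^esub> b) e = f a (f b e)"
  shows "card E mod r = card {e \<in> E. \<forall>a\<in>carrier A. f a e = e} mod r"
proof -
  interpret A: group A by fact
  define g where "g a = (\<lambda>e\<in>E. f a e)" for a
  interpret ga: group_action A E g
    using group_actionI[OF assms(1), of E f] cl one comp unfolding g_def by blast
  let ?O = "orbits A E g" and ?F = "{e \<in> E. \<forall>a\<in>carrier A. f a e = e}"
  have orbE: "orbit A g e = (\<lambda>a. f a e) ` carrier A" if "e \<in> E" for e
    using that unfolding orbit_def g_def by auto
  have finO: "finite ?O" using fin unfolding orbits_def by simp
  have finorb: "finite Y" if "Y \<in> ?O" for Y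
    using that fin ga.orbits_coverture by (metis Union_upper finite_subset)
  have one_iff: "card (orbit A g e) = 1 \<longleftrightarrow> e \<in> ?F" if e: "e \<in> E" for e
  proof
    assume "card (orbit A g e) = 1"
    moreover have "e \<in> orbit A g e" by (rule ga.orbit_refl[OF e])
    ultimately have "orbit A g e = {e}" by (metis card_1_singletonE singletonD)
    then show "e \<in> ?F" using orbE[OF e] e by auto
  next
    assume "e \<in> ?F"
    then have "orbit A g e = {e}" using orbE[OF e] A.one_closed by (auto simp: image_iff)
    then show "card (orbit A g e) = 1" by simp
  qed
  have dvd: "card Y = 1 \<or> r dvd card Y" if Y: "Y \<in> ?O" for Y
  proof -
    from Y obtain e where e: "e \<in> E" "Y = orbit A g e" unfolding orbits_def by blast
    have "card Y * card (stabilizer A g e) = r ^ k"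
      using ga.orbit_stabilizer_theorem[OF e(1)] ord e(2) by simp
    then have "card Y dvd r ^ k" by (metis dvd_triv_left)
    then obtain j where "card Y = r ^ j" using divides_primepow_nat[OF r] by blast
    then show ?thesis by (cases j) auto
  qed
  have "card E = (\<Sum>Y\<in>?O. card Y)"
  proof -
    have "(\<Sum>Y\<in>?O. \<Sum>x\<in>Y. (1::nat)) = (\<Sum>x\<in>E. 1)" by (rule ga.disjoint_sum[OF fin])
    then show ?thesis by simp
  qed
  also have "\<dots> mod r = (\<Sum>Y\<in>?O. if card Y = 1 then 1 else 0) mod r"
  proof -
    have "(\<Sum>Y\<in>?O. card Y) mod r = (\<Sum>Y\<in>?O. card Y mod r) mod r" by (rule mod_sum_eq[symmetric])
    also have "(\<Sum>Y\<in>?O. card Y mod r) = (\<Sum>Y\<in>?O. (if card Y = 1 then 1 else 0) mod r)"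
      by (rule sum.cong[OF refl]) (use dvd in \<open>force simp: dvd_eq_mod_eq_0\<close>)
    finally show ?thesis by (simp add: mod_sum_eq)
  qed
  also have "(\<Sum>Y\<in>?O. if card Y = 1 then 1 else (0::nat)) = card {Y \<in> ?O. card Y = 1}"
    using finO by (simp add: sum.If_cases Int_def)
  also have "{Y \<in> ?O. card Y = 1} = (\<lambda>e. {e}) ` ?F"
  proof (intro equalityI subsetI)
    fix Y assume "Y \<in> {Y \<in> ?O. card Y = 1}"
    then obtain e where e: "e \<in> E" "Y = orbit A g e" "card Y = 1" unfolding orbits_def by blast
    moreover have "e \<in> Y" using ga.orbit_refl e by blast
    ultimately have "Y = {e}" by (metis card_1_singletonE singletonD)
    with e one_iff[OF e(1)] show "Y \<in> (\<lambda>e. {e}) ` ?F" by auto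
  next
    fix Y assume "Y \<in> (\<lambda>e. {e}) ` ?F"
    then obtain e where e: "e \<in> ?F" "Y = {e}" by blast
    then have "orbit A g e = {e}" using orbE[of e] A.one_closed by (auto simp: image_iff)
    then show "Y \<in> {Y \<in> ?O. card Y = 1}" using e unfolding orbits_def by auto
  qed
  also have "card ((\<lambda>e. {e}) ` ?F) = card ?F" by (rule card_image) simp
  finally show ?thesis .
qed

text \<open>The set is a single orbit, so this is the orbit-stabilizer theorem;
  \<open>invariant_sylow\<close> applies it to the Sylow subgroups under conjugation.\<close>

lemma transitive_card_dvd:
  fixes A :: "('b, 'c) monoid_scheme" and f :: "'b \<Rightarrow> 'e \<Rightarrow> 'e"
  assumes "group A" and e0: "e0 \<in> E"
    and cl: "\<And>a e. a \<in> carrier A \<Longrightarrow> e \<in> E \<Longrightarrow> f a e \<in> E"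
    and one: "\<And>e. e \<in> E \<Longrightarrow> f \<one>\<^bsub>A\<^esub> e = e"
    and comp: "\<And>a b e. a \<in> carrier A \<Longrightarrow> b \<in> carrier A \<Longrightarrow> e \<in> E \<Longrightarrow> f (a \<otimes>\<^bsub>A\<^esub> b) e = f a (f b e)"
    and trans: "\<And>e. e \<in> E \<Longrightarrow> \<exists>a\<in>carrier A. f a e0 = e"
  shows "card E dvd order A"
proof -
  interpret ga: group_action A E "\<lambda>a. \<lambda>e\<in>E. f a e"
    by (rule group_actionI) (use assms in auto)
  have "orbit A (\<lambda>a. \<lambda>e\<in>E. f a e) e0 = E"
  proof -
    have "(\<lambda>a. f a e0) ` carrier A = E" using e0 cl trans by blast
    then show ?thesis unfolding orbit_def using e0 by auto
  qed
  then show ?thesis using ga.orbit_stabilizer_theorem[OF e0] by (metis dvd_triv_left)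
qed

context group
begin

lemma cancel_left [simp]:
  "x \<in> carrier G \<Longrightarrow> y \<in> carrier G \<Longrightarrow> x \<otimes> (inv x \<otimes> y) = y"
  "x \<in> carrier G \<Longrightarrow> y \<in> carrier G \<Longrightarrow> inv x \<otimes> (x \<otimes> y) = y"
  by (simp_all flip: m_assoc)

text \<open>In a finite group the inverse of \<open>x\<close> is the power with exponent
  \<open>order G - 1\<close>, so closure under products suffices.\<close>

lemma subgroup_finI:
  assumes "finite (carrier G)" and "H \<subseteq> carrier G" and "H \<noteq> {}"
    and cl: "\<And>x y. x \<in> H \<Longrightarrow> y \<in> H \<Longrightarrow> x \<otimes> y \<in> H"
  shows "subgroup H G"
proof (rule subgroupI[OF assms(2,3) _ cl])
  fix x assume x: "x \<in> H"
  then have xG: "x \<in> carrier G" using assms(2) by blast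
  have pw: "x [^] Suc n \<in> H" for n by (induction n) (use x xG cl in auto)
  have "order G > 0" using assms(1) order_gt_0_iff_finite by blast
  then have "x [^] (order G - 1) = inv x"
    using pow_order_eq_1[OF xG] xG inv_equality[of "x [^] (order G - 1)" x]
    by (metis Suc_pred' nat_pow_Suc nat_pow_closed One_nat_def)
  moreover have "inv x \<in> H"
  \<comment> \<open>The powers in \<open>pw\<close> start at exponent 1, so the trivial group, where
    the exponent is 0, is treated apart.\<close>
  proof (cases "order G - 1")
    case 0
    then have "inv x = \<one>" using calculation by simp
    then have "x = \<one>" using xG by (metis inv_eq_1_iff)
    then show ?thesis using x by simp
  next
    case (Suc n) then show ?thesis using pw[of n] calculation by simp
  qed
  ultimately show "inv x \<in> H" by simp
qed

lemma r_coset_eq_iff: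
  assumes "subgroup H G" "x \<in> carrier G" "y \<in> carrier G"
  shows "H #> x = H #> y \<longleftrightarrow> x \<otimes> inv y \<in> H"
  using assms by (metis coset_join1 coset_join2 coset_mult_assoc coset_mult_inv1 coset_mult_inv2 inv_closed
      m_closed subgroup.subset)

end

text \<open>Right multiplication by the inverse is a left action on the right cosets, as
  \<open>fixed_points_mod_prime\<close> requires.\<close>

lemma (in group) fixed_cosets_mod_prime:
  assumes fin: "finite (carrier G)" and p: "Factorial_Ring.prime (p::nat)"
    and Q: "subgroup Q G" "card Q = p ^ k" and C: "subgroup C G"
  shows "card (rcosets C) mod p = card {R \<in> rcosets C. \<forall>q\<in>Q. R #> inv q = R} mod p"
proof -
  interpret Q: subgroup Q G by fact
  interpret C: subgroup C G by fact
  let ?Q = "G\<lparr>carrier := Q\<rparr>"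
  have "card (rcosets C) mod p = card {R \<in> rcosets C. \<forall>q\<in>carrier ?Q. R #> inv q = R} mod p"
  proof (rule fixed_points_mod_prime[OF Q.subgroup_is_group[OF is_group] p])
    show "order ?Q = p ^ k" using Q(2) by (simp add: order_def)
    show "finite (rcosets C)" using fin rcosets_finite by (simp add: RCOSETS_def)
    fix a R assume ae: "a \<in> carrier ?Q" "R \<in> rcosets C"
    then obtain g where g: "g \<in> carrier G" "R = C #> g" unfolding RCOSETS_def by blast
    have a: "a \<in> carrier G" using ae by simp
    show "R #> inv a \<in> rcosets C"
      using g a coset_mult_assoc[OF C.subset g(1), of "inv a"] by (auto simp: RCOSETS_def)
    fix b assume "b \<in> carrier ?Q"
    then have b: "b \<in> carrier G" by simp
    show "R #> inv (a \<otimes>\<^bsub>?Q\<^esub> b) = R #> inv b #> inv a"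
      using g a b C.subset by (simp add: coset_mult_assoc inv_mult_group m_assoc)
  next
    fix R assume "R \<in> rcosets C"
    then obtain g where g: "g \<in> carrier G" "R = C #> g" unfolding RCOSETS_def by blast
    then show "R #> inv \<one>\<^bsub>?Q\<^esub> = R" using C.subset by (simp add: coset_mult_assoc)
  qed
  then show ?thesis by simp
qed

lemma (in group) fixed_coset_conj:
  assumes C: "subgroup C G" and g: "g \<in> carrier G" and q: "q \<in> carrier G" and e: "C #> g #> q = C #> g"
  shows "g \<otimes> q \<otimes> inv g \<in> C"
proof -
  have "C #> (g \<otimes> q) = C #> g"
    using e g q subgroup.subset[OF C] by (simp add: coset_mult_assoc)
  then show ?thesis using r_coset_eq_iff[OF C, of "g \<otimes> q" g] g q by simp
qed

text \<open>The \<open>p\<close>-group \<open>Q\<close> permutes the cosets of \<open>S\<close>,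
  whose number is prime to \<open>p\<close>. It therefore fixes some coset of \<open>S\<close>, and
  a representative of that coset conjugates \<open>Q\<close> into \<open>S\<close>.\<close>

lemma sylow_conj:
  fixes G (structure)
  assumes "group G" and fin: "finite (carrier G)" and p: "Factorial_Ring.prime (p::nat)"
    and Q: "subgroup Q G" "card Q = p ^ k" and S: "subgroup S G" "\<not> p dvd card (rcosets S)"
  shows "\<exists>g\<in>carrier G. \<forall>q\<in>Q. g \<otimes> q \<otimes> inv g \<in> S"
proof -
  interpret group G by fact
  interpret Q: subgroup Q G by fact
  let ?F = "{R \<in> rcosets S. \<forall>q\<in>Q. R #> inv q = R}"
  have "card ?F \<noteq> 0"
  proof
    assume "card ?F = 0"
    then have "card (rcosets S) mod p = 0" using fixed_cosets_mod_prime[OF fin p Q S(1)] by simp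
    with S(2) show False by (simp only: dvd_eq_mod_eq_0)
  qed
  then have "?F \<noteq> {}" by (metis card.empty)
  then obtain g where g: "g \<in> carrier G" "\<And>a. a \<in> Q \<Longrightarrow> S #> g #> inv a = S #> g"
    unfolding RCOSETS_def by blast
  have "g \<otimes> q \<otimes> inv g \<in> S" if q: "q \<in> Q" for q
    using fixed_coset_conj[OF S(1) g(1), of q] g(2)[of "inv q"] q by simp
  with g(1) show ?thesis by blast
qed

text \<open>This gives [H,A] < H without a semidirect product. A maximal proper invariant subgroup C
  serves as witness: counting the cosets of C fixed by C itself shows that its normalizer is larger,
  hence all of H; counting those fixed by A then shows the same for the subgroup of elements that A
  fixes modulo C.\<close>

lemma p_group_action_proper:
  fixes A :: "('b, 'c) monoid_scheme" and H :: "('a, 'd) monoid_scheme" (structure)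
  assumes "group A" and p: "Factorial_Ring.prime (p::nat)" and oA: "order A = p ^ k"
    and "group H" and oH: "order H = p ^ m" and ne: "carrier H \<noteq> {\<one>}"
    and act: "aut_action A H phi"
  shows "\<exists>M. subgroup M H \<and> M \<noteq> carrier H \<and> (\<forall>h\<in>carrier H. \<forall>a\<in>carrier A. inv h \<otimes> phi a h \<in> M)"
proof -
  interpret A: group A by fact
  interpret H: group H by fact
  have fin: "finite (carrier H)"
    using oH p H.order_gt_0_iff_finite by (simp add: prime_gt_0_nat)
  have cl: "phi a h \<in> carrier H" if "a \<in> carrier A" "h \<in> carrier H" for a h
    using act that unfolding aut_action_def iso_def hom_def by blast
  have mul: "phi a (h \<otimes> k) = phi a h \<otimes> phi a k" if "a \<in> carrier A" "h \<in> carrier H" "k \<in> carrier H" for a h k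
    using act that unfolding aut_action_def iso_def hom_def by blast
  have comp: "phi (a \<otimes>\<^bsub>A\<^esub> b) h = phi a (phi b h)" if "a \<in> carrier A" "b \<in> carrier A" "h \<in> carrier H" for a b h
    using act that unfolding aut_action_def by blast
  have one: "phi \<one>\<^bsub>A\<^esub> h = h" if "h \<in> carrier H" for h
    using act that unfolding aut_action_def by blast
  have inv_phi: "phi a (inv h) = inv (phi a h)" if "a \<in> carrier A" "h \<in> carrier H" for a h
  proof -
    have "phi a (inv h) \<otimes> phi a h = phi a \<one>" using that mul[of a "inv h" h] by simp
    moreover have "phi a \<one> = \<one>"
      using that mul[of a \<one> \<one>] cl[of a \<one>] by simp
    ultimately show ?thesis using that cl H.inv_equality by (metis H.inv_closed)
  qed
  define inva where "inva C \<longleftrightarrow> subgroup C H \<and> C \<noteq> carrier H \<and> (\<forall>a\<in>carrier A. \<forall>c\<in>C. phi a c \<in> C)" for C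
  have phi1: "phi a \<one> = \<one>" if "a \<in> carrier A" for a
    using that mul[of a \<one> \<one>] cl[of a \<one>] by simp
  have "inva {\<one>}" unfolding inva_def using ne H.triv_subgroup phi1 by auto
  moreover have "finite {C. inva C}"
    by (rule finite_subset[of _ "Pow (carrier H)"]) (use fin in \<open>auto simp: inva_def dest: subgroup.subset\<close>)
  ultimately obtain C where C: "inva C" and max: "\<And>D. inva D \<Longrightarrow> C \<subseteq> D \<Longrightarrow> D = C"
    using finite_has_maximal[of "{C. inva C}"] by blast
  interpret C: subgroup C H using C unfolding inva_def by blast
  have sC: "subgroup C H" and Cne: "C \<noteq> carrier H" and Ci: "\<And>a c. a \<in> carrier A \<Longrightarrow> c \<in> C \<Longrightarrow> phi a c \<in> C"
    using C unfolding inva_def by blast+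
  have finC: "finite C" using fin C.subset finite_subset by blast
  have lag: "card (rcosets C) * card C = p ^ m" using H.lagrange[OF sC] oH by simp
  then have "card (rcosets C) dvd p ^ m" "card C dvd p ^ m" by (metis dvd_triv_left, metis dvd_triv_right)
  then obtain i j where i: "card (rcosets C) = p ^ i" and j: "card C = p ^ j"
    using divides_primepow_nat[OF p] by blast
  have "i \<noteq> 0"
  proof
    assume "i = 0"
    then have "card C = card (carrier H)" using lag i oH by (simp add: order_def)
    then show False using Cne fin C.subset card_subset_eq by blast
  qed
  then have pdvd: "p dvd card (rcosets C)" using i by simp
  have finE: "finite (rcosets C)" using fin H.rcosets_finite by (simp add: RCOSETS_def)
  have C_in: "C \<in> rcosets C" by (rule C.subgroup_in_rcosets[OF H.is_group])
  \<comment> \<open>A set of cosets that contains \<open>C\<close> and whose size is divisible by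
    \<open>p\<close> must have a second member.\<close>
  have ex_fix: "\<exists>g\<in>carrier H. g \<notin> C \<and> C #> g \<in> F"
    if F: "F \<subseteq> rcosets C" "C \<in> F" "card (rcosets C) mod p = card F mod p" for F
  proof -
    have "p dvd card F" using F(3) pdvd by (simp add: dvd_eq_mod_eq_0)
    then have "F \<noteq> {C}" using p by (auto simp: prime_nat_iff)
    then obtain e where e: "e \<in> F" "e \<noteq> C" using F(2) by blast
    then obtain g where g: "g \<in> carrier H" "e = C #> g" using F(1) unfolding RCOSETS_def by blast
    then have "g \<notin> C" using e(2) H.coset_join2[OF _ sC] by blast
    with g e(1) show ?thesis by blast
  qed
  define N where "N = {g \<in> carrier H. \<forall>c\<in>C. g \<otimes> c \<otimes> inv g \<in> C}"
  have sN: "subgroup N H"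
  proof (rule H.subgroup_finI[OF fin])
    show "N \<subseteq> carrier H" "N \<noteq> {}" unfolding N_def by (auto intro!: exI[of _ \<one>])
    fix x y assume xy: "x \<in> N" "y \<in> N"
    show "x \<otimes> y \<in> N" unfolding N_def
    proof (intro CollectI conjI ballI)
      show "x \<otimes> y \<in> carrier H" using xy unfolding N_def by simp
      fix c assume c: "c \<in> C"
      have "x \<otimes> (y \<otimes> c \<otimes> inv y) \<otimes> inv x \<in> C" using xy c unfolding N_def by blast
      then show "x \<otimes> y \<otimes> c \<otimes> inv (x \<otimes> y) \<in> C"
        using xy c unfolding N_def by (simp add: H.m_assoc H.inv_mult_group)
    qed
  qed
  have CN: "C \<subseteq> N" unfolding N_def by auto
  have Ninv: "phi a g \<in> N" if a: "a \<in> carrier A" and g: "g \<in> N" for a g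
    unfolding N_def
  proof (intro CollectI conjI ballI)
    have gH: "g \<in> carrier H" using g unfolding N_def by simp
    then show "phi a g \<in> carrier H" using a cl by blast
    fix c assume c: "c \<in> C"
    have cH: "c \<in> carrier H" using c by simp
    define c' where "c' = phi (inv\<^bsub>A\<^esub> a) c"
    have c': "c' \<in> C" using Ci a c unfolding c'_def by simp
    have "phi a c' = c" using comp[of a "inv\<^bsub>A\<^esub> a" c] a cH one unfolding c'_def by simp
    then have "phi a g \<otimes> c \<otimes> inv (phi a g) = phi a (g \<otimes> c' \<otimes> inv g)"
      using a gH c' by (simp add: mul inv_phi)
    moreover have "g \<otimes> c' \<otimes> inv g \<in> C" using g c' unfolding N_def by blast
    ultimately show "phi a g \<otimes> c \<otimes> inv (phi a g) \<in> C" using Ci a by simp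
  qed
  have "\<exists>g\<in>carrier H. g \<notin> C \<and> C #> g \<in> {R \<in> rcosets C. \<forall>q\<in>C. R #> inv q = R}"
    by (rule ex_fix) (use C_in H.fixed_cosets_mod_prime[OF fin p sC j sC] H.coset_join2[OF _ sC] in auto)
  then obtain g where g: "g \<in> carrier H" "g \<notin> C" "\<And>b. b \<in> C \<Longrightarrow> C #> g #> inv b = C #> g" by blast
  have "g \<otimes> c \<otimes> inv g \<in> C" if c: "c \<in> C" for c
    using H.fixed_coset_conj[OF sC g(1), of c] g(3)[of "inv c"] c by simp
  then have "g \<in> N" unfolding N_def using g(1) by blast
  then have "\<not> inva N" using max[OF _ CN] g(2) by blast
  then have N_eq: "N = carrier H" using sN Ninv unfolding inva_def by blast
  have Cnorm: "g \<otimes> c \<otimes> inv g \<in> C" if "g \<in> carrier H" "c \<in> C" for g c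
    using N_eq that unfolding N_def by blast
  have Cnorm': "inv g \<otimes> c \<otimes> g \<in> C" if "g \<in> carrier H" "c \<in> C" for g c
    using Cnorm[of "inv g" c] that by simp
  define D where "D = {h \<in> carrier H. \<forall>a\<in>carrier A. inv h \<otimes> phi a h \<in> C}"
  have sD: "subgroup D H"
  proof (rule H.subgroup_finI[OF fin])
    show "D \<subseteq> carrier H" "D \<noteq> {}" unfolding D_def using phi1 by (auto intro!: exI[of _ \<one>])
    fix x y assume xy: "x \<in> D" "y \<in> D"
    show "x \<otimes> y \<in> D" unfolding D_def
    proof (intro CollectI conjI ballI)
      show "x \<otimes> y \<in> carrier H" using xy unfolding D_def by simp
      fix a assume a: "a \<in> carrier A"
      have "(inv y \<otimes> (inv x \<otimes> phi a x) \<otimes> y) \<otimes> (inv y \<otimes> phi a y) \<in> C"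
        using xy a Cnorm' unfolding D_def by blast
      then show "inv (x \<otimes> y) \<otimes> phi a (x \<otimes> y) \<in> C"
        using xy a cl unfolding D_def by (simp add: mul H.m_assoc H.inv_mult_group)
    qed
  qed
  have CD: "C \<subseteq> D" unfolding D_def using Ci by auto
  have Dinv: "phi b h \<in> D" if b: "b \<in> carrier A" and h: "h \<in> D" for b h
    unfolding D_def
  proof (intro CollectI conjI ballI)
    have hH: "h \<in> carrier H" using h unfolding D_def by simp
    then show "phi b h \<in> carrier H" using b cl by blast
    fix a assume a: "a \<in> carrier A"
    \<comment> \<open>The displacement of \<open>phi b h\<close> under \<open>a\<close> is the
      quotient of the displacements of \<open>h\<close> under the product of \<open>a\<close> and
      \<open>b\<close> and under \<open>b\<close>.\<close>
    have "inv (inv h \<otimes> phi b h) \<otimes> (inv h \<otimes> phi (a \<otimes>\<^bsub>A\<^esub> b) h) \<in> C"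
      using h a b unfolding D_def by (metis (no_types, lifting) A.m_closed C.m_closed C.m_inv_closed mem_Collect_eq)
    then show "inv (phi b h) \<otimes> phi a (phi b h) \<in> C"
      using a b hH cl by (simp add: comp H.m_assoc H.inv_mult_group)
  qed
  let ?F = "{R \<in> rcosets C. \<forall>a\<in>carrier A. phi a ` R = R}"
  have img: "phi a ` (C #> g) = C #> phi a g" if "a \<in> carrier A" "g \<in> carrier H" for a g
    proof -
      have "phi a ` C = C"
      proof
        show "phi a ` C \<subseteq> C" using Ci that by blast
        show "C \<subseteq> phi a ` C"
        proof
          fix c assume c: "c \<in> C"
          have "phi a (phi (inv\<^bsub>A\<^esub> a) c) = c" using comp[of a "inv\<^bsub>A\<^esub> a" c] that c one by simp
          then show "c \<in> phi a ` C" using Ci[of "inv\<^bsub>A\<^esub> a" c] that c by (metis A.inv_closed image_eqI)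
        qed
      qed
      moreover have "phi a ` (C #> g) = (phi a ` C) #> phi a g"
        using that by (force simp: r_coset_def mul)
      ultimately show ?thesis by simp
    qed
  have "card (rcosets C) mod p = card ?F mod p"
  proof (rule fixed_points_mod_prime[OF \<open>group A\<close> p oA finE])
    show "phi a ` e \<in> rcosets C" if "a \<in> carrier A" "e \<in> rcosets C" for a e
    proof -
      obtain x where "x \<in> carrier H" "e = C #> x" using \<open>e \<in> rcosets C\<close> unfolding RCOSETS_def by blast
      then show ?thesis using img[OF that(1)] cl[OF that(1)] H.rcosetsI[OF C.subset] by simp
    qed
    show "phi \<one>\<^bsub>A\<^esub> ` e = e" if "e \<in> rcosets C" for e
    proof -
      have "\<forall>x\<in>e. phi \<one>\<^bsub>A\<^esub> x = x" using one C.rcosets_carrier[OF H.is_group that] by blast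
      then show ?thesis by simp
    qed
    show "phi (a \<otimes>\<^bsub>A\<^esub> b) ` e = phi a ` phi b ` e" if "a \<in> carrier A" "b \<in> carrier A" "e \<in> rcosets C" for a b e
    proof -
      have "\<forall>x\<in>e. phi (a \<otimes>\<^bsub>A\<^esub> b) x = phi a (phi b x)"
        using comp that C.rcosets_carrier[OF H.is_group that(3)] by blast
      then show ?thesis by (simp add: image_image)
    qed
  qed
  moreover have "C \<in> ?F" using C_in img[OF _ H.one_closed] phi1 C.subset by simp
  ultimately have "\<exists>g\<in>carrier H. g \<notin> C \<and> C #> g \<in> ?F" by (intro ex_fix) blast
  then obtain g where g: "g \<in> carrier H" "g \<notin> C" "\<And>a. a \<in> carrier A \<Longrightarrow> phi a ` (C #> g) = C #> g" by blast
  have "g \<in> D" unfolding D_def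
  proof (intro CollectI conjI ballI)
    fix a assume a: "a \<in> carrier A"
    have "g \<in> C #> g" using H.rcos_self[OF g(1) sC] .
    then have "phi a g \<in> C #> g" using g(3)[OF a] by blast
    then obtain c where c: "c \<in> C" "phi a g = c \<otimes> g" unfolding r_coset_def by blast
    then show "inv g \<otimes> phi a g \<in> C" using Cnorm'[OF g(1) c(1)] g(1) by (simp add: H.m_assoc)
  qed fact
  then have "\<not> inva D" using max[OF _ CD] g(2) by blast
  then have "D = carrier H" using sD Dinv unfolding inva_def by blast
  then show ?thesis using sC Cne unfolding D_def by blast
qed

section \<open>Sections of p-power and coprime exponent\<close>

text \<open>The Boolean distinguishes powers of \<open>p\<close> from numbers prime to \<open>p\<close>, so that statements
  about \<open>p\<close>-groups and about \<open>p'\<close>-groups share one proof.\<close>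

definition pi_number :: "nat \<Rightarrow> bool \<Rightarrow> nat \<Rightarrow> bool" where
  "pi_number p s n \<longleftrightarrow> (if s then \<exists>k. n = p ^ k else coprime p n)"

lemma pi_number_1 [simp]: "pi_number p s 1" "pi_number p s (Suc 0)"
  unfolding pi_number_def by (auto intro: exI[of _ 0])

lemma pi_number_mult: "pi_number p s m \<Longrightarrow> pi_number p s n \<Longrightarrow> pi_number p s (m * n)"
  unfolding pi_number_def by (auto simp: power_add[symmetric] split: if_splits)

lemma pi_number_opposite_coprime:
  assumes "pi_number p s m" "pi_number p (\<not> s) n" shows "coprime m n"
  using assms unfolding pi_number_def by (cases s) (auto simp: coprime_commute)

lemma prime_power_of_unique_prime:
  assumes "n > 0" "\<And>q. Factorial_Ring.prime (q::nat) \<Longrightarrow> q dvd n \<Longrightarrow> q = p"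
  shows "\<exists>k. n = p ^ k"
proof (cases "n = 1")
  case True then show ?thesis by (auto intro: exI[of _ 0])
next
  case False
  then obtain q where q: "Factorial_Ring.prime q" "q dvd n" using prime_factor_nat by blast
  then have p: "Factorial_Ring.prime p" "p dvd n" using assms(2) by auto
  obtain m where m: "n = p ^ multiplicity p n * m" "\<not> p dvd m"
    using multiplicity_decompose'[of n p] p assms(1) by (metis less_numeral_extra(3) not_prime_unit)
  have "m = 1"
  proof (rule ccontr)
    assume "m \<noteq> 1"
    then obtain q where "Factorial_Ring.prime q" "q dvd m" using prime_factor_nat by blast
    then show False using m assms(2)[of q] by (metis dvd_mult)
  qed
  with m show ?thesis by auto
qed

text \<open>For \<open>N\<close> normal in \<open>S\<close> this says that \<open>S / N\<close> is a \<open>p\<close>-group (\<open>s = True\<close>) or a \<open>p'\<close>-group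
  (\<open>s = False\<close>); being phrased by exponents it needs no quotient group.\<close>

definition pi_section :: "('a, 'd) monoid_scheme \<Rightarrow> nat \<Rightarrow> bool \<Rightarrow> 'a set \<Rightarrow> 'a set \<Rightarrow> bool" where
  "pi_section G p s S N \<longleftrightarrow> (\<forall>g\<in>S. \<exists>n. pi_number p s n \<and> g [^]\<^bsub>G\<^esub> n \<in> N)"

lemma pi_section_restrict [simp]: "pi_section (G\<lparr>carrier := H\<rparr>) p s S N = pi_section G p s S N"
  unfolding pi_section_def nat_pow_def by simp

lemma pi_section_mono: "pi_section G p s S N \<Longrightarrow> S' \<subseteq> S \<Longrightarrow> N \<subseteq> N' \<Longrightarrow> pi_section G p s S' N'"
  unfolding pi_section_def by blast

context group
begin

lemma pi_section_refl: "S \<subseteq> carrier G \<Longrightarrow> pi_section G p s S S"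
  unfolding pi_section_def by (auto intro!: exI[of _ "1::nat"])

lemma pi_section_trans:
  assumes "pi_section G p s S N" "pi_section G p s N L" "S \<subseteq> carrier G"
  shows "pi_section G p s S L"
  unfolding pi_section_def
proof
  fix g assume g: "g \<in> S"
  then obtain n where n: "pi_number p s n" "g [^] n \<in> N" using assms(1) unfolding pi_section_def by blast
  then obtain m where m: "pi_number p s m" "(g [^] n) [^] m \<in> L" using assms(2) unfolding pi_section_def by blast
  show "\<exists>n. pi_number p s n \<and> g [^] n \<in> L"
    using n m g assms(3) by (intro exI[of _ "n * m"]) (auto simp: nat_pow_pow pi_number_mult)
qed

lemma subgroup_pow: "subgroup H G \<Longrightarrow> x \<in> H \<Longrightarrow> x [^] (n::nat) \<in> H"
  by (induction n) (auto simp: subgroup.one_closed subgroup.m_closed)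

text \<open>Bezout writes \<open>x\<close> as a quotient of powers of the two given elements of
  \<open>H\<close>.\<close>

lemma coprime_pow_mem:
  assumes H: "subgroup H G" and x: "x \<in> carrier G" and "x [^] (a::nat) \<in> H" "x [^] (b::nat) \<in> H" "coprime a b"
  shows "x \<in> H"
\<comment> \<open>Bezout over the natural numbers asks for a nonzero \<open>a\<close>; for
  \<open>a = 0\<close> coprimality forces \<open>b = 1\<close>.\<close>
proof (cases "a = 0")
  case True
  then have "b = 1" using assms(5) by simp
  then show ?thesis using assms(4) x by simp
next
  case False
  then obtain u v where uv: "a * u = b * v + 1"
    using coprime_bezout_strong[of a b] assms(5) bezout_nat[of a b] by auto
  have "x [^] (a * u) \<in> H" using subgroup_pow[OF H assms(3), of u] x by (simp add: nat_pow_pow)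
  moreover have "x [^] (b * v) \<in> H" using subgroup_pow[OF H assms(4), of v] x by (simp add: nat_pow_pow)
  moreover have "x = inv (x [^] (b * v)) \<otimes> x [^] (a * u)"
    using x by (simp add: uv flip: nat_pow_mult)
  ultimately show ?thesis using H by (metis subgroup.m_closed subgroup.m_inv_closed)
qed

lemma pi_section_opposite:
  assumes "pi_section G p s S N" "subgroup N G" "S \<subseteq> carrier G" "g \<in> S" "pi_number p (\<not> s) n" "g [^] n \<in> N"
  shows "g \<in> N"
proof -
  obtain m where "pi_number p s m" "g [^] m \<in> N" using assms unfolding pi_section_def by blast
  then show ?thesis using coprime_pow_mem[OF assms(2), of g m n] pi_number_opposite_coprime assms by blast
qed

lemma cauchy:
  assumes fin: "finite (carrier G)" and q: "Factorial_Ring.prime (q::nat)" "q dvd order G"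
  shows "\<exists>x\<in>carrier G. x \<noteq> \<one> \<and> x [^] q = \<one>"
proof -
  obtain m where m: "order G = q ^ 1 * m" using q(2) by auto
  obtain H where H: "subgroup H G" "card H = q ^ 1" using sylow_thm[OF q(1) is_group m fin] by blast
  interpret H: subgroup H G by fact
  have "card H > 1" using H(2) prime_gt_1_nat[OF q(1)] by simp
  then have "H \<noteq> {\<one>}" by auto
  then obtain x where x: "x \<in> H" "x \<noteq> \<one>" using H.one_closed by blast
  interpret HG: group "G\<lparr>carrier := H\<rparr>" by (rule H.subgroup_is_group[OF is_group])
  have "x [^]\<^bsub>G\<lparr>carrier := H\<rparr>\<^esub> order (G\<lparr>carrier := H\<rparr>) = \<one>\<^bsub>G\<lparr>carrier := H\<rparr>\<^esub>"
    by (rule HG.pow_order_eq_1) (use x in simp)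
  then have "x [^] q = \<one>" using H(2) by (simp add: order_def nat_pow_def)
  with x show ?thesis by auto
qed

lemma coset_pow:
  assumes "N \<lhd> G" "g \<in> carrier G"
  shows "(N #> g) [^]\<^bsub>G Mod N\<^esub> (n::nat) = N #> (g [^] n)"
  using normal.FactGroup_pow[OF assms] .

text \<open>For a prime divisor q of the index, Cauchy's theorem in the quotient gives an element
  outside \<open>N\<close> whose q-th power lies in \<open>N\<close>. Its exponent from the section
  therefore cannot be coprime to q.\<close>

lemma pi_section_index:
  assumes fin: "finite (carrier G)" and N: "N \<lhd> G" and p: "Factorial_Ring.prime p"
    and pi_section: "pi_section G p s (carrier G) N"
  shows "pi_number p s (card (rcosets N))"
proof -
  interpret N: normal N G by fact
  interpret Q: group "G Mod N" by (rule N.factorgroup_is_group)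
  have sN: "subgroup N G" by (rule N.subgroup_axioms)
  have finQ: "finite (carrier (G Mod N))" using fin by (simp add: FactGroup_def RCOSETS_def)
  have oQ: "order (G Mod N) = card (rcosets N)" by (simp add: order_def FactGroup_def)
  \<comment> \<open>One statement serves both kinds of section: if \<open>s\<close> holds, every
    prime divisor \<open>q\<close> is \<open>p\<close>; otherwise it is applied to
    \<open>q = p\<close> and says that \<open>p\<close> does not divide the index.\<close>
  have key: "q = p \<longleftrightarrow> s" if q: "Factorial_Ring.prime q" "q dvd card (rcosets N)" and "s \<or> q = p" for q
  proof -
    obtain R where R: "R \<in> carrier (G Mod N)" "R \<noteq> N" "R [^]\<^bsub>G Mod N\<^esub> q = N"
      using Q.cauchy[OF finQ q(1)] q(2) oQ by auto
    then obtain g where g: "g \<in> carrier G" "R = N #> g" by (auto simp: carrier_FactGroup)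
    have gq: "g [^] q \<in> N"
      using R(3) g coset_pow[OF N g(1)]
      by (metis nat_pow_closed rcos_self sN)
    have gN: "g \<notin> N" using R(2) g coset_join2[OF _ sN] by blast
    obtain n where n: "pi_number p s n" "g [^] n \<in> N" using pi_section g(1) unfolding pi_section_def by blast
    have "\<not> coprime n q" using coprime_pow_mem[OF sN g(1) n(2) gq] gN by blast
    moreover have "p = q \<or> coprime p q" using primes_coprime[OF p q(1)] by blast
    ultimately show ?thesis
      using n(1) that(3) unfolding pi_number_def by (auto split: if_splits simp: coprime_commute)
  qed
  have pos: "card (rcosets N) > 0" using oQ finQ Q.order_gt_0_iff_finite by simp
  show ?thesis
  proof (cases s)
    case True
    then show ?thesis using prime_power_of_unique_prime[OF pos, of p] key unfolding pi_number_def by auto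
  next
    case False
    then show ?thesis using key[OF p] p unfolding pi_number_def by (auto intro: prime_imp_coprime)
  qed
qed

lemma index_pi_section:
  assumes fin: "finite (carrier G)" and N: "N \<lhd> G" and i: "pi_number p s (card (rcosets N))"
  shows "pi_section G p s (carrier G) N"
  unfolding pi_section_def
proof
  fix g assume g: "g \<in> carrier G"
  interpret N: normal N G by fact
  interpret Q: group "G Mod N" by (rule N.factorgroup_is_group)
  have "(N #> g) [^]\<^bsub>G Mod N\<^esub> order (G Mod N) = N"
    using Q.pow_order_eq_1[of "N #> g"] g by (auto simp: carrier_FactGroup)
  then have "N #> (g [^] card (rcosets N)) = N" using coset_pow[OF N g] by (simp add: order_def FactGroup_def)
  then have "g [^] card (rcosets N) \<in> N" using rcos_self[OF _ N.subgroup_axioms, of "g [^] card (rcosets N)"] g by auto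
  then show "\<exists>n. pi_number p s n \<and> g [^] n \<in> N" using i by blast
qed

lemma pi_section_one_card:
  assumes fin: "finite (carrier G)" and H: "subgroup H G" and p: "Factorial_Ring.prime p"
  shows "pi_section G p s H {\<one>} \<longleftrightarrow> pi_number p s (card H)"
proof -
  interpret H: subgroup H G by fact
  interpret HG: group "G\<lparr>carrier := H\<rparr>" by (rule H.subgroup_is_group[OF is_group])
  have finH: "finite H" using fin H.subset finite_subset by blast
  have "card (rcosets\<^bsub>G\<lparr>carrier := H\<rparr>\<^esub> {\<one>}) = card H"
    using HG.lagrange[OF HG.triv_subgroup] by (simp add: order_def)
  moreover have "{\<one>} \<lhd> G\<lparr>carrier := H\<rparr>" using HG.one_is_normal by simp
  ultimately show ?thesis
    using HG.pi_section_index[of "{\<one>}" p s] HG.index_pi_section[of "{\<one>}" p s] finH p by auto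
qed

text \<open>The dictionary to exponents: in this form a normal p-complement can be restricted,
  intersected and mapped to quotients elementwise.\<close>

lemma p_nilpotent_iff:
  assumes fin: "finite (carrier G)" and p: "Factorial_Ring.prime p"
  shows "p_nilpotent p G \<longleftrightarrow> (\<exists>S. S \<lhd> G \<and> pi_section G p False S {\<one>} \<and> pi_section G p True (carrier G) S)"
proof -
  have "(\<not> p dvd card S \<and> (\<exists>k. order G = card S * p ^ k)) \<longleftrightarrow>
      pi_section G p False S {\<one>} \<and> pi_section G p True (carrier G) S" if S: "S \<lhd> G" for S
  proof -
    interpret S: normal S G by fact
    have cS: "card S > 0" using fin S.subset S.one_closed by (metis card_gt_0_iff empty_iff finite_subset)
    have lag: "order G = card (rcosets S) * card S" using lagrange[OF S.subgroup_axioms] by simp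
    have "pi_section G p False S {\<one>} \<longleftrightarrow> \<not> p dvd card S"
      using pi_section_one_card[OF fin S.subgroup_axioms p, of False] p unfolding pi_number_def
      by (metis (full_types) coprime_absorb_left not_prime_unit prime_imp_coprime)
    moreover have "pi_section G p True (carrier G) S \<longleftrightarrow> (\<exists>k. order G = card S * p ^ k)"
      using pi_section_index[OF fin S p, of True] index_pi_section[OF fin S, of p True] lag cS unfolding pi_number_def by auto
    ultimately show ?thesis by blast
  qed
  then show ?thesis unfolding p_nilpotent_def by blast
qed

section \<open>Sylow subgroups of subgroups, and conjugation of subsets\<close>

definition sylow_in :: "nat \<Rightarrow> 'a set \<Rightarrow> 'a set \<Rightarrow> bool" where
  "sylow_in q T H \<longleftrightarrow> subgroup T G \<and> T \<subseteq> H \<and> (\<exists>k m. card T = q ^ k \<and> card H = q ^ k * m \<and> \<not> q dvd m)"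

definition conj_set :: "'a \<Rightarrow> 'a set \<Rightarrow> 'a set" where
  "conj_set g S = (\<lambda>x. g \<otimes> x \<otimes> inv g) ` S"

lemma subgroup_pos_card:
  assumes "finite (carrier G)" "subgroup H G" shows "card H > 0" "finite H"
  using assms by (metis card_gt_0_iff empty_iff finite_subset subgroup.one_closed subgroup.subset)+

lemma subgroup_dvd:
  assumes "finite (carrier G)" "subgroup H G" "subgroup L G" "L \<subseteq> H" shows "card L dvd card H"
proof -
  interpret HG: group "G\<lparr>carrier := H\<rparr>" by (rule subgroup.subgroup_is_group[OF assms(2) is_group])
  have "subgroup L (G\<lparr>carrier := H\<rparr>)" using subgroup_incl[OF assms(3,2,4)] .
  then have "card (rcosets\<^bsub>G\<lparr>carrier := H\<rparr>\<^esub> L) * card L = card H" using HG.lagrange by (simp add: order_def)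
  then show ?thesis by (rule dvdI[OF sym[OF trans[OF mult.commute]]])
qed

lemma sylow_in_exists:
  assumes fin: "finite (carrier G)" and H: "subgroup H G" and q: "Factorial_Ring.prime q"
  shows "\<exists>T. sylow_in q T H"
proof -
  have g: "group (G\<lparr>carrier := H\<rparr>)" by (rule subgroup.subgroup_is_group[OF H is_group])
  note cH = subgroup_pos_card[OF fin H]
  obtain m where m: "card H = q ^ multiplicity q (card H) * m" "\<not> q dvd m"
    using multiplicity_decompose'[of "card H" q] q cH by (metis less_numeral_extra(3) not_prime_unit)
  obtain T where T: "subgroup T (G\<lparr>carrier := H\<rparr>)" "card T = q ^ multiplicity q (card H)"
    using sylow_thm[OF q g, of "multiplicity q (card H)" m] m cH by (auto simp: order_def)
  have "subgroup T G" "T \<subseteq> H" using incl_subgroup[OF H T(1)] subgroup.subset[OF T(1)] by simp_all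
  then have "sylow_in q T H" unfolding sylow_in_def using T(2) m by blast
  then show ?thesis by blast
qed

lemma sylow_in_absorbs:
  assumes fin: "finite (carrier G)" and H: "subgroup H G" and q: "Factorial_Ring.prime q"
    and T: "sylow_in q T H" and Q: "subgroup Q G" "Q \<subseteq> H" "card Q = q ^ k"
  shows "\<exists>h\<in>H. conj_set h Q \<subseteq> T"
proof -
  interpret HG: group "G\<lparr>carrier := H\<rparr>" by (rule subgroup.subgroup_is_group[OF H is_group])
  note cH = subgroup_pos_card[OF fin H]
  obtain j m where jm: "card T = q ^ j" "card H = q ^ j * m" "\<not> q dvd m" and sT: "subgroup T G" "T \<subseteq> H"
    using T unfolding sylow_in_def by blast
  have sT': "subgroup T (G\<lparr>carrier := H\<rparr>)" "subgroup Q (G\<lparr>carrier := H\<rparr>)"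
    using subgroup_incl H sT Q by blast+
  have "card (rcosets\<^bsub>G\<lparr>carrier := H\<rparr>\<^esub> T) = m"
    using HG.lagrange[OF sT'(1)] jm q by (simp add: order_def prime_gt_0_nat)
  then obtain h where h: "h \<in> H" "\<forall>x\<in>Q. h \<otimes> x \<otimes> inv\<^bsub>G\<lparr>carrier := H\<rparr>\<^esub> h \<in> T"
    using sylow_conj[OF HG.is_group _ q sT'(2) Q(3) sT'(1)] cH jm(3) by auto
  then show ?thesis unfolding conj_set_def using m_inv_consistent[OF H] by auto
qed

lemma inj_on_conj: "g \<in> carrier G \<Longrightarrow> S \<subseteq> carrier G \<Longrightarrow> inj_on (\<lambda>x. g \<otimes> x \<otimes> inv g) S"
  by (rule inj_onI) (simp add: subset_iff)

lemma card_conj_set: "g \<in> carrier G \<Longrightarrow> S \<subseteq> carrier G \<Longrightarrow> card (conj_set g S) = card S"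
  unfolding conj_set_def by (rule card_image) (rule inj_on_conj)

lemma conj_set_conj_set:
  assumes "g \<in> carrier G" "h \<in> carrier G" "S \<subseteq> carrier G" shows "conj_set g (conj_set h S) = conj_set (g \<otimes> h) S"
  unfolding conj_set_def image_image
  by (rule image_cong[OF refl]) (use assms in \<open>auto simp: subset_iff m_assoc inv_mult_group\<close>)

lemma conj_set_one: "S \<subseteq> carrier G \<Longrightarrow> conj_set \<one> S = S"
  unfolding conj_set_def by (force simp: subset_iff image_iff)

lemma conj_set_closed: "g \<in> carrier G \<Longrightarrow> S \<subseteq> carrier G \<Longrightarrow> conj_set g S \<subseteq> carrier G"
  unfolding conj_set_def by auto

lemma conj_set_eqI:
  assumes "finite S" "g \<in> carrier G" "S \<subseteq> carrier G" "conj_set g S \<subseteq> S" shows "conj_set g S = S"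
  using assms card_conj_set card_subset_eq by metis

lemma subgroup_conj_set:
  assumes g: "g \<in> carrier G" and S: "subgroup S G" shows "subgroup (conj_set g S) G"
proof (rule subgroupI)
  interpret S: subgroup S G by fact
  show "conj_set g S \<subseteq> carrier G" using g S.subset by (rule conj_set_closed)
  show "conj_set g S \<noteq> {}" unfolding conj_set_def using S.one_closed by blast
  fix x assume "x \<in> conj_set g S"
  then obtain s where s: "s \<in> S" "x = g \<otimes> s \<otimes> inv g" unfolding conj_set_def by blast
  then have "inv x = g \<otimes> inv s \<otimes> inv g" using g by (simp add: m_assoc inv_mult_group)
  then show "inv x \<in> conj_set g S" unfolding conj_set_def using s by blast
  fix y assume "y \<in> conj_set g S"
  then obtain t where t: "t \<in> S" "y = g \<otimes> t \<otimes> inv g" unfolding conj_set_def by blast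
  then have "x \<otimes> y = g \<otimes> (s \<otimes> t) \<otimes> inv g" using g s by (simp add: m_assoc)
  then show "x \<otimes> y \<in> conj_set g S" unfolding conj_set_def using s t by blast
qed

lemma sylow_in_conj_set:
  assumes "subgroup H G" "sylow_in q T H" "g \<in> carrier G" "conj_set g H \<subseteq> H"
  shows "sylow_in q (conj_set g T) H"
proof -
  have "conj_set g T \<subseteq> conj_set g H" using assms(2) unfolding sylow_in_def conj_set_def by blast
  moreover have "card (conj_set g T) = card T"
    using assms card_conj_set unfolding sylow_in_def by (meson subgroup.subset)
  ultimately show ?thesis using assms subgroup_conj_set unfolding sylow_in_def by (metis subset_trans)
qed

lemma subgroup_conj_set_self:
  assumes "subgroup H G" "h \<in> H" shows "conj_set h H \<subseteq> H"
  using assms unfolding conj_set_def by (auto simp: subgroup.m_closed subgroup.m_inv_closed)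

lemma sylow_in_conjugate:
  assumes fin: "finite (carrier G)" and H: "subgroup H G" and q: "Factorial_Ring.prime q"
    and T: "sylow_in q T H" "sylow_in q S H"
  shows "\<exists>h\<in>H. conj_set h T = S"
proof -
  obtain j m where jm: "card T = q ^ j" "card H = q ^ j * m" "\<not> q dvd m" and sT: "subgroup T G" "T \<subseteq> H"
    using T unfolding sylow_in_def by blast
  obtain j' m' where jm': "card S = q ^ j'" "card H = q ^ j' * m'" "\<not> q dvd m'" and sS: "subgroup S G" "S \<subseteq> H"
    using T unfolding sylow_in_def by blast
  \<comment> \<open>Compares the \<open>q\<close>-parts of two factorizations of one number; used in
    both directions it shows that \<open>T\<close> and \<open>S\<close> have equal order.\<close>
  have le: "a \<le> b" if "q ^ a * u = q ^ b * v" "\<not> q dvd v" for a b u v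
  proof -
    have "coprime (q ^ a) v" using that(2) q by (simp add: prime_imp_coprime)
    moreover have "q ^ a dvd q ^ b * v" using that(1) by (metis dvd_triv_left)
    ultimately have "q ^ a dvd q ^ b" by (simp add: coprime_dvd_mult_left_iff)
    then show ?thesis using prime_gt_1_nat[OF q] power_dvd_imp_le by blast
  qed
  have "j = j'" using le[of j m j' m'] le[of j' m' j m] jm jm' by simp
  then have "card T = card S" using jm jm' by simp
  moreover obtain h where h: "h \<in> H" "conj_set h T \<subseteq> S" using sylow_in_absorbs[OF fin H q T(2) sT jm(1)] by blast
  moreover have "card (conj_set h T) = card T"
    using card_conj_set h sT H by (meson subgroup.mem_carrier subgroup.subset)
  moreover have "finite S" using subgroup_pos_card[OF fin sS(1)] by simp
  ultimately show ?thesis using card_subset_eq by metis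
qed

text \<open>A prime dividing the index of \<open>D\<close> would contradict that \<open>D\<close>
  contains a subgroup carrying the full part of \<open>card H\<close> at that prime. Equality with
  \<open>H\<close> can thus be tested on one Sylow subgroup for each prime.\<close>

lemma subgroup_eq_of_sylow_in:
  assumes fin: "finite (carrier G)" and H: "subgroup H G" and D: "subgroup D G" "D \<subseteq> H"
    and sylow_in: "\<And>q. Factorial_Ring.prime q \<Longrightarrow> q dvd card H \<Longrightarrow> \<exists>T. sylow_in q T H \<and> T \<subseteq> D"
  shows "D = H"
proof -
  note cH = subgroup_pos_card[OF fin H]
  obtain m where m: "card H = card D * m" using subgroup_dvd[OF fin H D] by blast
  have "m = 1"
  proof (rule ccontr)
    assume "m \<noteq> 1"
    then obtain q where q: "Factorial_Ring.prime q" "q dvd m" using prime_factor_nat by blast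
    then obtain T where T: "sylow_in q T H" "T \<subseteq> D" using sylow_in[OF q(1)] m by auto
    then obtain k m' where km: "card T = q ^ k" "card H = q ^ k * m'" "\<not> q dvd m'" "subgroup T G"
      unfolding sylow_in_def by blast
    then obtain c where c: "card D = card T * c" using subgroup_dvd[OF fin D(1) km(4) T(2)] by blast
    have "q ^ k * m' = q ^ k * (c * m)" using m[unfolded c km(1)] km(2) by (simp only: mult.assoc)
    moreover have "q ^ k \<noteq> 0" using prime_gt_0_nat[OF q(1)] by simp
    ultimately have "m' = c * m" by (metis mult_left_cancel)
    with q(2) km(3) show False by simp
  qed
  then have "card D = card H" using m by simp
  then show ?thesis by (rule card_subset_eq[OF cH(2) D(2)])
qed

end

section \<open>Good actions\<close>

locale finite_good_action = G: group G + A: group A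
  for G :: "('a, 'd) monoid_scheme" (structure) and A :: "('b, 'c) monoid_scheme" and phi :: "'b \<Rightarrow> 'a \<Rightarrow> 'a" +
  assumes finG: "finite (carrier G)" and finA: "finite (carrier A)"
    and aut: "aut_action A G phi" and good: "good_action A G phi"
begin

lemma phi_closed [simp]: "a \<in> carrier A \<Longrightarrow> h \<in> carrier G \<Longrightarrow> phi a h \<in> carrier G"
  using aut unfolding aut_action_def iso_def hom_def by blast

lemma phi_mult: "a \<in> carrier A \<Longrightarrow> h \<in> carrier G \<Longrightarrow> k \<in> carrier G \<Longrightarrow> phi a (h \<otimes> k) = phi a h \<otimes> phi a k"
  using aut unfolding aut_action_def iso_def hom_def by blast

lemma phi_comp: "a \<in> carrier A \<Longrightarrow> b \<in> carrier A \<Longrightarrow> h \<in> carrier G \<Longrightarrow> phi (a \<otimes>\<^bsub>A\<^esub> b) h = phi a (phi b h)"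
  using aut unfolding aut_action_def by blast

lemma phi_id: "h \<in> carrier G \<Longrightarrow> phi \<one>\<^bsub>A\<^esub> h = h"
  using aut unfolding aut_action_def by blast

lemma phi_hom: "a \<in> carrier A \<Longrightarrow> group_hom G G (phi a)"
  unfolding group_hom_def group_hom_axioms_def hom_def using phi_mult by auto

lemma phi_one [simp]: "a \<in> carrier A \<Longrightarrow> phi a \<one> = \<one>"
  using group_hom.hom_one[OF phi_hom] .

lemma phi_inv: "a \<in> carrier A \<Longrightarrow> h \<in> carrier G \<Longrightarrow> phi a (inv h) = inv (phi a h)"
  using group_hom.hom_inv[OF phi_hom] .

lemma phi_inverse [simp]:
  "a \<in> carrier A \<Longrightarrow> h \<in> carrier G \<Longrightarrow> phi (inv\<^bsub>A\<^esub> a) (phi a h) = h"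
  "a \<in> carrier A \<Longrightarrow> h \<in> carrier G \<Longrightarrow> phi a (phi (inv\<^bsub>A\<^esub> a) h) = h"
  using phi_comp[of "inv\<^bsub>A\<^esub> a" a h] phi_comp[of a "inv\<^bsub>A\<^esub> a" h] by (auto simp: phi_id)

definition A_invariant :: "'a set \<Rightarrow> bool" where
  "A_invariant H \<longleftrightarrow> subgroup H G \<and> (\<forall>a\<in>carrier A. \<forall>h\<in>H. phi a h \<in> H)"

definition fixed_pts :: "'b \<Rightarrow> 'a set" where
  "fixed_pts a = {g \<in> carrier G. phi a g = g}"

text \<open>This is the commutator group of G with the cyclic group of \<open>x\<close>: a
  displacement under a power of \<open>x\<close> is a product of displacements under
  \<open>x\<close> itself.\<close>

definition comm_with :: "'b \<Rightarrow> 'a set" where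
  "comm_with x = generate G {inv g \<otimes> phi x g |g. g \<in> carrier G}"

lemma A_invariantD: "A_invariant H \<Longrightarrow> subgroup H G" "A_invariant H \<Longrightarrow> a \<in> carrier A \<Longrightarrow> h \<in> H \<Longrightarrow> phi a h \<in> H"
  unfolding A_invariant_def by auto

lemma A_invariant_carrier: "A_invariant (carrier G)"
  unfolding A_invariant_def using G.subgroup_self by auto

lemma phi_image: "A_invariant H \<Longrightarrow> a \<in> carrier A \<Longrightarrow> phi a ` H = H"
proof
  assume H: "A_invariant H" and a: "a \<in> carrier A"
  show "phi a ` H \<subseteq> H" using A_invariantD[OF H] a by blast
  show "H \<subseteq> phi a ` H"
  proof
    fix h assume h: "h \<in> H"
    then have "h = phi a (phi (inv\<^bsub>A\<^esub> a) h)" using a A_invariantD(1)[OF H] by (simp add: subgroup.mem_carrier)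
    then show "h \<in> phi a ` H" using A_invariantD(2)[OF H, of "inv\<^bsub>A\<^esub> a" h] a h by auto
  qed
qed

lemma fixed_pts_subgroup: "a \<in> carrier A \<Longrightarrow> subgroup (fixed_pts a) G"
  by (rule G.subgroupI) (auto simp: fixed_pts_def phi_mult phi_inv intro: exI[of _ \<one>])

lemma stabilizer_subgroup: "h \<in> carrier G \<Longrightarrow> subgroup {a \<in> carrier A. phi a h = h} A"
proof (rule A.subgroup_finI[OF finA])
  assume h: "h \<in> carrier G"
  show "{a \<in> carrier A. phi a h = h} \<noteq> {}" using phi_id[OF h] by blast
qed (auto simp: phi_comp)

lemma set_mult_subset: "subgroup D G \<Longrightarrow> S \<subseteq> D \<Longrightarrow> T \<subseteq> D \<Longrightarrow> S <#> T \<subseteq> D"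
  unfolding set_mult_def using subgroup.m_closed[of D G] by blast

lemma all_fixed_subgroup: "subgroup {h \<in> carrier G. \<forall>a\<in>carrier A. phi a h = h} G"
  by (rule G.subgroup_finI[OF finG]) (auto simp: phi_mult intro!: exI[of _ \<one>])

text \<open>The working form of goodness for the cyclic group of \<open>a\<close>. The elements of A
  that preserve \<open>H\<close> and displace it into \<open>D\<close> form a subgroup, so checking
  \<open>a\<close> is enough; then both factors of \<open>H\<close> lie in \<open>D\<close>.\<close>

lemma good_gen:
  assumes a: "a \<in> carrier A" and H: "subgroup H G" and Hi: "\<And>h. h \<in> H \<Longrightarrow> phi a h \<in> H"
    and D: "subgroup D G" and c: "\<And>h. h \<in> H \<Longrightarrow> inv h \<otimes> phi a h \<in> D"
    and f: "\<And>h. h \<in> H \<Longrightarrow> phi a h = h \<Longrightarrow> h \<in> D"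
  shows "H \<subseteq> D"
proof -
  interpret H: subgroup H G by fact
  interpret D: subgroup D G by fact
  let ?B = "generate A {a}"
  let ?S = "{b \<in> carrier A. \<forall>h\<in>H. phi b h \<in> H \<and> inv h \<otimes> phi b h \<in> D}"
  have sB: "subgroup ?B A" using a A.generate_is_subgroup by simp
  have "subgroup ?S A"
  proof (rule A.subgroup_finI[OF finA])
    show "?S \<noteq> {}" using a c Hi by blast
    fix b b' assume b: "b \<in> ?S" "b' \<in> ?S"
    have "inv h \<otimes> phi (b \<otimes>\<^bsub>A\<^esub> b') h \<in> D" if h: "h \<in> H" for h
    proof -
      have "(inv h \<otimes> phi b' h) \<otimes> (inv (phi b' h) \<otimes> phi b (phi b' h)) \<in> D"
        by (rule D.m_closed) (use b h in auto)
      then show ?thesis using b h by (simp add: phi_comp G.m_assoc)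
    qed
    then show "b \<otimes>\<^bsub>A\<^esub> b' \<in> ?S" using b by (auto simp: phi_comp)
  qed auto
  then have BS: "?B \<subseteq> ?S" using A.generate_subgroup_incl[of "{a}" ?S] a c Hi by blast
  have "comm_act G phi H ?B \<subseteq> D"
    unfolding comm_act_def by (rule G.generate_subgroup_incl[OF _ D]) (use BS in auto)
  moreover have "fixed_by phi H ?B \<subseteq> D"
    unfolding fixed_by_def using f generate.incl[of a "{a}" A] by blast
  moreover have eq: "H = comm_act G phi H ?B <#> fixed_by phi H ?B"
    using good sB H BS unfolding good_action_def by blast
  ultimately show ?thesis using set_mult_subset[OF D] eq by metis
qed

lemma good_gen_all:
  assumes H: "A_invariant H"
    and D: "subgroup D G" and c: "\<And>a h. a \<in> carrier A \<Longrightarrow> h \<in> H \<Longrightarrow> inv h \<otimes> phi a h \<in> D"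
    and f: "\<And>h. h \<in> H \<Longrightarrow> (\<And>a. a \<in> carrier A \<Longrightarrow> phi a h = h) \<Longrightarrow> h \<in> D"
  shows "H \<subseteq> D"
proof -
  interpret D: subgroup D G by fact
  have "comm_act G phi H (carrier A) \<subseteq> D"
    unfolding comm_act_def by (rule G.generate_subgroup_incl[OF _ D]) (use c in auto)
  moreover have "fixed_by phi H (carrier A) \<subseteq> D"
    unfolding fixed_by_def using f by blast
  moreover have eq: "H = comm_act G phi H (carrier A) <#> fixed_by phi H (carrier A)"
    using good A.subgroup_self A_invariantD[OF H] unfolding good_action_def by blast
  ultimately show ?thesis using set_mult_subset[OF D] eq by metis
qed

text \<open>Goodness quantifies over all invariant subgroups and hence is inherited; what remains is
  that inverses and generated subgroups computed in \<open>H\<close> agree with those in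
  \<open>G\<close>.\<close>

lemma restrict: assumes H: "A_invariant H" shows "finite_good_action (G\<lparr>carrier := H\<rparr>) A phi"
proof -
  have sH: "subgroup H G" by (rule A_invariantD(1)[OF H])
  interpret H: subgroup H G by fact
  interpret HG: group "G\<lparr>carrier := H\<rparr>" by (rule H.subgroup_is_group[OF G.is_group])
  have "finite H" using finG H.subset finite_subset by blast
  have aut': "aut_action A (G\<lparr>carrier := H\<rparr>) phi"
    unfolding aut_action_def
  proof (intro conjI ballI)
    fix a assume a: "a \<in> carrier A"
    have "inj_on (phi a) H" by (rule inj_on_inverseI[of _ "phi (inv\<^bsub>A\<^esub> a)"]) (use a in simp)
    then show "phi a \<in> iso (G\<lparr>carrier := H\<rparr>) (G\<lparr>carrier := H\<rparr>)"
      unfolding iso_def hom_def bij_betw_def using phi_image[OF H a] A_invariantD(2)[OF H a] a by (auto simp: phi_mult)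
  qed (auto simp: phi_id phi_comp)
  have good': "good_action A (G\<lparr>carrier := H\<rparr>) phi"
    unfolding good_action_def
  proof (intro allI impI)
    fix B L assume B: "subgroup B A" "subgroup L (G\<lparr>carrier := H\<rparr>)" "\<forall>b\<in>B. phi b ` L \<subseteq> L"
    have L: "subgroup L G" "L \<subseteq> H" using G.incl_subgroup[OF sH B(2)] subgroup.subset[OF B(2)] by auto
    have "L = comm_act G phi L B <#> fixed_by phi L B" using good B L unfolding good_action_def by blast
    moreover have "comm_act (G\<lparr>carrier := H\<rparr>) phi L B = comm_act G phi L B"
    proof -
      have *: "inv\<^bsub>G\<lparr>carrier := H\<rparr>\<^esub> h = inv h" if "h \<in> L" for h
        using L(2) G.m_inv_consistent[OF sH] that by blast
      have eq: "{inv\<^bsub>G\<lparr>carrier := H\<rparr>\<^esub> h \<otimes>\<^bsub>G\<lparr>carrier := H\<rparr>\<^esub> phi b h |h b. h \<in> L \<and> b \<in> B} =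
          {inv h \<otimes> phi b h |h b. h \<in> L \<and> b \<in> B}"
        by (intro Collect_cong ex_cong1) (auto simp: *)
      have sub: "{inv h \<otimes> phi b h |h b. h \<in> L \<and> b \<in> B} \<subseteq> H"
        using L B(1) A_invariantD(2)[OF H] subgroup.subset[OF B(1)] by (auto intro!: H.m_closed)
      show ?thesis unfolding comm_act_def eq using G.generate_consistent[OF sub sH] by simp
    qed
    ultimately show "L = comm_act (G\<lparr>carrier := H\<rparr>) phi L B <#>\<^bsub>G\<lparr>carrier := H\<rparr>\<^esub> fixed_by phi L B" by simp
  qed
  show ?thesis
    by unfold_locales (use \<open>finite H\<close> finA aut' good' in auto)
qed

text \<open>Lifting of fixed points with goodness in place of coprime orders. In the group of all
  elements that \<open>a\<close> fixes modulo \<open>N\<close> every displacement lies in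
  \<open>N\<close>, so goodness splits this group into \<open>N\<close> and fixed points.\<close>

lemma fixed_lift:
  assumes a: "a \<in> carrier A" and N: "N \<lhd> G" "\<And>n. n \<in> N \<Longrightarrow> phi a n \<in> N"
    and g: "g \<in> carrier G" "inv g \<otimes> phi a g \<in> N"
  shows "\<exists>n\<in>N. \<exists>c\<in>fixed_pts a. g = n \<otimes> c"
proof -
  interpret N: normal N G by fact
  define H where "H = {g \<in> carrier G. inv g \<otimes> phi a g \<in> N}"
  have sH: "subgroup H G"
  proof (rule G.subgroup_finI[OF finG])
    show "H \<subseteq> carrier G" "H \<noteq> {}" unfolding H_def using a by (auto intro!: exI[of _ \<one>])
    fix x y assume xy: "x \<in> H" "y \<in> H"
    then have xyG: "x \<in> carrier G" "y \<in> carrier G" unfolding H_def by auto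
    have "(inv y \<otimes> (inv x \<otimes> phi a x) \<otimes> y) \<otimes> (inv y \<otimes> phi a y) \<in> N"
      by (rule N.m_closed[OF N.inv_op_closed1]) (use xy in \<open>auto simp: H_def\<close>)
    then show "x \<otimes> y \<in> H"
      using xyG a unfolding H_def by (simp add: phi_mult G.m_assoc G.inv_mult_group)
  qed
  have "H \<subseteq> N <#> fixed_pts a"
  proof (rule good_gen[OF a sH])
    show "subgroup (N <#> fixed_pts a) G"
      by (rule G.mult_norm_subgroup[OF N(1) fixed_pts_subgroup[OF a]])
    show "phi a h \<in> H" if "h \<in> H" for h
    proof -
      have h: "h \<in> carrier G" "inv h \<otimes> phi a h \<in> N" using that unfolding H_def by auto
      have "phi a (inv h \<otimes> phi a h) \<in> N" using h N(2) by blast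
      then show ?thesis using h a unfolding H_def by (simp add: phi_mult phi_inv)
    qed
    have one: "\<one> \<in> fixed_pts a" using a by (simp add: fixed_pts_def)
    fix h assume h: "h \<in> H"
    then have hG: "h \<in> carrier G" unfolding H_def by auto
    have n: "inv h \<otimes> phi a h \<in> N" using h unfolding H_def by simp
    have "(inv h \<otimes> phi a h) \<otimes> \<one> \<in> N <#> fixed_pts a" unfolding set_mult_def using n one by blast
    then show "inv h \<otimes> phi a h \<in> N <#> fixed_pts a" using hG a by simp
    assume "phi a h = h"
    then have "\<one> \<otimes> h \<in> N <#> fixed_pts a"
      unfolding set_mult_def fixed_pts_def using hG N.one_closed by blast
    then show "h \<in> N <#> fixed_pts a" using hG by simp
  qed
  moreover have "g \<in> H" using g unfolding H_def by simp
  ultimately show ?thesis unfolding set_mult_def by blast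
qed

lemma phi_coset:
  assumes N: "A_invariant N" and a: "a \<in> carrier A" and g: "g \<in> carrier G"
  shows "phi a ` (N #> g) = N #> phi a g"
proof -
  have sub: "N \<subseteq> carrier G" using A_invariantD(1)[OF N] subgroup.subset by blast
  have "phi a ` (N #> g) = (phi a ` N) #> phi a g"
    unfolding r_coset_def using a g sub by (force simp: phi_mult)
  then show ?thesis using phi_image[OF N a] by simp
qed

lemma fixed_coset_lift:
  assumes a: "a \<in> carrier A" and N: "N \<lhd> G" "A_invariant N"
    and g: "g \<in> carrier G" and f: "phi a ` (N #> g) = N #> g"
  shows "\<exists>c\<in>fixed_pts a. N #> g = N #> c"
proof -
  interpret N: normal N G by (rule N(1))
  have "N #> phi a g = N #> g" using phi_coset[OF N(2) a g] f by simp
  then have "phi a g \<otimes> inv g \<in> N" using G.r_coset_eq_iff[OF N.subgroup_axioms, of "phi a g" g] g a by simp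
  then have "inv g \<otimes> (phi a g \<otimes> inv g) \<otimes> g \<in> N" by (rule N.inv_op_closed1[OF g])
  then have "inv g \<otimes> phi a g \<in> N" using g a by (simp add: G.m_assoc)
  from fixed_lift[OF a N(1) A_invariantD(2)[OF N(2) a] g this]
  obtain n c where nc: "n \<in> N" "c \<in> fixed_pts a" "g = n \<otimes> c" by blast
  have cG: "c \<in> carrier G" using nc(2) unfolding fixed_pts_def by blast
  have "N #> g = N #> c" using G.r_coset_eq_iff[OF N.subgroup_axioms g cG] nc cG by (simp add: G.m_assoc)
  then show ?thesis using nc(2) by blast
qed

lemma quotient_aut_action:
  assumes N: "N \<lhd> G" "A_invariant N"
  shows "aut_action A (G Mod N) (\<lambda>a R. phi a ` R)"
proof -
  interpret N: normal N G by fact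
  have sub: "R \<subseteq> carrier G" if "R \<in> carrier (G Mod N)" for R
    using that N.rcosets_carrier[OF G.is_group] by (simp add: FactGroup_def)
  have comp: "phi (a \<otimes>\<^bsub>A\<^esub> b) ` R = phi a ` phi b ` R"
    if "a \<in> carrier A" "b \<in> carrier A" "R \<in> carrier (G Mod N)" for a b R
  proof -
    have "\<forall>x\<in>R. phi (a \<otimes>\<^bsub>A\<^esub> b) x = phi a (phi b x)" using phi_comp that sub by blast
    then show ?thesis by (simp add: image_image)
  qed
  have id: "phi \<one>\<^bsub>A\<^esub> ` R = R" if "R \<in> carrier (G Mod N)" for R
  proof -
    have "\<forall>x\<in>R. phi \<one>\<^bsub>A\<^esub> x = x" using phi_id that sub by blast
    then show ?thesis by simp
  qed
  have cl: "phi a ` R \<in> carrier (G Mod N)" if "a \<in> carrier A" "R \<in> carrier (G Mod N)" for a R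
    using that phi_coset[OF N(2) that(1)] by (auto simp: carrier_FactGroup)
  show ?thesis
    unfolding aut_action_def
  proof (intro conjI ballI)
    fix a assume a: "a \<in> carrier A"
    have "(\<lambda>R. phi a ` R) \<in> hom (G Mod N) (G Mod N)"
    proof (rule homI)
      fix R S assume "R \<in> carrier (G Mod N)" "S \<in> carrier (G Mod N)"
      then obtain x y where xy: "x \<in> carrier G" "R = N #> x" "y \<in> carrier G" "S = N #> y"
        by (auto simp: carrier_FactGroup)
      then show "phi a ` (R \<otimes>\<^bsub>G Mod N\<^esub> S) = phi a ` R \<otimes>\<^bsub>G Mod N\<^esub> phi a ` S"
        using a by (simp add: N.rcos_sum phi_coset[OF N(2)] phi_mult)
    qed (use cl a in blast)
    moreover have "bij_betw (\<lambda>R. phi a ` R) (carrier (G Mod N)) (carrier (G Mod N))"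
    proof (rule bij_betw_byWitness[where f' = "\<lambda>R. phi (inv\<^bsub>A\<^esub> a) ` R"])
      show "\<forall>R\<in>carrier (G Mod N). phi (inv\<^bsub>A\<^esub> a) ` phi a ` R = R"
        using comp[of "inv\<^bsub>A\<^esub> a" a] id a by (metis A.inv_closed A.l_inv)
      show "\<forall>R\<in>carrier (G Mod N). phi a ` phi (inv\<^bsub>A\<^esub> a) ` R = R"
        using comp[of a "inv\<^bsub>A\<^esub> a"] id a by (metis A.inv_closed A.r_inv)
    qed (use cl a in auto)
    ultimately show "(\<lambda>R. phi a ` R) \<in> iso (G Mod N) (G Mod N)" unfolding iso_def by blast
  qed (use comp id in auto)
qed

end

section \<open>Elementary abelian groups of rank two\<close>

lemma (in group) subgroup_cancel_right:
  assumes W: "subgroup W G" and "a \<in> carrier G" "b \<in> W" "a \<otimes> b \<in> W"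
  shows "a \<in> W"
proof -
  interpret W: subgroup W G by fact
  have "a = (a \<otimes> b) \<otimes> inv b" using assms by (simp add: m_assoc)
  then show ?thesis using assms W.m_closed W.m_inv_closed by metis
qed

lemma (in group) subgroup_cancel_left:
  assumes W: "subgroup W G" and "a \<in> W" "b \<in> carrier G" "a \<otimes> b \<in> W"
  shows "b \<in> W"
proof -
  interpret W: subgroup W G by fact
  have "b = inv a \<otimes> (a \<otimes> b)" using assms by (simp add: m_assoc)
  then show ?thesis using assms W.m_closed W.m_inv_closed by metis
qed

lemma (in comm_group) finprod_mem_subgroup:
  assumes "subgroup W G" "\<And>i. i \<in> I \<Longrightarrow> f i \<in> W"
  shows "finprod G f I \<in> W"
  using assms(2)
proof (induction I rule: infinite_finite_induct)
  case (insert x F)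
  have "finprod G f (insert x F) = f x \<otimes> finprod G f F"
    using insert subgroup.subset[OF assms(1)] by (intro finprod_insert) auto
  then show ?case using insert subgroup.m_closed[OF assms(1)] by auto
qed (use subgroup.one_closed[OF assms(1)] in auto)

lemma (in comm_group) hom_finprod:
  assumes h: "h \<in> hom G G" and f: "\<And>i. i \<in> I \<Longrightarrow> f i \<in> carrier G"
  shows "h (finprod G f I) = finprod G (\<lambda>i. h (f i)) I"
proof -
  interpret h: group_hom G G h using h by unfold_locales
  show ?thesis
    using f
  proof (induction I rule: infinite_finite_induct)
    case (insert x F)
    have "finprod G f (insert x F) = f x \<otimes> finprod G f F"
      using insert by (intro finprod_insert) auto
    moreover have "finprod G (\<lambda>i. h (f i)) (insert x F) = h (f x) \<otimes> finprod G (\<lambda>i. h (f i)) F"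
      using insert by (intro finprod_insert) auto
    moreover have "finprod G f F \<in> carrier G" using insert by (intro finprod_closed) auto
    ultimately show ?case using insert by simp
  qed auto
qed

lemma (in group) translate_subgroup:
  assumes S: "subgroup S G" and g: "g \<in> S"
  shows "(\<lambda>h. g \<otimes> h) ` S = S" "(\<lambda>h. h \<otimes> g) ` S = S"
proof -
  interpret S: subgroup S G by fact
  have "h = g \<otimes> (inv g \<otimes> h)" "inv g \<otimes> h \<in> S" "h = (h \<otimes> inv g) \<otimes> g" "h \<otimes> inv g \<in> S" if "h \<in> S" for h
    using that g by (auto simp: m_assoc)
  then show "(\<lambda>h. g \<otimes> h) ` S = S" "(\<lambda>h. h \<otimes> g) ` S = S" using g by blast+
qed

text \<open>This product is the norm of \<open>v\<close> over \<open>B\<close>; applying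
  \<open>x\<close> only permutes its factors.\<close>

lemma finprod_orbit_fixed:
  assumes "group A" and V: "comm_group V" and act: "aut_action A V theta"
    and B: "subgroup B A" and x: "x \<in> B" and v: "v \<in> carrier V"
  shows "theta x (finprod V (\<lambda>b. theta b v) B) = finprod V (\<lambda>b. theta b v) B"
proof -
  interpret A: group A by fact
  interpret V: comm_group V by fact
  interpret B: subgroup B A by fact
  have cl: "theta a w \<in> carrier V" and hom: "theta a \<in> hom V V" if "a \<in> carrier A" "w \<in> carrier V" for a w
    using act that unfolding aut_action_def iso_def hom_def by blast+
  have xA: "x \<in> carrier A" using x by simp
  have "theta x (finprod V (\<lambda>b. theta b v) B) = finprod V (\<lambda>b. theta x (theta b v)) B"
    by (rule V.hom_finprod[OF hom[OF xA v]]) (use cl v in auto)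
  also have "\<dots> = finprod V (\<lambda>b. theta (x \<otimes>\<^bsub>A\<^esub> b) v) B"
    by (rule V.finprod_cong') (use cl v xA act in \<open>auto simp: aut_action_def\<close>)
  also have "\<dots> = finprod V (\<lambda>b. theta b v) ((\<lambda>b. x \<otimes>\<^bsub>A\<^esub> b) ` B)"
    by (rule V.finprod_reindex[symmetric]) (use cl v x in \<open>auto intro!: inj_onI\<close>)
  finally show ?thesis unfolding A.translate_subgroup(1)[OF B x] .
qed

locale rank_two = comm_group A for A :: "('b, 'c) monoid_scheme" (structure) +
  fixes r :: nat
  assumes prime_r: "Factorial_Ring.prime r" and order_A: "order A = r ^ 2"
    and exponent: "x \<in> carrier A \<Longrightarrow> x [^] r = \<one>"
begin

abbreviation cyc :: "'b \<Rightarrow> 'b set" where "cyc x \<equiv> generate A {x}"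

lemma finite_A: "finite (carrier A)"
  using order_A prime_r order_gt_0_iff_finite by (simp add: prime_gt_0_nat)

lemma cyc_subgroup: "x \<in> carrier A \<Longrightarrow> subgroup (cyc x) A"
  by (rule generate_is_subgroup) simp

lemma cyc_self: "x \<in> cyc x"
  by (rule generate.incl) simp

lemma cyc_incl: "subgroup D A \<Longrightarrow> x \<in> D \<Longrightarrow> cyc x \<subseteq> D"
  by (rule generate_subgroup_incl) simp

lemma card_cyc: assumes "x \<in> carrier A" "x \<noteq> \<one>" shows "card (cyc x) = r"
proof -
  have "ord x dvd r" using exponent[OF assms(1)] pow_eq_id assms(1) by blast
  moreover have "ord x \<noteq> 1" using assms ord_eq_1 by blast
  ultimately have "ord x = r" using prime_r by (auto simp: prime_nat_iff)
  then show ?thesis using generate_pow_card[OF assms(1)] by simp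
qed

lemma cyc_eq:
  assumes "x \<in> carrier A" "y \<in> cyc x" "y \<noteq> \<one>" shows "cyc y = cyc x"
proof -
  have y: "y \<in> carrier A" using subgroup.mem_carrier[OF cyc_subgroup[OF assms(1)] assms(2)] .
  have "x \<noteq> \<one>" using assms generate_one by auto
  then have "card (cyc y) = card (cyc x)" using card_cyc assms y by simp
  moreover have "cyc y \<subseteq> cyc x" by (rule cyc_incl[OF cyc_subgroup[OF assms(1)] assms(2)])
  moreover have "finite (cyc x)" by (rule subgroup_pos_card(2)[OF finite_A cyc_subgroup[OF assms(1)]])
  ultimately show ?thesis by (metis card_subset_eq)
qed

text \<open>The order of \<open>D\<close> exceeds \<open>r\<close> and divides
  \<open>r ^ 2\<close>.\<close>

lemma two_generate:
  assumes D: "subgroup D A" "x \<in> D" "y \<in> D" and "x \<noteq> \<one>" "y \<notin> cyc x"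
  shows "D = carrier A"
proof -
  have x: "x \<in> carrier A" by (rule subgroup.mem_carrier[OF D(1,2)])
  have finD: "finite D" using subgroup_pos_card[OF finite_A D(1)] by simp
  have "cyc x \<subset> D" using cyc_incl[OF D(1,2)] D(3) assms(5) by blast
  then have "r < card D" using psubset_card_mono[OF finD, of "cyc x"] card_cyc[OF x assms(4)] by simp
  moreover have "card D dvd r ^ 2" using lagrange[OF D(1)] order_A by (metis dvd_triv_right)
  then obtain k where k: "card D = r ^ k" "k \<le> 2" using divides_primepow_nat[OF prime_r] by blast
  ultimately have "k = 2" using prime_gt_1_nat[OF prime_r] power_less_imp_less_exp[of r 1 k] by simp
  then have "card D = card (carrier A)" using k order_A by (simp add: order_def)
  then show ?thesis using card_subset_eq[OF finite_A subgroup.subset[OF D(1)]] by blast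
qed

lemma decompose:
  assumes "x \<in> carrier A" "y \<in> carrier A" "x \<noteq> \<one>" "y \<notin> cyc x" "a \<in> carrier A"
  obtains x' y' where "x' \<in> cyc x" "y' \<in> cyc y" "a = x' \<otimes> y'"
proof -
  have "subgroup (cyc x <#> cyc y) A" by (rule mult_subgroups[OF cyc_subgroup[OF assms(1)] cyc_subgroup[OF assms(2)]])
  moreover have "x \<otimes> \<one> \<in> cyc x <#> cyc y"
    unfolding set_mult_def using cyc_self generate.one by blast
  moreover have "\<one> \<otimes> y \<in> cyc x <#> cyc y"
    unfolding set_mult_def using cyc_self generate.one by blast
  ultimately have "cyc x <#> cyc y = carrier A" using two_generate[of "cyc x <#> cyc y" x y] assms by simp
  then show ?thesis using that assms(5) unfolding set_mult_def by blast
qed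

lemma ex_independent:
  assumes "x \<in> carrier A" obtains y where "y \<in> carrier A" "y \<notin> cyc x" "y \<noteq> \<one>"
proof -
  have "card (cyc x) \<le> r"
    using card_cyc[OF assms] generate_one prime_gt_1_nat[OF prime_r] by (cases "x = \<one>") auto
  moreover have "r < card (carrier A)"
    using order_A prime_gt_1_nat[OF prime_r] by (simp add: order_def power2_eq_square)
  ultimately have "carrier A \<noteq> cyc x" by auto
  then obtain y where "y \<in> carrier A" "y \<notin> cyc x"
    using subgroup.subset[OF cyc_subgroup[OF assms]] by blast
  then show ?thesis using that generate.one[of A "{x}"] by metis
qed

lemma ex_nontrivial: obtains x where "x \<in> carrier A" "x \<noteq> \<one>"
  using ex_independent[OF one_closed] by blast

text \<open>The products of \<open>theta b v\<close> over the subgroups of order \<open>r\<close> multiply up to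
  the product over all of \<open>A\<close>, except that the identity is counted \<open>r + 1\<close> times;
  hence the \<open>r\<close>-th power of \<open>v\<close> is a product of fixed points.\<close>

lemma abelian_generated_by_fixed_points:
  fixes V :: "('v, 'w) monoid_scheme"
  assumes V: "comm_group V" and finV: "finite (carrier V)" and act: "aut_action A V theta"
    and cop: "coprime r (order V)" and W: "subgroup W V"
    and fp: "\<And>x v. x \<in> carrier A \<Longrightarrow> x \<noteq> \<one> \<Longrightarrow> v \<in> carrier V \<Longrightarrow> theta x v = v \<Longrightarrow> v \<in> W"
  shows "W = carrier V"
proof -
  interpret V: comm_group V by fact
  interpret W: subgroup W V by fact
  have cl: "theta a v \<in> carrier V" if "a \<in> carrier A" "v \<in> carrier V" for a v
    using act that unfolding aut_action_def iso_def hom_def by blast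
  have one: "theta \<one> v = v" if "v \<in> carrier V" for v
    using act that unfolding aut_action_def by blast
  have tr: "finprod V (\<lambda>b. theta b v) B \<in> W"
    if B: "subgroup B A" and x: "x \<in> B" "x \<noteq> \<one>" and v: "v \<in> carrier V" for B x v
  proof (rule fp)
    interpret B: subgroup B A by fact
    show xA: "x \<in> carrier A" using x by simp
    show "x \<noteq> \<one>" by fact
    show "finprod V (\<lambda>b. theta b v) B \<in> carrier V" using cl v by (intro V.finprod_closed) auto
    show "theta x (finprod V (\<lambda>b. theta b v) B) = finprod V (\<lambda>b. theta b v) B"
      by (rule finprod_orbit_fixed[OF is_group V act B x(1) v])
  qed
  have "v \<in> W" if v: "v \<in> carrier V" for v
  proof -
    let ?f = "\<lambda>b. theta b v"
    define LL where "LL = cyc ` (carrier A - {\<one>})"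
    have finL: "finite LL" unfolding LL_def using finite_A by simp
    \<comment> \<open>Leaving out the identity makes the index sets disjoint: the subgroups in
      \<open>LL\<close> without the identity partition the nonidentity elements of
      \<open>A\<close>.\<close>
    define s where "s B = finprod V ?f (B - {\<one>})" for B
    have sub: "subgroup B A" "\<exists>x\<in>B. x \<noteq> \<one> \<and> B = cyc x" if "B \<in> LL" for B
      using that cyc_subgroup cyc_self unfolding LL_def by auto
    have split: "finprod V ?f B = v \<otimes>\<^bsub>V\<^esub> s B" if B: "subgroup B A" for B
    proof -
      interpret B: subgroup B A by fact
      have "B = insert \<one> (B - {\<one>})" by auto
      then have "finprod V ?f B = finprod V ?f (insert \<one> (B - {\<one>}))" by simp
      also have "\<dots> = ?f \<one> \<otimes>\<^bsub>V\<^esub> s B" unfolding s_def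
        using finite_A finite_subset[OF B.subset] cl v by (intro V.finprod_insert) auto
      finally show ?thesis using one v by simp
    qed
    have sB: "s B \<in> carrier V" if "subgroup B A" for B
      unfolding s_def using cl v subgroup.mem_carrier[OF that] by (intro V.finprod_closed) auto
    have tB: "v \<otimes>\<^bsub>V\<^esub> s B \<in> W" if "B \<in> LL" for B
      using tr[OF sub(1)[OF that] _ _ v] sub(2)[OF that] split[OF sub(1)[OF that]] by auto
    have un: "\<Union>((\<lambda>B. B - {\<one>}) ` LL) = carrier A - {\<one>}"
      unfolding LL_def using cyc_self cyc_subgroup subgroup.subset by fastforce
    have disj: "pairwise (\<lambda>i j. disjnt (i - {\<one>}) (j - {\<one>})) LL"
      unfolding pairwise_def disjnt_def
    proof (intro ballI impI, rule ccontr)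
      fix B B' assume B: "B \<in> LL" "B' \<in> LL" "B \<noteq> B'" and "(B - {\<one>}) \<inter> (B' - {\<one>}) \<noteq> {}"
      then obtain y where "y \<in> B" "y \<in> B'" "y \<noteq> \<one>" by blast
      then have "cyc y = B" "cyc y = B'" using B cyc_eq unfolding LL_def by blast+
      with B(3) show False by simp
    qed
    have sA: "s (carrier A) = finprod V s LL"
    proof -
      have "finprod V ?f (\<Union>((\<lambda>B. B - {\<one>}) ` LL)) = finprod V (\<lambda>B. finprod V ?f (B - {\<one>})) LL"
      proof (rule V.finprod_UN_disjoint[OF finL _ disj])
        fix B assume B: "B \<in> LL"
        show "finite (B - {\<one>})" using subgroup_pos_card(2)[OF finite_A sub(1)[OF B]] by simp
        fix b assume "b \<in> B - {\<one>}"
        then show "theta b v \<in> carrier V" using subgroup.mem_carrier[OF sub(1)[OF B]] cl v by simp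
      qed
      then show ?thesis unfolding un s_def .
    qed
    \<comment> \<open>By this partition the number of subgroups is the quotient of
      \<open>r ^ 2 - 1\<close> by \<open>r - 1\<close>.\<close>
    have cardL: "card LL = r + 1"
    proof -
      have "card (\<Union>((\<lambda>B. B - {\<one>}) ` LL)) = (\<Sum>B\<in>LL. card (B - {\<one>}))"
        by (rule card_UN_disjoint[OF finL])
          (use disj sub(1) subgroup_pos_card[OF finite_A] in \<open>auto simp: pairwise_def disjnt_def\<close>)
      also have "\<dots> = (\<Sum>B\<in>LL. r - 1)"
      proof (rule sum.cong[OF refl])
        fix B assume "B \<in> LL"
        then have "card B = r" "\<one> \<in> B" using card_cyc generate.one unfolding LL_def by auto
        then show "card (B - {\<one>}) = r - 1" by simp
      qed
      finally have "r ^ 2 - 1 = card LL * (r - 1)"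
        unfolding un using order_A by (simp add: order_def)
      moreover have "r ^ 2 - 1 = (r + 1) * (r - 1)"
        by (simp add: power2_eq_square algebra_simps)
      moreover have "r - 1 \<noteq> 0" using prime_gt_1_nat[OF prime_r] by simp
      ultimately show ?thesis by (metis mult_right_cancel)
    qed
    have "finprod V (\<lambda>B. v \<otimes>\<^bsub>V\<^esub> s B) LL = finprod V (\<lambda>B. v) LL \<otimes>\<^bsub>V\<^esub> finprod V s LL"
      by (rule V.finprod_multf) (use v sB sub in auto)
    also have "finprod V (\<lambda>B. v) LL = v [^]\<^bsub>V\<^esub> (r + 1)" using V.finprod_const[OF v, of LL] cardL by (simp only:)
    finally have 1: "v [^]\<^bsub>V\<^esub> (r + 1) \<otimes>\<^bsub>V\<^esub> s (carrier A) \<in> W"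
      using V.finprod_mem_subgroup[OF W, of LL "\<lambda>B. v \<otimes>\<^bsub>V\<^esub> s B"] tB sA by simp
    have 2: "v \<otimes>\<^bsub>V\<^esub> s (carrier A) \<in> W"
      using ex_nontrivial tr[OF subgroup_self _ _ v] split[OF subgroup_self] by metis
    \<comment> \<open>Cancelling the norm over \<open>A\<close> from the product of the norms over
      the \<open>r + 1\<close> subgroups leaves the \<open>r\<close>-th power of \<open>v\<close>,
      whose root lies in \<open>W\<close> because \<open>r\<close> is prime to the order of
      \<open>V\<close>.\<close>
    have "v [^]\<^bsub>V\<^esub> (r + 1) \<otimes>\<^bsub>V\<^esub> s (carrier A) = v [^]\<^bsub>V\<^esub> r \<otimes>\<^bsub>V\<^esub> (v \<otimes>\<^bsub>V\<^esub> s (carrier A))"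
      using v sB[OF subgroup_self] by (simp add: V.m_assoc)
    with 1 have "v [^]\<^bsub>V\<^esub> r \<otimes>\<^bsub>V\<^esub> (v \<otimes>\<^bsub>V\<^esub> s (carrier A)) \<in> W" by (simp only:)
    then have "v [^]\<^bsub>V\<^esub> r \<in> W" by (rule V.subgroup_cancel_right[OF W V.nat_pow_closed[OF v] 2])
    moreover have "v [^]\<^bsub>V\<^esub> order V \<in> W" using V.pow_order_eq_1[OF v] by simp
    ultimately show ?thesis using V.coprime_pow_mem[OF W v] cop by blast
  qed
  then show ?thesis using W.subset by blast
qed

end

section \<open>Commutator subgroups in q-groups\<close>

lemma (in group) generate_conj:
  assumes S: "S \<subseteq> carrier G" and g: "g \<in> carrier G"
    and inv: "\<And>s. s \<in> S \<Longrightarrow> g \<otimes> s \<otimes> inv g \<in> generate G S" and c: "c \<in> generate G S"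
  shows "g \<otimes> c \<otimes> inv g \<in> generate G S"
proof -
  have sg: "subgroup (generate G S) G" by (rule generate_is_subgroup[OF S])
  show ?thesis using c
  proof (induction c rule: generate.induct)
    case one then show ?case using g subgroup.one_closed[OF sg] by simp
  next
    case (incl h) then show ?case by (rule inv)
  next
    case (inv h)
    then have "g \<otimes> inv h \<otimes> inv g = inv (g \<otimes> h \<otimes> inv g)"
      using g S by (simp add: subset_iff m_assoc inv_mult_group)
    then show ?case using subgroup.m_inv_closed[OF sg assms(3)[OF inv]] by simp
  next
    case (eng a b)
    then have "a \<in> carrier G" "b \<in> carrier G" using subgroup.mem_carrier[OF sg] by blast+
    then have "g \<otimes> (a \<otimes> b) \<otimes> inv g = (g \<otimes> a \<otimes> inv g) \<otimes> (g \<otimes> b \<otimes> inv g)" using g by (simp add: m_assoc)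
    then show ?case using subgroup.m_closed[OF sg eng.IH] by simp
  qed
qed

text \<open>The commutator group [Z,T], with its generators written as displacements of
  \<open>Z\<close> under conjugation by \<open>T\<close> so that
  \<open>p_group_action_proper\<close> applies.\<close>

definition (in group) conj_comm :: "'a set \<Rightarrow> 'a set \<Rightarrow> 'a set" where
  "conj_comm Z T = generate G {inv z \<otimes> (t \<otimes> z \<otimes> inv t) |z t. z \<in> Z \<and> t \<in> T}"

text \<open>\<open>T\<close> acts on \<open>Z\<close> by conjugation and both are
  \<open>q\<close>-groups, so some proper subgroup of \<open>Z\<close> contains all
  displacements.\<close>

lemma (in group) conj_comm_proper:
  assumes T: "subgroup T G" "card T = q ^ k" and Z: "subgroup Z G" "card Z = q ^ l"
    and q: "Factorial_Ring.prime q" and ne: "Z \<noteq> {\<one>}"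
    and norm: "\<And>t z. t \<in> T \<Longrightarrow> z \<in> Z \<Longrightarrow> t \<otimes> z \<otimes> inv t \<in> Z"
  shows "conj_comm Z T \<noteq> Z" "conj_comm Z T \<subseteq> Z"
proof -
  interpret T: subgroup T G by fact
  interpret Z: subgroup Z G by fact
  let ?T = "G\<lparr>carrier := T\<rparr>" and ?Z = "G\<lparr>carrier := Z\<rparr>"
  interpret TG: group ?T by (rule T.subgroup_is_group[OF is_group])
  interpret ZG: group ?Z by (rule Z.subgroup_is_group[OF is_group])
  have norm': "inv t \<otimes> z \<otimes> t \<in> Z" if "t \<in> T" "z \<in> Z" for t z using norm[of "inv t" z] that by simp
  have inv: "inv\<^bsub>?Z\<^esub> h = inv h" if "h \<in> Z" for h using m_inv_consistent[OF Z(1) that] .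
  have act: "aut_action ?T ?Z (\<lambda>t z. t \<otimes> z \<otimes> inv t)"
    unfolding aut_action_def iso_def
  proof (intro conjI ballI)
    fix a assume a: "a \<in> carrier ?T"
    have "bij_betw (\<lambda>z. a \<otimes> z \<otimes> inv a) Z Z"
      by (rule bij_betw_byWitness[where f' = "\<lambda>z. inv a \<otimes> z \<otimes> a"])
        (use a norm norm' in \<open>auto simp: m_assoc\<close>)
    moreover have "(\<lambda>z. a \<otimes> z \<otimes> inv a) \<in> hom ?Z ?Z"
      by (rule homI) (use a norm in \<open>auto simp: m_assoc\<close>)
    ultimately show "(\<lambda>z. a \<otimes> z \<otimes> inv a) \<in> {h \<in> hom ?Z ?Z. bij_betw h (carrier ?Z) (carrier ?Z)}" by simp
  qed (auto simp: m_assoc inv_mult_group)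
  obtain M where M: "subgroup M ?Z" "M \<noteq> Z" "\<And>h a. h \<in> Z \<Longrightarrow> a \<in> T \<Longrightarrow> inv h \<otimes> (a \<otimes> h \<otimes> inv a) \<in> M"
    using p_group_action_proper[OF TG.is_group q _ ZG.is_group _ _ act, of k l] T(2) Z(2) ne inv
    by (auto simp: order_def)
  have sM: "subgroup M G" "M \<subseteq> Z" using incl_subgroup[OF Z(1) M(1)] subgroup.subset[OF M(1)] by simp_all
  have "conj_comm Z T \<subseteq> M"
    unfolding conj_comm_def by (rule generate_subgroup_incl[OF _ sM(1)]) (use M(3) in blast)
  then show "conj_comm Z T \<noteq> Z" "conj_comm Z T \<subseteq> Z" using sM M(2) by blast+
qed

lemma (in group) derived_proper:
  assumes H: "subgroup H G" and q: "Factorial_Ring.prime q" "card H = q ^ k" and ne: "H \<noteq> {\<one>}"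
  shows "derived G H \<noteq> H" "derived G H \<subseteq> H"
proof -
  interpret H: subgroup H G by fact
  note p = conj_comm_proper[OF H q(2) H q(2) q(1) ne]
  have "derived G H \<subseteq> conj_comm H H" unfolding derived_def
  proof (rule generate_subgroup_incl)
    show "subgroup (conj_comm H H) G"
      unfolding conj_comm_def by (rule generate_is_subgroup) auto
    show "(\<Union>h1\<in>H. \<Union>h2\<in>H. {h1 \<otimes> h2 \<otimes> inv h1 \<otimes> inv h2}) \<subseteq> conj_comm H H"
    proof safe
      fix h1 h2 assume h: "h1 \<in> H" "h2 \<in> H"
      \<comment> \<open>The commutator of \<open>h1\<close> and \<open>h2\<close> is the
        displacement of the inverse of \<open>h1\<close> under \<open>h2\<close>.\<close>
      have "inv (inv h1) \<otimes> (h2 \<otimes> inv h1 \<otimes> inv h2) \<in> conj_comm H H"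
        unfolding conj_comm_def by (rule generate.incl) (use h H.m_inv_closed in blast)
      then show "h1 \<otimes> h2 \<otimes> inv h1 \<otimes> inv h2 \<in> conj_comm H H" using h by (simp add: m_assoc)
    qed
  qed
  then show "derived G H \<noteq> H" "derived G H \<subseteq> H" using p by auto
qed

section \<open>Generation of r'-groups by the fixed points of nonidentity elements of A\<close>

locale rank_two_action = finite_good_action G A phi + rank_two A r
  for G :: "('a, 'd) monoid_scheme" (structure) and A :: "('b, 'c) monoid_scheme"
    and phi :: "'b \<Rightarrow> 'a \<Rightarrow> 'a" and r :: nat
begin

abbreviation nontriv :: "'b \<Rightarrow> bool" where
  "nontriv x \<equiv> x \<in> carrier A \<and> x \<noteq> \<one>\<^bsub>A\<^esub>"

lemma restrict_rank_two: "A_invariant H \<Longrightarrow> rank_two_action (G\<lparr>carrier := H\<rparr>) A phi r"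
  unfolding rank_two_action_def using restrict rank_two_axioms by blast

lemma fixed_cyc: "x \<in> carrier A \<Longrightarrow> g \<in> fixed_pts x \<Longrightarrow> y \<in> cyc x \<Longrightarrow> phi y g = g"
  using cyc_incl[OF stabilizer_subgroup, of g x] unfolding fixed_pts_def by blast

lemma fixed_by_two:
  assumes "nontriv x" "y \<notin> cyc x" "g \<in> fixed_pts x" "g \<in> fixed_pts y" "y \<in> carrier A" "a \<in> carrier A"
  shows "phi a g = g"
proof -
  have "{a \<in> carrier A. phi a g = g} = carrier A"
    by (rule two_generate[OF stabilizer_subgroup, of g x y]) (use assms in \<open>auto simp: fixed_pts_def\<close>)
  then show ?thesis using assms(6) by blast
qed

lemma A_invariant_generate:
  assumes S: "S \<subseteq> carrier G" "\<And>a s. a \<in> carrier A \<Longrightarrow> s \<in> S \<Longrightarrow> phi a s \<in> generate G S"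
  shows "A_invariant (generate G S)"
proof -
  have sg: "subgroup (generate G S) G" by (rule G.generate_is_subgroup[OF S(1)])
  have "phi a h \<in> generate G S" if a: "a \<in> carrier A" and h: "h \<in> generate G S" for a h
    using h
  proof (induction h rule: generate.induct)
    case one then show ?case using a generate.one by simp
  next
    case (incl h) then show ?case using S a by blast
  next
    case (inv h)
    then have "phi a (inv h) = inv (phi a h)" using a S(1) by (auto simp: phi_inv)
    then show ?case using S(2)[OF a inv] subgroup.m_inv_closed[OF sg] by simp
  next
    case (eng h1 h2)
    then have "h1 \<in> carrier G" "h2 \<in> carrier G" using subgroup.mem_carrier[OF sg] by blast+
    then show ?case using eng a subgroup.m_closed[OF sg] by (simp add: phi_mult)
  qed
  then show ?thesis unfolding A_invariant_def using sg by blast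
qed

lemma A_invariant_derived: assumes "A_invariant H" shows "A_invariant (derived G H)"
proof -
  interpret H: subgroup H G by (rule A_invariantD(1)[OF assms])
  show ?thesis unfolding derived_def
  proof (rule A_invariant_generate)
    show "(\<Union>h1\<in>H. \<Union>h2\<in>H. {h1 \<otimes> h2 \<otimes> inv h1 \<otimes> inv h2}) \<subseteq> carrier G" by auto
    fix a s assume a: "a \<in> carrier A" and "s \<in> (\<Union>h1\<in>H. \<Union>h2\<in>H. {h1 \<otimes> h2 \<otimes> inv h1 \<otimes> inv h2})"
    then obtain h1 h2 where h: "h1 \<in> H" "h2 \<in> H" "s = h1 \<otimes> h2 \<otimes> inv h1 \<otimes> inv h2" by blast
    then have "phi a s = phi a h1 \<otimes> phi a h2 \<otimes> inv (phi a h1) \<otimes> inv (phi a h2)"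
      using a by (simp add: phi_mult phi_inv)
    then show "phi a s \<in> generate G (\<Union>h1\<in>H. \<Union>h2\<in>H. {h1 \<otimes> h2 \<otimes> inv h1 \<otimes> inv h2})"
      using A_invariantD(2)[OF assms a] h by (intro generate.incl) blast
  qed
qed

text \<open>Induction along the derived subgroup, which lies in \<open>D\<close> by hypothesis of
  induction. The image of \<open>D\<close> is the whole abelian quotient by
  \<open>abelian_generated_by_fixed_points\<close>, because fixed cosets have fixed
  representatives.\<close>

lemma q_group_generated:
  assumes "A_invariant H" and q: "Factorial_Ring.prime q" "q \<noteq> r" "card H = q ^ k"
    and D: "subgroup D G" and fp: "\<And>x. nontriv x \<Longrightarrow> fixed_pts x \<inter> H \<subseteq> D"
  shows "H \<subseteq> D"
  using assms(1,4) fp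
proof (induction "card H" arbitrary: H k rule: less_induct)
  case less
  note H = less.prems(1)
  show ?case
  proof (cases "H = {\<one>}")
    case True then show ?thesis using subgroup.one_closed[OF D] by simp
  next
    case False
    interpret H: subgroup H G by (rule A_invariantD(1)[OF H])
    interpret D: subgroup D G by fact
    let ?H = "G\<lparr>carrier := H\<rparr>" and ?N = "derived G H"
    interpret HA: rank_two_action ?H A phi r by (rule restrict_rank_two[OF H])
    note NH = G.derived_proper[OF H.subgroup_axioms q(1) less.prems(2) False]
    have AN: "A_invariant ?N" by (rule A_invariant_derived[OF H])
    note finH = G.subgroup_pos_card[OF finG H.subgroup_axioms]
    have "card ?N dvd q ^ k" using G.subgroup_dvd[OF finG H.subgroup_axioms A_invariantD(1)[OF AN] NH(2)] less.prems(2) by simp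
    then obtain j where j: "card ?N = q ^ j" using divides_primepow_nat[OF q(1)] by blast
    have ND: "?N \<subseteq> D"
    proof (rule less.hyps[OF _ AN j])
      show "card ?N < card H" using NH finH(2) by (simp add: psubset_card_mono psubset_eq)
      show "fixed_pts x \<inter> ?N \<subseteq> D" if "nontriv x" for x using less.prems(3)[OF that] NH(2) by blast
    qed
    have nN: "?N \<lhd> ?H" by (rule G.derived_subgroup_is_normal[OF H.subgroup_axioms])
    interpret N: normal ?N ?H by (rule nN)
    have V: "comm_group (?H Mod ?N)" by (rule G.derived_quot_of_subgroup_is_comm_group[OF H.subgroup_axioms])
    have HAN: "HA.A_invariant ?N" unfolding HA.A_invariant_def using N.subgroup_axioms A_invariantD(2)[OF AN] by auto
    have act: "aut_action A (?H Mod ?N) (\<lambda>a R. phi a ` R)" by (rule HA.quotient_aut_action[OF nN HAN])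
    have "order (?H Mod ?N) * card ?N = q ^ k"
      using HA.G.lagrange[OF N.subgroup_axioms] less.prems(2) by (simp add: order_def FactGroup_def)
    then have "order (?H Mod ?N) dvd q ^ k" by (metis dvd_triv_left)
    moreover have "coprime r (q ^ k)" using primes_coprime[OF prime_r q(1)] q(2) by simp
    ultimately have cop: "coprime r (order (?H Mod ?N))" by (metis coprime_divisors dvd_refl)
    let ?W = "(\<lambda>h. ?N #>\<^bsub>?H\<^esub> h) ` (D \<inter> H)"
    interpret gh: group_hom ?H "?H Mod ?N" "\<lambda>h. ?N #>\<^bsub>?H\<^esub> h"
      by (intro group_hom.intro group_hom_axioms.intro HA.G.is_group N.factorgroup_is_group N.r_coset_hom_Mod)
    have sDH: "subgroup (D \<inter> H) ?H"
      by (rule G.subgroup_incl[OF G.subgroups_Inter_pair[OF D H.subgroup_axioms] H.subgroup_axioms]) simp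
    have W: "subgroup ?W (?H Mod ?N)" by (rule gh.subgroup_img_is_subgroup[OF sDH])
    have "?W = carrier (?H Mod ?N)"
    proof (rule abelian_generated_by_fixed_points[OF V _ act cop W])
      show "finite (carrier (?H Mod ?N))" using finH(2) by (simp add: FactGroup_def RCOSETS_def)
      fix x v assume x: "x \<in> carrier A" "x \<noteq> \<one>\<^bsub>A\<^esub>" and v: "v \<in> carrier (?H Mod ?N)" "phi x ` v = v"
      then obtain h where h: "h \<in> H" "v = ?N #>\<^bsub>?H\<^esub> h" by (auto simp: carrier_FactGroup)
      have hH: "h \<in> carrier ?H" using h(1) by simp
      have "phi x ` (?N #>\<^bsub>?H\<^esub> h) = ?N #>\<^bsub>?H\<^esub> h" using v(2) h(2) by simp
      from HA.fixed_coset_lift[OF x(1) nN HAN hH this]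
      obtain c where "c \<in> HA.fixed_pts x" "?N #>\<^bsub>?H\<^esub> h = ?N #>\<^bsub>?H\<^esub> c" by blast
      then have c: "c \<in> fixed_pts x \<inter> H" and "v = ?N #>\<^bsub>?H\<^esub> c" using h(2) unfolding HA.fixed_pts_def fixed_pts_def by auto
      moreover have "c \<in> D \<inter> H" using c less.prems(3)[of x] x by blast
      ultimately show "v \<in> ?W" by blast
    qed
    then have W_eq: "?W = carrier (?H Mod ?N)" .
    show ?thesis
    proof
      fix h assume h: "h \<in> H"
      then have "?N #>\<^bsub>?H\<^esub> h \<in> ?W" unfolding W_eq by (auto simp: carrier_FactGroup)
      then obtain d where d: "d \<in> D" "d \<in> H" "?N #>\<^bsub>?H\<^esub> h = ?N #>\<^bsub>?H\<^esub> d" by blast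
      then have "h \<otimes> inv d \<in> ?N"
        using HA.G.r_coset_eq_iff[OF N.subgroup_axioms, of h d] h
        by (simp add: G.m_inv_consistent[OF H.subgroup_axioms])
      then have "h \<otimes> inv d \<in> D" using ND by blast
      then show "h \<in> D" using G.subgroup_cancel_right[OF D, of h "inv d"] d h by simp
    qed
  qed
qed

lemma phi_conj_set:
  "a \<in> carrier A \<Longrightarrow> g \<in> carrier G \<Longrightarrow> S \<subseteq> carrier G \<Longrightarrow> phi a ` G.conj_set g S = G.conj_set (phi a g) (phi a ` S)"
  unfolding G.conj_set_def image_image
  by (rule image_cong[OF refl]) (auto simp: phi_mult phi_inv subset_iff)

lemma phi_image_subgroup: "a \<in> carrier A \<Longrightarrow> subgroup S G \<Longrightarrow> subgroup (phi a ` S) G"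
  using group_hom.subgroup_img_is_subgroup[OF phi_hom] .

lemma phi_inj: "a \<in> carrier A \<Longrightarrow> S \<subseteq> carrier G \<Longrightarrow> inj_on (phi a) S"
  by (rule inj_on_inverseI[of _ "phi (inv\<^bsub>A\<^esub> a)"]) auto

lemma phi_sylow_in:
  assumes H: "A_invariant H" and a: "a \<in> carrier A" and T: "G.sylow_in q T H"
  shows "G.sylow_in q (phi a ` T) H"
proof -
  have sT: "subgroup T G" "T \<subseteq> H" using T unfolding G.sylow_in_def by auto
  have "card (phi a ` T) = card T" by (rule card_image[OF phi_inj[OF a subgroup.subset[OF sT(1)]]])
  moreover have "phi a ` T \<subseteq> H" using sT(2) A_invariantD(2)[OF H a] by blast
  ultimately show ?thesis using T phi_image_subgroup[OF a sT(1)] unfolding G.sylow_in_def by simp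
qed

text \<open>The number of Sylow subgroups divides \<open>card H\<close>, so it is prime to
  \<open>r\<close>, and the \<open>r\<close>-group \<open>A\<close> must fix one of them.\<close>

lemma invariant_sylow:
  assumes H: "A_invariant H" and rH: "\<not> r dvd card H" and q: "Factorial_Ring.prime q"
  shows "\<exists>T. G.sylow_in q T H \<and> A_invariant T"
proof -
  have sH: "subgroup H G" by (rule A_invariantD(1)[OF H])
  interpret H: subgroup H G by fact
  let ?H = "G\<lparr>carrier := H\<rparr>"
  let ?E = "{T. G.sylow_in q T H}"
  obtain T0 where T0: "G.sylow_in q T0 H" using G.sylow_in_exists[OF finG sH q] by blast
  have sub: "T \<subseteq> carrier G" if "T \<in> ?E" for T using that unfolding G.sylow_in_def by (auto dest: subgroup.subset)
  have finE: "finite ?E" by (rule finite_subset[of _ "Pow (carrier G)"]) (use finG sub in auto)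
  have "card ?E dvd order ?H"
  proof (rule transitive_card_dvd[where f = "\<lambda>h T. G.conj_set h T" and ?e0.0 = T0])
    show "group ?H" by (rule H.subgroup_is_group[OF G.is_group])
    show "T0 \<in> ?E" using T0 by simp
    show "G.conj_set h T \<in> ?E" if "h \<in> carrier ?H" "T \<in> ?E" for h T
      using that G.sylow_in_conj_set[OF sH _ _ G.subgroup_conj_set_self[OF sH]] by auto
    show "G.conj_set \<one>\<^bsub>?H\<^esub> T = T" if "T \<in> ?E" for T using G.conj_set_one[OF sub[OF that]] by simp
    show "G.conj_set (g \<otimes>\<^bsub>?H\<^esub> h) T = G.conj_set g (G.conj_set h T)"
      if "g \<in> carrier ?H" "h \<in> carrier ?H" "T \<in> ?E" for g h T
      using that G.conj_set_conj_set[OF _ _ sub[OF that(3)], of g h] by simp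
    show "\<exists>h\<in>carrier ?H. G.conj_set h T0 = T" if "T \<in> ?E" for T
      using G.sylow_in_conjugate[OF finG sH q T0] that by auto
  qed
  then have "\<not> r dvd card ?E" using rH by (auto simp: order_def dest: dvd_trans)
  moreover have "card ?E mod r = card {T \<in> ?E. \<forall>a\<in>carrier A. phi a ` T = T} mod r"
  proof (rule fixed_points_mod_prime[OF A.is_group prime_r order_A finE])
    show "phi a ` T \<in> ?E" if "a \<in> carrier A" "T \<in> ?E" for a T using that phi_sylow_in[OF H] by simp
    show "phi \<one>\<^bsub>A\<^esub> ` T = T" if "T \<in> ?E" for T
    proof -
      have "\<forall>x\<in>T. phi \<one>\<^bsub>A\<^esub> x = x" using phi_id sub[OF that] by blast
      then show ?thesis by simp
    qed
    show "phi (a \<otimes>\<^bsub>A\<^esub> b) ` T = phi a ` phi b ` T" if "a \<in> carrier A" "b \<in> carrier A" "T \<in> ?E" for a b T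
    proof -
      have "\<forall>x\<in>T. phi (a \<otimes>\<^bsub>A\<^esub> b) x = phi a (phi b x)" using phi_comp that(1,2) sub[OF that(3)] by blast
      then show ?thesis by (simp add: image_image)
    qed
  qed
  ultimately have "card {T \<in> ?E. \<forall>a\<in>carrier A. phi a ` T = T} \<noteq> 0"
    by (metis dvd_eq_mod_eq_0 mod_0)
  then have "{T \<in> ?E. \<forall>a\<in>carrier A. phi a ` T = T} \<noteq> {}" by (metis card.empty)
  then obtain T where "G.sylow_in q T H" "\<forall>a\<in>carrier A. phi a ` T = T" by blast
  then show ?thesis unfolding A_invariant_def G.sylow_in_def by blast
qed

text \<open>Invariant Sylow subgroups reduce this to \<open>q_group_generated\<close>, and
  \<open>subgroup_eq_of_sylow_in\<close> assembles the primes.\<close>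

lemma generated_by_fixed_points:
  assumes H: "A_invariant H" and rH: "\<not> r dvd card H"
    and D: "subgroup D G" and fp: "\<And>x. nontriv x \<Longrightarrow> fixed_pts x \<inter> H \<subseteq> D"
  shows "H \<subseteq> D"
proof -
  have sH: "subgroup H G" by (rule A_invariantD(1)[OF H])
  have "D \<inter> H = H"
  proof (rule G.subgroup_eq_of_sylow_in[OF finG sH G.subgroups_Inter_pair[OF D sH]])
    fix q assume q: "Factorial_Ring.prime q" "q dvd card H"
    obtain T where T: "G.sylow_in q T H" "A_invariant T" using invariant_sylow[OF H rH q(1)] by blast
    then obtain k where k: "card T = q ^ k" "T \<subseteq> H" unfolding G.sylow_in_def by blast
    have "q \<noteq> r" using q(2) rH by blast
    then have "T \<subseteq> D" using q_group_generated[OF T(2) q(1) _ k(1) D] fp k(2) by blast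
    then show "\<exists>T. G.sylow_in q T H \<and> T \<subseteq> D \<inter> H" using T k by blast
  qed simp
  then show ?thesis by blast
qed

text \<open>The elements that \<open>x\<close> fixes modulo \<open>K\<close> form a subgroup. It
  contains the fixed points of every generator of \<open>cyc x\<close>, which are fixed by
  \<open>x\<close>, and it contains \<open>K\<close>, hence all other fixed points; together these
  generate \<open>H\<close>. It will show that x acts trivially on Z and on T modulo suitable
  kernels.\<close>

lemma trivial_modulo:
  assumes H: "A_invariant H" and rH: "\<not> r dvd card H" and K: "A_invariant K" "K \<subseteq> H"
    and norm: "\<And>h k. h \<in> H \<Longrightarrow> k \<in> K \<Longrightarrow> inv h \<otimes> k \<otimes> h \<in> K"
    and x: "nontriv x" and fp: "\<And>y. nontriv y \<Longrightarrow> y \<notin> cyc x \<Longrightarrow> fixed_pts y \<inter> H \<subseteq> K"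
    and h: "h \<in> H"
  shows "inv h \<otimes> phi x h \<in> K"
proof -
  interpret H: subgroup H G by (rule A_invariantD(1)[OF H])
  interpret K: subgroup K G by (rule A_invariantD(1)[OF K(1)])
  let ?D = "{h \<in> H. inv h \<otimes> phi x h \<in> K}"
  have "subgroup ?D G"
  proof (rule G.subgroup_finI[OF finG])
    show "?D \<noteq> {}" using x by (auto intro!: exI[of _ \<one>])
    fix g h assume gh: "g \<in> ?D" "h \<in> ?D"
    have "(inv h \<otimes> (inv g \<otimes> phi x g) \<otimes> h) \<otimes> (inv h \<otimes> phi x h) \<in> K"
      by (rule K.m_closed[OF norm]) (use gh in auto)
    then show "g \<otimes> h \<in> ?D" using gh x by (simp add: phi_mult G.m_assoc G.inv_mult_group)
  qed auto
  then have "H \<subseteq> ?D"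
  proof (rule generated_by_fixed_points[OF H rH])
    fix y assume y: "nontriv y"
    show "fixed_pts y \<inter> H \<subseteq> ?D"
    proof (cases "y \<in> cyc x")
      case True
      then have "x \<in> cyc y" using cyc_eq[of x y] y x cyc_self by blast
      then show ?thesis using fixed_cyc[of y _ x] y by auto
    next
      case False
      then show ?thesis using fp[OF y] A_invariantD(2)[OF K(1)] x by (auto intro!: K.m_closed)
    qed
  qed
  with h show ?thesis by blast
qed

end

section \<open>Invariant modules\<close>

lemma (in comm_group) finprod_swap:
  assumes "finite J" and f: "\<And>i j. i \<in> I \<Longrightarrow> j \<in> J \<Longrightarrow> f i j \<in> carrier G"
  shows "finprod G (\<lambda>i. finprod G (\<lambda>j. f i j) J) I = finprod G (\<lambda>j. finprod G (\<lambda>i. f i j) I) J"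
  using assms
proof (induction J rule: finite_induct)
  case (insert b F)
  have "finprod G (\<lambda>i. finprod G (\<lambda>j. f i j) (insert b F)) I = finprod G (\<lambda>i. f i b \<otimes> finprod G (\<lambda>j. f i j) F) I"
    by (rule finprod_cong) (use insert in \<open>auto simp: simp_implies_def intro!: finprod_insert finprod_closed\<close>)
  also have "\<dots> = finprod G (\<lambda>i. f i b) I \<otimes> finprod G (\<lambda>i. finprod G (\<lambda>j. f i j) F) I"
    by (rule finprod_multf) (use insert in \<open>auto intro!: finprod_closed\<close>)
  also have "\<dots> = finprod G (\<lambda>j. finprod G (\<lambda>i. f i j) I) (insert b F)"
    using insert by (subst finprod_insert) (auto intro!: finprod_closed)
  finally show ?case .
qed auto

text \<open>A module for the semidirect product of \<open>G\<close> with \<open>A\<close>, encoded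
  by two actions and the relation \<open>compat\<close>, so that the semidirect product itself is
  never formed.\<close>

locale rank_two_module = rank_two_action G A phi r + V: comm_group V
  for G :: "('a, 'd) monoid_scheme" (structure) and A :: "('b, 'c) monoid_scheme"
    and phi :: "'b \<Rightarrow> 'a \<Rightarrow> 'a" and r :: nat and V :: "('v, 'w) monoid_scheme" +
  fixes psi :: "'a \<Rightarrow> 'v \<Rightarrow> 'v" and theta :: "'b \<Rightarrow> 'v \<Rightarrow> 'v"
  assumes finV: "finite (carrier V)" and r_not_dvd: "\<not> r dvd order G" and coprime_r: "coprime r (order V)"
    and psi_act: "aut_action G V psi" and theta_act: "aut_action A V theta"
    and compat: "a \<in> carrier A \<Longrightarrow> g \<in> carrier G \<Longrightarrow> v \<in> carrier V \<Longrightarrow>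
      theta a (psi g v) = psi (phi a g) (theta a v)"
begin

lemma psi_hom: "g \<in> carrier G \<Longrightarrow> psi g \<in> hom V V"
  using psi_act unfolding aut_action_def iso_def by blast

lemma theta_hom: "a \<in> carrier A \<Longrightarrow> theta a \<in> hom V V"
  using theta_act unfolding aut_action_def iso_def by blast

lemma psi_closed [simp]: "g \<in> carrier G \<Longrightarrow> v \<in> carrier V \<Longrightarrow> psi g v \<in> carrier V"
  using psi_hom unfolding hom_def by blast

lemma theta_closed [simp]: "a \<in> carrier A \<Longrightarrow> v \<in> carrier V \<Longrightarrow> theta a v \<in> carrier V"
  using theta_hom unfolding hom_def by blast

lemma psi_mult: "g \<in> carrier G \<Longrightarrow> v \<in> carrier V \<Longrightarrow> w \<in> carrier V \<Longrightarrow> psi g (v \<otimes>\<^bsub>V\<^esub> w) = psi g v \<otimes>\<^bsub>V\<^esub> psi g w"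
  using psi_hom unfolding hom_def by blast

lemma theta_mult: "a \<in> carrier A \<Longrightarrow> v \<in> carrier V \<Longrightarrow> w \<in> carrier V \<Longrightarrow> theta a (v \<otimes>\<^bsub>V\<^esub> w) = theta a v \<otimes>\<^bsub>V\<^esub> theta a w"
  using theta_hom unfolding hom_def by blast

lemma psi_group_hom: "g \<in> carrier G \<Longrightarrow> group_hom V V (psi g)"
  unfolding group_hom_def group_hom_axioms_def using psi_hom V.is_group by blast

lemma theta_group_hom: "a \<in> carrier A \<Longrightarrow> group_hom V V (theta a)"
  unfolding group_hom_def group_hom_axioms_def using theta_hom V.is_group by blast

lemma psi_V_one [simp]: "g \<in> carrier G \<Longrightarrow> psi g \<one>\<^bsub>V\<^esub> = \<one>\<^bsub>V\<^esub>"
  using group_hom.hom_one[OF psi_group_hom] .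

lemma psi_V_inv: "g \<in> carrier G \<Longrightarrow> v \<in> carrier V \<Longrightarrow> psi g (inv\<^bsub>V\<^esub> v) = inv\<^bsub>V\<^esub> (psi g v)"
  using group_hom.hom_inv[OF psi_group_hom] .

lemma theta_V_inv: "a \<in> carrier A \<Longrightarrow> v \<in> carrier V \<Longrightarrow> theta a (inv\<^bsub>V\<^esub> v) = inv\<^bsub>V\<^esub> (theta a v)"
  using group_hom.hom_inv[OF theta_group_hom] .

lemma psi_comp: "g \<in> carrier G \<Longrightarrow> h \<in> carrier G \<Longrightarrow> v \<in> carrier V \<Longrightarrow> psi (g \<otimes> h) v = psi g (psi h v)"
  using psi_act unfolding aut_action_def by blast

lemma theta_comp: "a \<in> carrier A \<Longrightarrow> b \<in> carrier A \<Longrightarrow> v \<in> carrier V \<Longrightarrow> theta (a \<otimes>\<^bsub>A\<^esub> b) v = theta a (theta b v)"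
  using theta_act unfolding aut_action_def by blast

lemma psi_one [simp]: "v \<in> carrier V \<Longrightarrow> psi \<one> v = v"
  using psi_act unfolding aut_action_def by blast

lemma theta_one [simp]: "v \<in> carrier V \<Longrightarrow> theta \<one>\<^bsub>A\<^esub> v = v"
  using theta_act unfolding aut_action_def by blast

lemma psi_inverse [simp]:
  "g \<in> carrier G \<Longrightarrow> v \<in> carrier V \<Longrightarrow> psi (inv g) (psi g v) = v"
  "g \<in> carrier G \<Longrightarrow> v \<in> carrier V \<Longrightarrow> psi g (psi (inv g) v) = v"
  using psi_comp[of "inv g" g v] psi_comp[of g "inv g" v] by auto

lemma theta_inverse [simp]:
  "a \<in> carrier A \<Longrightarrow> v \<in> carrier V \<Longrightarrow> theta (inv\<^bsub>A\<^esub> a) (theta a v) = v"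
  "a \<in> carrier A \<Longrightarrow> v \<in> carrier V \<Longrightarrow> theta a (theta (inv\<^bsub>A\<^esub> a) v) = v"
  using theta_comp[of "inv\<^bsub>A\<^esub> a" a v] theta_comp[of a "inv\<^bsub>A\<^esub> a" v] by auto

lemma psi_stabilizer_subgroup: "v \<in> carrier V \<Longrightarrow> subgroup {g \<in> carrier G. psi g v = v} G"
proof (rule G.subgroup_finI[OF finG])
  assume v: "v \<in> carrier V"
  show "{g \<in> carrier G. psi g v = v} \<noteq> {}" using v by (auto intro!: exI[of _ \<one>])
qed (auto simp: psi_comp)

lemma fixed_V_subgroup: "S \<subseteq> carrier G \<Longrightarrow> subgroup {v \<in> carrier V. \<forall>g\<in>S. psi g v = v} V"
  by (rule V.subgroupI) (auto simp: psi_mult psi_V_inv subset_iff intro!: exI[of _ "\<one>\<^bsub>V\<^esub>"])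

text \<open>In additive notation this is (g - 1) v, the image of \<open>v\<close> under an element
  of the group ring.\<close>

definition displ :: "'a \<Rightarrow> 'v \<Rightarrow> 'v" where
  "displ g v = psi g v \<otimes>\<^bsub>V\<^esub> inv\<^bsub>V\<^esub> v"

lemma displ_closed [simp]: "g \<in> carrier G \<Longrightarrow> v \<in> carrier V \<Longrightarrow> displ g v \<in> carrier V"
  unfolding displ_def by simp

lemma displ_one_iff: "g \<in> carrier G \<Longrightarrow> v \<in> carrier V \<Longrightarrow> displ g v = \<one>\<^bsub>V\<^esub> \<longleftrightarrow> psi g v = v"
  unfolding displ_def by (metis V.inv_closed V.inv_equality V.inv_inv V.r_inv psi_closed)

lemma displ_V_mult:
  "g \<in> carrier G \<Longrightarrow> v \<in> carrier V \<Longrightarrow> w \<in> carrier V \<Longrightarrow> displ g (v \<otimes>\<^bsub>V\<^esub> w) = displ g v \<otimes>\<^bsub>V\<^esub> displ g w"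
  unfolding displ_def by (simp add: psi_mult V.inv_mult V.m_ac)

lemma displ_V_hom: "g \<in> carrier G \<Longrightarrow> displ g \<in> hom V V"
  by (rule homI) (auto simp: displ_V_mult)

lemma psi_displ: "g \<in> carrier G \<Longrightarrow> v \<in> carrier V \<Longrightarrow> psi g v = displ g v \<otimes>\<^bsub>V\<^esub> v"
  unfolding displ_def by (simp add: V.m_assoc)

lemma displ_mult:
  assumes "g \<in> carrier G" "h \<in> carrier G" "v \<in> carrier V"
  shows "displ (g \<otimes> h) v = displ g (psi h v) \<otimes>\<^bsub>V\<^esub> displ h v"
  using assms unfolding displ_def
  by (simp add: psi_comp V.m_assoc)

lemma theta_displ:
  "a \<in> carrier A \<Longrightarrow> g \<in> carrier G \<Longrightarrow> v \<in> carrier V \<Longrightarrow> theta a (displ g v) = displ (phi a g) (theta a v)"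
  unfolding displ_def by (simp add: theta_mult theta_V_inv compat)

lemma psi_displ_conj:
  "g \<in> carrier G \<Longrightarrow> h \<in> carrier G \<Longrightarrow> v \<in> carrier V \<Longrightarrow> psi g (displ h v) = displ (g \<otimes> h \<otimes> inv g) (psi g v)"
  unfolding displ_def by (simp add: psi_mult psi_V_inv psi_comp)

text \<open>Replaces division by \<open>n\<close>, which is invertible on \<open>V\<close>, after an
  averaging argument.\<close>

lemma V_root:
  assumes "subgroup W V" "v \<in> carrier V" "v [^]\<^bsub>V\<^esub> (n::nat) \<in> W" "coprime n (order V)"
  shows "v \<in> W"
  using V.coprime_pow_mem[OF assms(1,2,3) _ assms(4)] V.pow_order_eq_1[OF assms(2)]
    subgroup.one_closed[OF assms(1)] by simp

text \<open>An average over \<open>S\<close> without the division by \<open>card S\<close>;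
  \<open>V_root\<close> takes over that division later.\<close>

definition norm :: "'a set \<Rightarrow> 'v \<Rightarrow> 'v" where
  "norm S v = finprod V (\<lambda>g. psi g v) S"

lemma norm_closed: "S \<subseteq> carrier G \<Longrightarrow> v \<in> carrier V \<Longrightarrow> norm S v \<in> carrier V"
  unfolding norm_def by (intro V.finprod_closed) auto

lemma psi_norm:
  assumes S: "subgroup S G" and g: "g \<in> S" and v: "v \<in> carrier V"
  shows "psi g (norm S v) = norm S v"
  unfolding norm_def by (rule finprod_orbit_fixed[OF G.is_group V.comm_group_axioms psi_act S g v])

lemma norm_mult:
  assumes "S \<subseteq> carrier G" "v \<in> carrier V" "w \<in> carrier V"
  shows "norm S (v \<otimes>\<^bsub>V\<^esub> w) = norm S v \<otimes>\<^bsub>V\<^esub> norm S w"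
proof -
  have "norm S (v \<otimes>\<^bsub>V\<^esub> w) = finprod V (\<lambda>g. psi g v \<otimes>\<^bsub>V\<^esub> psi g w) S"
    unfolding norm_def by (rule V.finprod_cong) (use assms in \<open>auto simp: simp_implies_def psi_mult subset_iff\<close>)
  also have "\<dots> = norm S v \<otimes>\<^bsub>V\<^esub> norm S w"
    unfolding norm_def by (rule V.finprod_multf) (use assms in auto)
  finally show ?thesis .
qed

lemma norm_fixed:
  assumes "v \<in> carrier V" "\<And>g. g \<in> S \<Longrightarrow> psi g v = v"
  shows "norm S v = v [^]\<^bsub>V\<^esub> card S"
proof -
  have "norm S v = finprod V (\<lambda>g. v) S"
    unfolding norm_def by (rule V.finprod_cong) (use assms in \<open>auto simp: simp_implies_def\<close>)
  then show ?thesis using V.finprod_const[OF assms(1)] by simp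
qed

end

text \<open>In the application \<open>V\<close> is an abelian section of \<open>O\<^sub>p(G)\<close> and \<open>T\<close> a Sylow subgroup of
  \<open>O\<^sub>p\<^sub>,\<^sub>p\<^sub>'(G)\<close>, acted on by its normalizer; \<open>Z\<close> is minimal among the invariant subgroups of \<open>T\<close>
  acting nontrivially on \<open>V\<close>, so that \<open>[Z,T]\<close> acts trivially.\<close>

locale rank_two_layer = rank_two_module G A phi r V psi theta
  for G :: "('a, 'd) monoid_scheme" (structure) and A :: "('b, 'c) monoid_scheme"
    and phi :: "'b \<Rightarrow> 'a \<Rightarrow> 'a" and r :: nat and V :: "('v, 'w) monoid_scheme"
    and psi :: "'a \<Rightarrow> 'v \<Rightarrow> 'v" and theta :: "'b \<Rightarrow> 'v \<Rightarrow> 'v" +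
  fixes T Z :: "'a set"
  assumes T_A_invariant: "A_invariant T" and T_normal: "g \<in> carrier G \<Longrightarrow> t \<in> T \<Longrightarrow> g \<otimes> t \<otimes> inv g \<in> T"
    and T_coprime: "coprime (card T) (order V)"
    and Z_A_invariant: "A_invariant Z" and Z_normal: "g \<in> carrier G \<Longrightarrow> z \<in> Z \<Longrightarrow> g \<otimes> z \<otimes> inv g \<in> Z"
    and Z_T: "Z \<subseteq> T"
    and commute: "z \<in> Z \<Longrightarrow> t \<in> T \<Longrightarrow> v \<in> carrier V \<Longrightarrow> psi z (psi t v) = psi t (psi z v)"
    and centralize: "nontriv x \<Longrightarrow> t \<in> T \<Longrightarrow> phi x t = t \<Longrightarrow> v \<in> carrier V \<Longrightarrow> theta x v = v \<Longrightarrow> psi t v = v"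
begin

sublocale T: subgroup T G by (rule A_invariantD(1)[OF T_A_invariant])
sublocale Z: subgroup Z G by (rule A_invariantD(1)[OF Z_A_invariant])

lemma T_r: "\<not> r dvd card T" and Z_r: "\<not> r dvd card Z"
  using G.subgroup_dvd[OF finG G.subgroup_self T.subgroup_axioms T.subset]
    G.subgroup_dvd[OF finG G.subgroup_self Z.subgroup_axioms Z.subset] r_not_dvd
  unfolding order_def by (auto dest: dvd_trans)

lemma sub_coprime: "subgroup S G \<Longrightarrow> S \<subseteq> T \<Longrightarrow> coprime (card S) (order V)"
  using G.subgroup_dvd[OF finG T.subgroup_axioms] T_coprime coprime_divisors dvd_refl by blast

lemma phi_T: "a \<in> carrier A \<Longrightarrow> t \<in> T \<Longrightarrow> phi a t \<in> T"
  by (rule A_invariantD(2)[OF T_A_invariant])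

lemma phi_Z: "a \<in> carrier A \<Longrightarrow> z \<in> Z \<Longrightarrow> phi a z \<in> Z"
  by (rule A_invariantD(2)[OF Z_A_invariant])

lemma ZT: "z \<in> Z \<Longrightarrow> z \<in> T" using Z_T by blast

lemma Z_normal': "g \<in> carrier G \<Longrightarrow> z \<in> Z \<Longrightarrow> inv g \<otimes> z \<otimes> g \<in> Z"
  using Z_normal[of "inv g" z] by simp

text \<open>Such a \<open>t\<close> centralizes the fixed points in \<open>V\<close> of every
  nonidentity element of \<open>A\<close>, and these generate \<open>V\<close>.\<close>

lemma A_fixed_trivial:
  assumes t: "t \<in> T" "\<And>a. a \<in> carrier A \<Longrightarrow> phi a t = t" and v: "v \<in> carrier V"
  shows "psi t v = v"
proof -
  have "{v \<in> carrier V. \<forall>g\<in>{t}. psi g v = v} = carrier V"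
    by (rule abelian_generated_by_fixed_points[OF V.comm_group_axioms finV theta_act coprime_r fixed_V_subgroup])
      (use t centralize in auto)
  then show ?thesis using v by blast
qed

lemma displ_commute:
  assumes "z \<in> Z" "t \<in> T" "v \<in> carrier V" shows "displ z (displ t v) = displ t (displ z v)"
  using assms commute[OF assms] unfolding displ_def
  by (simp add: psi_mult psi_V_inv V.inv_mult V.m_ac)

lemma psi_displ_commute:
  assumes "z \<in> Z" "t \<in> T" "v \<in> carrier V"
  shows "psi z (displ t v) = displ t (psi z v)" "psi t (displ z v) = displ z (psi t v)"
  using assms commute[OF assms] unfolding displ_def by (simp_all add: psi_mult psi_V_inv)

definition fixed_Z :: "'v set" where
  "fixed_Z = {v \<in> carrier V. \<forall>z\<in>Z. psi z v = v}"

lemma fixed_Z_subgroup: "subgroup fixed_Z V"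
  unfolding fixed_Z_def by (rule fixed_V_subgroup[OF Z.subset])

text \<open>The Frobenius-type averaging argument: conjugates by \<open>Z \<inter> fixed_pts x\<close> of the norm over
  \<open>cyc y\<close> are killed by \<open>displ t\<close>, and all their terms except those for the identity of \<open>cyc y\<close>
  add up to vectors fixed by \<open>Z \<inter> fixed_pts x\<close>.\<close>

lemma fixed_points_annihilate:
  assumes x: "nontriv x" and y: "nontriv y" and xy: "y \<notin> cyc x"
    and z: "z \<in> Z" "phi x z = z" and t: "t \<in> T" "phi y t = t" and v: "v \<in> carrier V"
  shows "displ z (displ t v) = \<one>\<^bsub>V\<^esub>"
proof -
  define S where "S = Z \<inter> fixed_pts x"
  have sS: "subgroup S G"
    unfolding S_def by (rule G.subgroups_Inter_pair[OF Z.subgroup_axioms fixed_pts_subgroup]) (use x in simp)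
  interpret S: subgroup S G by (rule sS)
  have SZ: "s \<in> Z" "phi x s = s" if "s \<in> S" for s using that unfolding S_def fixed_pts_def by auto
  have finS: "finite S" using G.subgroup_pos_card[OF finG sS] by simp
  let ?B = "cyc y"
  have sB: "subgroup ?B A" using cyc_subgroup y by blast
  have BA: "b \<in> carrier A" if "b \<in> ?B" for b using subgroup.mem_carrier[OF sB that] .
  have finB: "finite ?B" using A.subgroup_pos_card[OF finA sB] by simp
  have oneB: "\<one>\<^bsub>A\<^esub> \<in> ?B" by (rule subgroup.one_closed[OF sB])
  define W where "W = {w \<in> carrier V. \<forall>g\<in>S. psi g w = w}"
  have sW: "subgroup W V" unfolding W_def by (rule fixed_V_subgroup[OF S.subset])
  \<comment> \<open>This is \<open>v\<close> moved by the conjugate of \<open>b\<close> by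
    \<open>s\<close> in the semidirect product. The double product over \<open>s\<close> and
    \<open>b\<close> is evaluated in both orders: \<open>G1\<close> fixes \<open>b\<close>,
    \<open>G0\<close> fixes \<open>s\<close>.\<close>
  define F where "F s b = psi (inv s) (theta b (psi s v))" for s b
  have F_closed [simp]: "F s b \<in> carrier V" if "s \<in> S" "b \<in> ?B" for s b
    unfolding F_def using that v BA by simp
  have tG: "t \<in> carrier G" using t by simp
  have S_phi: "phi b s \<in> S" if "b \<in> carrier A" "s \<in> S" for b s
  proof -
    have "phi x (phi b s) = phi b (phi x s)"
      using phi_comp[of x b s] phi_comp[of b x s] m_comm[of b x] x that by simp
    then show ?thesis using that(1) SZ[OF that(2)] phi_Z[OF that(1), of s] unfolding S_def fixed_pts_def by simp
  qed
  \<comment> \<open>By \<open>compat\<close> the factors are the images of \<open>theta b v\<close>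
    under displacements of \<open>S\<close> by \<open>b\<close>, so their product is fixed by [S,b].
    A fixed point of \<open>b\<close> in \<open>S\<close> is fixed by \<open>x\<close> and
    \<open>b\<close>, hence by \<open>A\<close>, and acts trivially. Goodness then yields all of
    \<open>S\<close>, and \<open>displ t\<close> commutes with \<open>S\<close>.\<close>
  have G1: "finprod V (\<lambda>s. displ t (F s b)) S \<in> W" if b: "b \<in> ?B" "b \<noteq> \<one>\<^bsub>A\<^esub>" for b
  proof -
    have bA: "b \<in> carrier A" by (rule BA[OF b(1)])
    let ?w = "theta b v" and ?d = "\<lambda>s. inv s \<otimes> phi b s"
    let ?P = "finprod V (\<lambda>s. psi (?d s) ?w) S"
    have wV: "?w \<in> carrier V" using v bA by simp
    have dS: "?d s \<in> S" if "s \<in> S" for s using S_phi[OF bA that] that by simp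
    have PV: "?P \<in> carrier V" using dS wV by (intro V.finprod_closed) auto
    have fixP: "psi (?d s0) ?P = ?P" if s0: "s0 \<in> S" for s0
    proof -
      have "psi (?d s0) ?P = finprod V (\<lambda>s. psi (?d s0) (psi (?d s) ?w)) S"
        by (rule V.hom_finprod[OF psi_hom]) (use dS[OF s0] dS wV in auto)
      \<comment> \<open>Elements of \<open>Z\<close> commute with each other on \<open>V\<close>, so
        \<open>?d\<close> is multiplicative there and the product is only reindexed.\<close>
      also have "\<dots> = finprod V (\<lambda>s. psi (?d (s \<otimes> s0)) ?w) S"
      proof (rule V.finprod_cong'[OF refl])
        show "(\<lambda>s. psi (?d (s \<otimes> s0)) ?w) \<in> S \<rightarrow> carrier V"
          using dS s0 wV by (intro funcsetI psi_closed) (auto simp del: G.inv_mult_group)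
        show "psi (?d s0) (psi (?d s) ?w) = psi (?d (s \<otimes> s0)) ?w" if "s \<in> S" for s
        proof -
          have p: "phi b s0 \<in> S" using S_phi[OF bA s0] .
          have "psi (?d (s \<otimes> s0)) ?w = psi (inv s0 \<otimes> (?d s \<otimes> phi b s0)) ?w"
            using that s0 bA p S_phi[OF bA that] by (simp add: phi_mult G.m_assoc G.inv_mult_group)
          also have "\<dots> = psi (inv s0) (psi (?d s) (psi (phi b s0) ?w))"
            using that s0 p dS[OF that] wV S.mem_carrier by (simp add: psi_comp)
          also have "psi (?d s) (psi (phi b s0) ?w) = psi (phi b s0) (psi (?d s) ?w)"
            by (rule commute) (use dS[OF that] p SZ ZT wV in auto)
          also have "psi (inv s0) (psi (phi b s0) (psi (?d s) ?w)) = psi (?d s0) (psi (?d s) ?w)"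
            using s0 p dS[OF that] wV S.mem_carrier by (simp add: psi_comp)
          finally show ?thesis by simp
        qed
      qed
      also have "\<dots> = ?P"
      proof -
        have img: "(\<lambda>s. s \<otimes> s0) ` S = S" by (rule G.translate_subgroup(2)[OF sS s0])
        have "inj_on (\<lambda>s. s \<otimes> s0) S" using s0 by (auto intro!: inj_onI)
        moreover have "(\<lambda>s. psi (?d s) ?w) \<in> (\<lambda>s. s \<otimes> s0) ` S \<rightarrow> carrier V"
          unfolding img using dS wV S.mem_carrier by (intro funcsetI psi_closed) blast+
        ultimately show ?thesis using V.finprod_reindex[of "\<lambda>s. psi (?d s) ?w" "\<lambda>s. s \<otimes> s0" S] unfolding img by simp
      qed
      finally show ?thesis .
    qed
    have "S \<subseteq> {g \<in> carrier G. psi g ?P = ?P}"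
    proof (rule good_gen[OF bA sS S_phi[OF bA] psi_stabilizer_subgroup[OF PV]])
      show "?d s \<in> {g \<in> carrier G. psi g ?P = ?P}" if "s \<in> S" for s
        using fixP[OF that] dS[OF that] by simp
      show "s \<in> {g \<in> carrier G. psi g ?P = ?P}" if s: "s \<in> S" "phi b s = s" for s
      proof -
        have "b \<notin> cyc x"
          using cyc_eq[of x b] cyc_eq[of y b] x y b xy cyc_self[of y] by auto
        then have "psi s ?P = ?P"
          using fixed_by_two[OF x, of b s] s SZ[OF s(1)] bA ZT PV
          by (intro A_fixed_trivial) (auto simp: fixed_pts_def)
        then show ?thesis using s(1) by simp
      qed
    qed
    then have PW: "?P \<in> W" unfolding W_def using PV by blast
    have eq: "finprod V (\<lambda>s. F s b) S = ?P"
    proof (rule V.finprod_cong'[OF refl])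
      show "(\<lambda>s. psi (?d s) ?w) \<in> S \<rightarrow> carrier V" using dS wV by (intro funcsetI psi_closed) auto
      show "F s b = psi (?d s) ?w" if "s \<in> S" for s
        unfolding F_def using that v bA S_phi[OF bA that] S.mem_carrier by (simp add: compat psi_comp)
    qed
    have "finprod V (\<lambda>s. displ t (F s b)) S = displ t ?P"
      using V.hom_finprod[OF displ_V_hom[OF tG], of S "\<lambda>s. F s b"] b eq by simp
    moreover have "displ t ?P \<in> W"
      unfolding W_def using PW PV tG t SZ psi_displ_commute(1) by (auto simp: W_def)
    ultimately show ?thesis by simp
  qed
  \<comment> \<open>Up to the action of \<open>s\<close>, this is \<open>displ t\<close> of the norm
    of \<open>psi s v\<close> over \<open>cyc y\<close>. The norm is fixed by \<open>y\<close>, and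
    \<open>t\<close>, being fixed by \<open>y\<close> too, centralizes it.\<close>
  have G0: "finprod V (\<lambda>b. displ t (F s b)) ?B = \<one>\<^bsub>V\<^esub>" if s: "s \<in> S" for s
  proof -
    let ?u = "finprod V (\<lambda>b. theta b (psi s v)) ?B"
    have uV: "?u \<in> carrier V" using BA s v by (intro V.finprod_closed) auto
    have fixu: "theta y ?u = ?u"
      by (rule finprod_orbit_fixed[OF A.is_group V.comm_group_axioms theta_act sB cyc_self]) (use s v in simp)
    have "finprod V (\<lambda>b. displ t (F s b)) ?B = finprod V (\<lambda>b. psi (inv s) (displ t (theta b (psi s v)))) ?B"
    proof (rule V.finprod_cong'[OF refl])
      show "(\<lambda>b. psi (inv s) (displ t (theta b (psi s v)))) \<in> ?B \<rightarrow> carrier V" using s tG v BA by auto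
      show "displ t (F s b) = psi (inv s) (displ t (theta b (psi s v)))" if "b \<in> ?B" for b
        unfolding F_def using psi_displ_commute(1)[of "inv s" t "theta b (psi s v)"] SZ[OF S.m_inv_closed[OF s]] t s v BA[OF that]
        by simp
    qed
    also have "\<dots> = psi (inv s) (finprod V (\<lambda>b. displ t (theta b (psi s v))) ?B)"
      by (rule V.hom_finprod[OF psi_hom, symmetric]) (use s v tG BA in auto)
    also have "finprod V (\<lambda>b. displ t (theta b (psi s v))) ?B = displ t ?u"
      by (rule V.hom_finprod[OF displ_V_hom[OF tG], symmetric]) (use s v BA in auto)
    also have "displ t ?u = \<one>\<^bsub>V\<^esub>"
      using centralize[OF y t uV fixu] displ_one_iff[OF tG uV] by simp
    finally show ?thesis using s by simp
  qed
  let ?g = "\<lambda>b. finprod V (\<lambda>s. displ t (F s b)) S"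
  have "finprod V ?g ?B = finprod V (\<lambda>s. finprod V (\<lambda>b. displ t (F s b)) ?B) S"
    by (rule V.finprod_swap[OF finB, symmetric]) (use tG in auto)
  also have "\<dots> = \<one>\<^bsub>V\<^esub>" by (rule V.finprod_one_eqI) (rule G0)
  finally have tot: "finprod V ?g ?B = \<one>\<^bsub>V\<^esub>" .
  have gV: "?g b \<in> carrier V" if "b \<in> ?B" for b
    by (rule V.finprod_closed) (use that tG in auto)
  have "?B = insert \<one>\<^bsub>A\<^esub> (?B - {\<one>\<^bsub>A\<^esub>})" using oneB by blast
  then have "finprod V ?g ?B = finprod V ?g (insert \<one>\<^bsub>A\<^esub> (?B - {\<one>\<^bsub>A\<^esub>}))" by simp
  also have "\<dots> = ?g \<one>\<^bsub>A\<^esub> \<otimes>\<^bsub>V\<^esub> finprod V ?g (?B - {\<one>\<^bsub>A\<^esub>})"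
    using finB gV oneB by (intro V.finprod_insert) auto
  finally have prod: "?g \<one>\<^bsub>A\<^esub> \<otimes>\<^bsub>V\<^esub> finprod V ?g (?B - {\<one>\<^bsub>A\<^esub>}) = \<one>\<^bsub>V\<^esub>" using tot by simp
  have "finprod V ?g (?B - {\<one>\<^bsub>A\<^esub>}) \<in> W" by (rule V.finprod_mem_subgroup[OF sW]) (use G1 in auto)
  then have gW: "?g \<one>\<^bsub>A\<^esub> \<in> W"
    using V.subgroup_cancel_right[OF sW gV[OF oneB]] prod subgroup.one_closed[OF sW] by simp
  \<comment> \<open>For the identity of \<open>A\<close> the conjugation by \<open>s\<close>
    cancels, so every factor is \<open>displ t v\<close> and the product is its power by
    \<open>card S\<close>.\<close>
  have "?g \<one>\<^bsub>A\<^esub> = finprod V (\<lambda>s. displ t v) S"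
    by (rule V.finprod_cong) (use tG v in \<open>auto simp: F_def simp_implies_def\<close>)
  then have "displ t v [^]\<^bsub>V\<^esub> card S \<in> W" using gW V.finprod_const[of "displ t v" S] tG v by simp
  then have "displ t v \<in> W"
    by (rule V_root[OF sW displ_closed[OF tG v] _ sub_coprime[OF sS]]) (use SZ ZT in auto)
  moreover have "z \<in> S" using z unfolding S_def fixed_pts_def by simp
  ultimately show ?thesis using displ_one_iff[of z "displ t v"] tG v z unfolding W_def by simp
qed

text \<open>This is the decomposition of V into C_V(Z) and [V,Z], with [V,Z] spanned by the
  contributions of the fixed points that generate \<open>Z\<close>. The norm of \<open>v\<close>
  over \<open>Z\<close> lies in \<open>fixed_Z\<close> and equals the product of all displacements
  of \<open>v\<close> times \<open>v\<close> to the power \<open>card Z\<close>, which is prime to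
  the order of \<open>V\<close>.\<close>

lemma span_V:
  assumes W: "subgroup W V" and C: "fixed_Z \<subseteq> W"
    and d: "\<And>x z v. nontriv x \<Longrightarrow> z \<in> Z \<Longrightarrow> phi x z = z \<Longrightarrow> v \<in> carrier V \<Longrightarrow> displ z v \<in> W"
  shows "W = carrier V"
proof -
  interpret W: subgroup W V by fact
  let ?D = "{z \<in> Z. \<forall>v\<in>carrier V. displ z v \<in> W}"
  have "subgroup ?D G"
  proof (rule G.subgroup_finI[OF finG])
    show "?D \<noteq> {}" using W.one_closed displ_one_iff[of \<one>] by (auto intro!: exI[of _ \<one>])
    fix g h assume "g \<in> ?D" "h \<in> ?D"
    then show "g \<otimes> h \<in> ?D" by (auto simp: displ_mult intro!: W.m_closed)
  qed auto
  then have ZD: "Z \<subseteq> ?D"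
    by (rule generated_by_fixed_points[OF Z_A_invariant Z_r]) (use d in \<open>auto simp: fixed_pts_def\<close>)
  have "v \<in> W" if v: "v \<in> carrier V" for v
  proof -
    have "norm Z v \<in> fixed_Z" unfolding fixed_Z_def using norm_closed[OF Z.subset v] psi_norm[OF Z.subgroup_axioms _ v] by simp
    then have nW: "norm Z v \<in> W" using C by blast
    have "norm Z v = finprod V (\<lambda>z. displ z v \<otimes>\<^bsub>V\<^esub> v) Z"
      unfolding norm_def by (rule V.finprod_cong) (use v psi_displ in \<open>auto simp: simp_implies_def\<close>)
    also have "\<dots> = finprod V (\<lambda>z. displ z v) Z \<otimes>\<^bsub>V\<^esub> finprod V (\<lambda>z. v) Z"
      by (rule V.finprod_multf) (use v in auto)
    also have "finprod V (\<lambda>z. v) Z = v [^]\<^bsub>V\<^esub> card Z" by (rule V.finprod_const[OF v])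
    finally have "finprod V (\<lambda>z. displ z v) Z \<otimes>\<^bsub>V\<^esub> v [^]\<^bsub>V\<^esub> card Z \<in> W" using nW by simp
    moreover have "finprod V (\<lambda>z. displ z v) Z \<in> W" by (rule V.finprod_mem_subgroup[OF W]) (use ZD v in blast)
    ultimately have "v [^]\<^bsub>V\<^esub> card Z \<in> W" using V.subgroup_cancel_left[OF W] v by blast
    then show ?thesis by (rule V_root[OF W v _ sub_coprime[OF Z.subgroup_axioms Z_T]])
  qed
  then show ?thesis using W.subset by blast
qed

end

section \<open>Displacements by fixed points of x and the fixed points of [Z,x]\<close>

context rank_two_layer
begin

text \<open>The fixed points of \<open>[Z,x]\<close> in \<open>V\<close>.\<close>

definition comm_fixed :: "'b \<Rightarrow> 'v set" where
  "comm_fixed x = {v \<in> carrier V. \<forall>z\<in>Z. psi (phi x z) v = psi z v}"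

lemma comm_fixed_closed: "v \<in> comm_fixed x \<Longrightarrow> v \<in> carrier V"
  unfolding comm_fixed_def by blast

lemma comm_fixed_subgroup: assumes "x \<in> carrier A" shows "subgroup (comm_fixed x) V"
  by (rule V.subgroupI)
    (use assms phi_Z in \<open>auto simp: comm_fixed_def psi_mult psi_V_inv subset_iff intro!: exI[of _ "\<one>\<^bsub>V\<^esub>"]\<close>)

lemma comm_fixed_psi_Z: assumes "x \<in> carrier A" "v \<in> comm_fixed x" "z \<in> Z" shows "psi z v \<in> comm_fixed x"
proof -
  have v: "v \<in> carrier V" by (rule comm_fixed_closed[OF assms(2)])
  have "psi (phi x s) (psi z v) = psi s (psi z v)" if s: "s \<in> Z" for s
    using commute[of "phi x s" z v] commute[of s z v] assms s v phi_Z[OF assms(1) s] ZT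
    unfolding comm_fixed_def by simp
  then show ?thesis using v assms(3) unfolding comm_fixed_def by simp
qed

lemma comm_fixed_comm:
  assumes x: "x \<in> carrier A" and v: "v \<in> comm_fixed x" and z: "z \<in> Z" shows "psi (inv z \<otimes> phi x z) v = v"
  using assms phi_Z[OF x z] comm_fixed_closed[OF v] unfolding comm_fixed_def by (simp add: psi_comp)

lemma fixed_Z_comm_fixed: "x \<in> carrier A \<Longrightarrow> fixed_Z \<subseteq> comm_fixed x"
  unfolding fixed_Z_def comm_fixed_def using phi_Z by auto

text \<open>Let \<open>?K\<close> be the kernel of \<open>Z\<close> on [V, C_Z(x)]. For
  \<open>y\<close> outside \<open>cyc x\<close> the fixed points of \<open>y\<close> in
  \<open>Z\<close> lie in it by \<open>fixed_points_annihilate\<close>, so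
  \<open>trivial_modulo\<close> puts [Z,x] into \<open>?K\<close>.\<close>

lemma displ_comm_fixed:
  assumes x: "nontriv x" and z: "z \<in> Z" "phi x z = z" and v: "v \<in> carrier V"
  shows "displ z v \<in> comm_fixed x"
proof -
  let ?K = "{s \<in> Z. \<forall>z\<in>Z. phi x z = z \<longrightarrow> (\<forall>v\<in>carrier V. psi s (displ z v) = displ z v)}"
  have sK: "subgroup ?K G"
  proof (rule G.subgroup_finI[OF finG])
    show "?K \<noteq> {}" by (auto intro!: exI[of _ \<one>])
  qed (auto simp: psi_comp)
  have K: "A_invariant ?K"
    unfolding A_invariant_def
  proof (intro conjI ballI sK)
    fix a s assume a: "a \<in> carrier A" and s: "s \<in> ?K"
    have "psi (phi a s) (displ z v) = displ z v" if z: "z \<in> Z" "phi x z = z" and v: "v \<in> carrier V" for z v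
    proof -
      define z' where "z' = phi (inv\<^bsub>A\<^esub> a) z"
      define v' where "v' = theta (inv\<^bsub>A\<^esub> a) v"
      have z': "z' \<in> Z" "phi a z' = z" and v': "v' \<in> carrier V" "theta a v' = v"
        using a z v phi_Z unfolding z'_def v'_def by auto
      \<comment> \<open>\<open>A\<close> is abelian, so it preserves the fixed points of
        \<open>x\<close>.\<close>
      have "phi x z' = phi (inv\<^bsub>A\<^esub> a) (phi x z)"
        using phi_comp[of x "inv\<^bsub>A\<^esub> a" z] phi_comp[of "inv\<^bsub>A\<^esub> a" x z] m_comm[of x "inv\<^bsub>A\<^esub> a"] x a z
        unfolding z'_def by simp
      then have "phi x z' = z'" using z unfolding z'_def by simp
      then have "psi s (displ z' v') = displ z' v'" using s z' v' by blast
      then have "theta a (psi s (displ z' v')) = theta a (displ z' v')" by simp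
      then show ?thesis using a s z' v' by (simp add: compat theta_displ)
    qed
    then show "phi a s \<in> ?K" using s phi_Z[OF a] by blast
  qed
  have "psi (phi x s) (displ z v) = psi s (displ z v)" if s: "s \<in> Z" for s
  proof -
    have "inv s \<otimes> phi x s \<in> ?K"
    proof (rule trivial_modulo[OF Z_A_invariant Z_r K _ _ x _ s])
      show "inv h \<otimes> k \<otimes> h \<in> ?K" if hk: "h \<in> Z" "k \<in> ?K" for h k
      proof -
        have "psi (inv h \<otimes> k \<otimes> h) (displ z v) = displ z v"
          if z: "z \<in> Z" "phi x z = z" and v: "v \<in> carrier V" for z v
        proof -
          have w: "displ z v \<in> carrier V" using z v by simp
          have "psi (inv h \<otimes> k \<otimes> h) (displ z v) = psi (inv h) (psi k (psi h (displ z v)))"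
            using hk w by (simp add: psi_comp)
          also have "psi k (psi h (displ z v)) = psi h (psi k (displ z v))"
            by (rule commute) (use hk w ZT in auto)
          finally show ?thesis using hk w z v by auto
        qed
        then show ?thesis using hk by simp
      qed
      show "fixed_pts y \<inter> Z \<subseteq> ?K" if y: "nontriv y" "y \<notin> cyc x" for y
      proof
        fix s assume s: "s \<in> fixed_pts y \<inter> Z"
        have "psi s (displ z v) = displ z v" if z: "z \<in> Z" "phi x z = z" and v: "v \<in> carrier V" for z v
        proof -
          have "displ z (displ s v) = \<one>\<^bsub>V\<^esub>"
            by (rule fixed_points_annihilate[OF x y z _ _ v]) (use s ZT in \<open>auto simp: fixed_pts_def\<close>)
          then have "displ s (displ z v) = \<one>\<^bsub>V\<^esub>" using displ_commute[of z s v] s z v ZT by simp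
          then show ?thesis using displ_one_iff[of s "displ z v"] s z v by simp
        qed
        then show "s \<in> ?K" using s by blast
      qed
    qed blast
    then have "psi (inv s \<otimes> phi x s) (displ z v) = displ z v" using z v by blast
    then have "psi s (psi (inv s \<otimes> phi x s) (displ z v)) = psi s (displ z v)" by simp
    then show ?thesis using s x phi_Z[of x s] z v by (simp add: psi_comp)
  qed
  then show ?thesis unfolding comm_fixed_def using z v by simp
qed

text \<open>The operators \<open>\<sigma>\<close> on \<open>Z\<close> for which \<open>\<sigma> z\<close> and \<open>z\<close> move \<open>v\<close> in the same way are closed
  under composition.  From \<open>y\<close> and the conjugate of \<open>x\<close> by \<open>n\<close> we obtain first an element of
  \<open>cyc w\<close> (using that \<open>r\<close> does not divide the order of \<open>G\<close>) and then all conjugates of \<open>A\<close> by \<open>n\<close>.\<close>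

lemma comm_fixed_conj_disjoint:
  assumes x: "nontriv x" and y: "nontriv y" and w: "nontriv w"
    and yx: "y \<notin> cyc x" and wx: "w \<notin> cyc x" and n: "n \<in> fixed_pts w"
    and v: "v \<in> comm_fixed y" and vx: "\<And>z. z \<in> Z \<Longrightarrow> psi (n \<otimes> (inv z \<otimes> phi x z) \<otimes> inv n) v = v"
    and z: "z \<in> Z"
  shows "psi z v = v"
proof -
  have vV: "v \<in> carrier V" by (rule comm_fixed_closed[OF v])
  have nG: "n \<in> carrier G" and nw: "phi w n = n" using n unfolding fixed_pts_def by auto
  define E where "E \<sigma> \<longleftrightarrow> (\<forall>z\<in>Z. \<sigma> z \<in> Z \<and> psi (\<sigma> z) v = psi z v)" for \<sigma>
  have E_comp: "E (\<lambda>z. \<sigma> (\<tau> z))" if "E \<sigma>" "E \<tau>" for \<sigma> \<tau> using that unfolding E_def by auto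
  have Ey: "E (phi y)" using v phi_Z[of y] y unfolding E_def comm_fixed_def by blast
  \<comment> \<open>The automorphism of \<open>Z\<close> induced by the conjugate of
    \<open>a\<close> by \<open>n\<close> in the semidirect product.\<close>
  define al where "al a z = n \<otimes> phi a (inv n \<otimes> z \<otimes> n) \<otimes> inv n" for a z
  have al_Z: "al a z \<in> Z" if "a \<in> carrier A" "z \<in> Z" for a z
    unfolding al_def using Z_normal[OF nG phi_Z[OF that(1) Z_normal'[OF nG that(2)]]] .
  have al_comp: "al (a \<otimes>\<^bsub>A\<^esub> b) z = al a (al b z)" if "a \<in> carrier A" "b \<in> carrier A" "z \<in> Z" for a b z
    unfolding al_def using that nG by (simp add: phi_comp G.m_assoc)
  have "subgroup {a \<in> carrier A. E (al a)} A"
  proof (rule A.subgroup_finI[OF finA])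
    have "al \<one>\<^bsub>A\<^esub> z = z" if "z \<in> Z" for z unfolding al_def using that nG by (simp add: phi_id G.m_assoc)
    then have "E (al \<one>\<^bsub>A\<^esub>)" unfolding E_def by simp
    then show "{a \<in> carrier A. E (al a)} \<noteq> {}" by blast
    fix a b assume ab: "a \<in> {a \<in> carrier A. E (al a)}" "b \<in> {a \<in> carrier A. E (al a)}"
    then have "E (\<lambda>z. al a (al b z))" using E_comp by blast
    then have "E (al (a \<otimes>\<^bsub>A\<^esub> b))" unfolding E_def using al_comp ab by simp
    then show "a \<otimes>\<^bsub>A\<^esub> b \<in> {a \<in> carrier A. E (al a)}" using ab by simp
  qed blast
  then have sE: "subgroup {a \<in> carrier A. E (al a)} A" .
  have "E (al x)"
    unfolding E_def
  proof (intro ballI conjI)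
    fix z assume z: "z \<in> Z"
    show "al x z \<in> Z" using al_Z x z by blast
    define z' where "z' = inv n \<otimes> z \<otimes> n"
    have z': "z' \<in> Z" unfolding z'_def by (rule Z_normal'[OF nG z])
    \<comment> \<open>\<open>al x z\<close> differs from \<open>z\<close> by a conjugate by
      \<open>n\<close> of a displacement under \<open>x\<close>, and these fix \<open>v\<close> by
      \<open>vx\<close>.\<close>
    have eq: "al x z = z \<otimes> (n \<otimes> (inv z' \<otimes> phi x z') \<otimes> inv n)"
      unfolding al_def z'_def using z nG x by (simp add: phi_mult phi_inv G.m_assoc G.inv_mult_group)
    have "psi (al x z) v = psi z (psi (n \<otimes> (inv z' \<otimes> phi x z') \<otimes> inv n) v)"
      unfolding eq using z z' nG vV x phi_Z[of x z'] by (simp add: psi_comp)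
    then show "psi (al x z) v = psi z v" using vx[OF z'] by simp
  qed
  then have xE: "x \<in> {a \<in> carrier A. E (al a)}" using x by simp
  obtain x' w' where xw: "x' \<in> cyc x" "w' \<in> cyc w" "y = x' \<otimes>\<^bsub>A\<^esub> w'"
    using decompose[of x w y] x y w wx by blast
  have x'A: "x' \<in> carrier A" and w'A: "w' \<in> carrier A"
    using subgroup.mem_carrier[OF cyc_subgroup] xw x w by blast+
  have w'1: "w' \<noteq> \<one>\<^bsub>A\<^esub>" using xw yx x'A by auto
  have "inv\<^bsub>A\<^esub> x' \<in> {a \<in> carrier A. E (al a)}"
    using cyc_incl[OF sE xE] xw(1) subgroup.m_inv_closed[OF sE] by blast
  then have "E (al (inv\<^bsub>A\<^esub> x'))" by blast
  then have Eb: "E (\<lambda>z. al (inv\<^bsub>A\<^esub> x') (phi y z))" using E_comp Ey by blast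
  \<comment> \<open>\<open>al (inv x')\<close> composed with \<open>phi y\<close> is
    \<open>phi w'\<close> followed by conjugation by \<open>m\<close>. Since \<open>w'\<close> fixes
    \<open>m\<close>, the powers of this operator have the same shape, with \<open>m ^ k\<close> and
    the k-th power of \<open>w'\<close>.\<close>
  define m where "m = n \<otimes> phi (inv\<^bsub>A\<^esub> x') (inv n)"
  have mG: "m \<in> carrier G" unfolding m_def using nG x'A by simp
  have w'n: "phi w' n = n" using fixed_cyc[OF _ n xw(2)] w by blast
  have w'm: "phi w' m = m"
  proof -
    have "phi w' (phi (inv\<^bsub>A\<^esub> x') (inv n)) = phi (inv\<^bsub>A\<^esub> x') (phi w' (inv n))"
      using phi_comp[of w' "inv\<^bsub>A\<^esub> x'" "inv n"] phi_comp[of "inv\<^bsub>A\<^esub> x'" w' "inv n"] m_comm[of w' "inv\<^bsub>A\<^esub> x'"]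
        w'A x'A nG by simp
    then show ?thesis unfolding m_def using w'n w'A nG x'A by (simp add: phi_mult phi_inv)
  qed
  have beta: "al (inv\<^bsub>A\<^esub> x') (phi y z) = m \<otimes> phi w' z \<otimes> inv m" if z: "z \<in> Z" for z
  proof -
    have "phi (inv\<^bsub>A\<^esub> x') (phi y z) = phi w' z"
      using phi_comp[of "inv\<^bsub>A\<^esub> x'" y z] xw(3) x'A w'A z A.m_assoc[of "inv\<^bsub>A\<^esub> x'" x' w'] y by simp
    then show ?thesis unfolding al_def m_def using z nG x'A w'A y
      by (simp add: phi_mult phi_inv G.m_assoc G.inv_mult_group)
  qed
  have Ebk: "E (\<lambda>z. m [^] k \<otimes> phi (w' [^]\<^bsub>A\<^esub> k) z \<otimes> inv (m [^] k))" for k :: nat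
  proof (induction k)
    case 0
    show ?case unfolding E_def by (simp add: phi_id)
  next
    case (Suc k)
    have "m [^] Suc k \<otimes> phi (w' [^]\<^bsub>A\<^esub> Suc k) z \<otimes> inv (m [^] Suc k)
      = m [^] k \<otimes> phi (w' [^]\<^bsub>A\<^esub> k) (al (inv\<^bsub>A\<^esub> x') (phi y z)) \<otimes> inv (m [^] k)" if z: "z \<in> Z" for z
    proof -
      have "phi (w' [^]\<^bsub>A\<^esub> j) m = m" for j :: nat
        by (induction j) (use w'm w'A mG in \<open>auto simp: phi_id phi_comp\<close>)
      then show ?thesis
        using beta[OF z] mG w'A z by (simp add: phi_mult phi_inv phi_comp G.m_assoc G.inv_mult_group)
    qed
    then show ?case using E_comp[OF Suc.IH Eb] unfolding E_def by simp
  qed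
  \<comment> \<open>The exponent \<open>order G\<close> kills \<open>m\<close> and leaves a
    nontrivial power of \<open>w'\<close>, because \<open>r\<close> does not divide it. As
    \<open>w2\<close> fixes \<open>n\<close>, the remaining operator \<open>phi w2\<close> is
    \<open>al w2\<close>.\<close>
  define w2 where "w2 = w' [^]\<^bsub>A\<^esub> order G"
  have w2A: "w2 \<in> carrier A" unfolding w2_def using w'A by simp
  have w2w: "w2 \<in> cyc w" unfolding w2_def using A.subgroup_pow[OF cyc_subgroup xw(2)] w by blast
  have w2n: "phi w2 n = n" using fixed_cyc[OF _ n w2w] w by blast
  have w21: "w2 \<noteq> \<one>\<^bsub>A\<^esub>"
  proof
    assume "w2 = \<one>\<^bsub>A\<^esub>"
    then have "w' \<in> {\<one>\<^bsub>A\<^esub>}"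
      using A.coprime_pow_mem[OF A.triv_subgroup w'A, of r "order G"] exponent[OF w'A]
        prime_imp_coprime[OF prime_r r_not_dvd] unfolding w2_def by simp
    with w'1 show False by simp
  qed
  have "E (al w2)"
  proof -
    have "m [^] order G = \<one>" by (rule G.pow_order_eq_1[OF mG])
    then have "E (\<lambda>z. \<one> \<otimes> phi w2 z \<otimes> inv \<one>)" using Ebk[of "order G"] unfolding w2_def by simp
    moreover have "al w2 z = \<one> \<otimes> phi w2 z \<otimes> inv \<one>" if "z \<in> Z" for z
      unfolding al_def using that w2A w2n nG by (simp add: phi_mult phi_inv G.m_assoc)
    ultimately show ?thesis unfolding E_def by simp
  qed
  moreover have "w2 \<notin> cyc x"
    using cyc_eq[of w w2] cyc_eq[of x w2] w x w2w w21 wx cyc_self[of w] by auto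
  ultimately have all: "{a \<in> carrier A. E (al a)} = carrier A"
    using two_generate[OF sE xE, of w2] x w2A by blast
  \<comment> \<open>All displacements of \<open>Z\<close> under \<open>A\<close>, conjugated by
    \<open>n\<close>, now fix \<open>v\<close>, and the fixed points of \<open>A\<close> in
    \<open>Z\<close> act trivially on \<open>V\<close>. By goodness the conjugate of
    \<open>Z\<close> by \<open>n\<close>, which is \<open>Z\<close>, fixes \<open>v\<close>.\<close>
  let ?D = "{u \<in> carrier G. psi (n \<otimes> u \<otimes> inv n) v = v}"
  have "Z \<subseteq> ?D"
  proof (rule good_gen_all[OF Z_A_invariant])
    show "subgroup ?D G"
    proof (rule G.subgroup_finI[OF finG])
      show "?D \<noteq> {}" using nG vV by (auto intro!: exI[of _ \<one>])
      fix a b assume ab: "a \<in> ?D" "b \<in> ?D"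
      have "psi (n \<otimes> (a \<otimes> b) \<otimes> inv n) v = psi ((n \<otimes> a \<otimes> inv n) \<otimes> (n \<otimes> b \<otimes> inv n)) v"
        using ab nG by (simp add: G.m_assoc)
      also have "\<dots> = psi (n \<otimes> a \<otimes> inv n) (psi (n \<otimes> b \<otimes> inv n) v)"
        by (rule psi_comp) (use ab nG vV in auto)
      finally show "a \<otimes> b \<in> ?D" using ab by simp
    qed blast
  next
    fix a h assume a: "a \<in> carrier A" and h: "h \<in> Z"
    define z where "z = n \<otimes> h \<otimes> inv n"
    have zZ: "z \<in> Z" unfolding z_def by (rule Z_normal[OF nG h])
    have "E (al a)" using all a by blast
    then have "psi (al a z) v = psi z v" using zZ unfolding E_def by blast
    then have "psi (inv z) (psi (al a z) v) = v" using zZ vV by simp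
    then have "psi (inv z \<otimes> al a z) v = v" using zZ al_Z[OF a zZ] vV by (simp add: psi_comp)
    moreover have "inv z \<otimes> al a z = n \<otimes> (inv h \<otimes> phi a h) \<otimes> inv n"
      unfolding z_def al_def using h nG a by (simp add: G.m_assoc G.inv_mult_group)
    ultimately show "inv h \<otimes> phi a h \<in> ?D" using h a by simp
  next
    fix h assume h: "h \<in> Z" "\<And>a. a \<in> carrier A \<Longrightarrow> phi a h = h"
    have "psi h (psi (inv n) v) = psi (inv n) v"
      by (rule A_fixed_trivial) (use h ZT nG vV in auto)
    then show "h \<in> ?D" using h nG vV by (simp add: psi_comp)
  qed
  then have "inv n \<otimes> z \<otimes> n \<in> ?D" using Z_normal'[OF nG z] by blast
  moreover have "n \<otimes> (inv n \<otimes> z \<otimes> n) \<otimes> inv n = z" using nG z by (simp add: G.m_assoc)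
  ultimately show ?thesis by simp
qed

end

section \<open>Invariance of the fixed points of [Z,x], and the kernels they define\<close>

context rank_two_layer
begin

text \<open>An element fixed by \<open>x\<close> normalizes [Z,x], since it commutes with
  \<open>x\<close> in the semidirect product.\<close>

lemma comm_fixed_same_cyc:
  assumes x: "nontriv x" and n: "n \<in> fixed_pts x" and v: "v \<in> comm_fixed x"
  shows "psi n v \<in> comm_fixed x"
proof -
  have nG: "n \<in> carrier G" "phi x n = n" using n unfolding fixed_pts_def by auto
  have vV: "v \<in> carrier V" by (rule comm_fixed_closed[OF v])
  have "psi (phi x z) (psi n v) = psi z (psi n v)" if z: "z \<in> Z" for z
  proof -
    have z': "inv n \<otimes> z \<otimes> n \<in> Z" by (rule Z_normal'[OF nG(1) z])
    have "psi (phi x z) (psi n v) = psi n (psi (phi x (inv n \<otimes> z \<otimes> n)) v)"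
      using z nG vV x phi_Z[of x z] by (simp add: phi_mult phi_inv psi_comp)
    also have "psi (phi x (inv n \<otimes> z \<otimes> n)) v = psi (inv n \<otimes> z \<otimes> n) v"
      using v z' unfolding comm_fixed_def by blast
    finally show ?thesis using z nG vV by (simp add: psi_comp)
  qed
  then show ?thesis unfolding comm_fixed_def using nG vV by simp
qed

text \<open>For \<open>w\<close> outside \<open>cyc x\<close>, let \<open>S\<close> be the conjugate
  of [Z,x] by \<open>n\<close>. The norm over \<open>S\<close> maps all of \<open>V\<close> into
  \<open>comm_fixed x\<close>, which is checked on the spanning set of \<open>span_V\<close>:
  displacements belonging to \<open>cyc x\<close> already lie in \<open>comm_fixed x\<close>, which
  \<open>Z\<close> preserves; for other \<open>y\<close> the norm lies in
  \<open>comm_fixed y\<close> and is fixed by \<open>S\<close>, hence by \<open>Z\<close> through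
  \<open>comm_fixed_conj_disjoint\<close>. As \<open>psi n v\<close> is fixed by \<open>S\<close>,
  its norm is a power of it and a root can be taken.\<close>

lemma comm_fixed_fixed_pts_invariant:
  assumes x: "nontriv x" and w: "nontriv w" and n: "n \<in> fixed_pts w" and v: "v \<in> comm_fixed x"
  shows "psi n v \<in> comm_fixed x"
proof (cases "w \<in> cyc x")
  case True
  then have "x \<in> cyc w" using cyc_eq[of x w] x w cyc_self by blast
  then have "n \<in> fixed_pts x" using fixed_cyc[OF _ n] n w unfolding fixed_pts_def by blast
  then show ?thesis using comm_fixed_same_cyc[OF x _ v] by blast
next
  case wx: False
  have nG: "n \<in> carrier G" using n unfolding fixed_pts_def by auto
  have vV: "v \<in> carrier V" by (rule comm_fixed_closed[OF v])
  let ?C = "{inv z \<otimes> phi x z |z. z \<in> Z}"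
  define S where "S = G.conj_set n (generate G ?C)"
  have CZ': "?C \<subseteq> Z" using phi_Z x by auto
  have sC: "subgroup (generate G ?C) G" by (rule G.generate_is_subgroup) (use CZ' Z.subset in blast)
  have sS: "subgroup S G" unfolding S_def by (rule G.subgroup_conj_set[OF nG sC])
  have "generate G ?C \<subseteq> Z" by (rule G.generate_subgroup_incl[OF CZ' Z.subgroup_axioms])
  then have SZ: "S \<subseteq> Z" unfolding S_def G.conj_set_def using Z_normal[OF nG] by blast
  have SG: "S \<subseteq> carrier G" using SZ Z.subset by blast
  have UUy: "norm S u \<in> comm_fixed y" if "y \<in> carrier A" "u \<in> comm_fixed y" for y u
    unfolding norm_def
    by (rule V.finprod_mem_subgroup[OF comm_fixed_subgroup]) (use that comm_fixed_psi_Z SZ in blast)+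
  have hn: "norm S \<in> hom V V"
    by (rule homI) (use norm_closed[OF SG] norm_mult[OF SG] in auto)
  let ?W = "{v \<in> carrier V. norm S v \<in> comm_fixed x}"
  have xA: "x \<in> carrier A" using x by simp
  interpret U: subgroup "comm_fixed x" V by (rule comm_fixed_subgroup[OF xA])
  have sW: "subgroup ?W V"
  proof (rule V.subgroup_finI[OF finV])
    show "?W \<noteq> {}" using UUy[OF xA U.one_closed] by (auto intro!: exI[of _ "\<one>\<^bsub>V\<^esub>"])
  qed (auto simp: norm_mult[OF SG])
  have "?W = carrier V"
  proof (rule span_V[OF sW])
    show "fixed_Z \<subseteq> ?W" using fixed_Z_comm_fixed[OF xA] UUy[OF xA] comm_fixed_closed by blast
    fix y z u assume y: "nontriv y" and z: "z \<in> Z" "phi y z = z" and u: "u \<in> carrier V"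
    have duV: "displ z u \<in> carrier V" using z u by simp
    show "displ z u \<in> ?W"
    proof (cases "y \<in> cyc x")
      case True
      then have "x \<in> cyc y" using cyc_eq[of x y] x y cyc_self by blast
      then have "phi x z = z" using fixed_cyc[of y z x] y z unfolding fixed_pts_def by auto
      then show ?thesis using UUy[OF xA displ_comm_fixed[OF x z(1) _ u]] duV by blast
    next
      case False
      have nU: "norm S (displ z u) \<in> comm_fixed y" using UUy[OF _ displ_comm_fixed[OF y z u]] y by blast
      have fx: "psi (n \<otimes> (inv s \<otimes> phi x s) \<otimes> inv n) (norm S (displ z u)) = norm S (displ z u)" if s: "s \<in> Z" for s
      proof (rule psi_norm[OF sS _ duV])
        have "inv s \<otimes> phi x s \<in> generate G ?C" by (rule generate.incl) (use s in blast)
        then show "n \<otimes> (inv s \<otimes> phi x s) \<otimes> inv n \<in> S" unfolding S_def G.conj_set_def by blast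
      qed
      have "norm S (displ z u) \<in> fixed_Z"
        unfolding fixed_Z_def using comm_fixed_conj_disjoint[OF x y w False wx n nU fx] comm_fixed_closed[OF nU] by blast
      then show ?thesis using fixed_Z_comm_fixed[OF xA] duV by blast
    qed
  qed
  then have "norm S (psi n v) \<in> comm_fixed x" using nG vV psi_closed by blast
  moreover have "norm S (psi n v) = psi n v [^]\<^bsub>V\<^esub> card S"
  proof (rule norm_fixed)
    show "psi n v \<in> carrier V" using nG vV by simp
    fix g assume "g \<in> S"
    then obtain u where u: "u \<in> generate G ?C" "g = n \<otimes> u \<otimes> inv n" unfolding S_def G.conj_set_def by blast
    have "generate G ?C \<subseteq> {g \<in> carrier G. psi g v = v}"
      by (rule G.generate_subgroup_incl[OF _ psi_stabilizer_subgroup[OF vV]])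
        (use comm_fixed_comm[OF xA v] CZ' Z.subset in blast)
    then have "psi u v = v" "u \<in> carrier G" using u(1) by blast+
    then show "psi g (psi n v) = psi n v" using u(2) nG vV by (simp add: psi_comp)
  qed
  ultimately have "psi n v [^]\<^bsub>V\<^esub> card S \<in> comm_fixed x" by simp
  then show ?thesis
    by (rule V_root[OF U.subgroup_axioms psi_closed[OF nG vV] _ sub_coprime[OF sS subset_trans[OF SZ Z_T]]])
qed

lemma comm_fixed_invariant:
  assumes x: "nontriv x" and g: "g \<in> carrier G" and v: "v \<in> comm_fixed x"
  shows "psi g v \<in> comm_fixed x"
proof -
  let ?D = "{g \<in> carrier G. \<forall>v\<in>comm_fixed x. psi g v \<in> comm_fixed x}"
  have sD: "subgroup ?D G"
  proof (rule G.subgroup_finI[OF finG])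
    show "?D \<noteq> {}" using comm_fixed_closed by (auto intro!: exI[of _ \<one>])
    fix a b assume ab: "a \<in> ?D" "b \<in> ?D"
    then have "psi (a \<otimes> b) u \<in> comm_fixed x" if "u \<in> comm_fixed x" for u
      using that comm_fixed_closed[OF that] by (simp add: psi_comp)
    then show "a \<otimes> b \<in> ?D" using ab by simp
  qed blast
  have "carrier G \<subseteq> ?D"
  proof (rule generated_by_fixed_points[OF A_invariant_carrier _ sD])
    show "\<not> r dvd card (carrier G)" using r_not_dvd by (simp add: order_def)
    show "fixed_pts w \<inter> carrier G \<subseteq> ?D" if "nontriv w" for w
      using comm_fixed_fixed_pts_invariant[OF x that] unfolding fixed_pts_def by blast
  qed
  with g v show ?thesis by blast
qed

text \<open>The kernel of \<open>T\<close> on [C_V([Z,x]), Z]. With \<open>comm_fixed x\<close>,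
  which is invariant under \<open>G\<close>, the kernel is normal; with [V, C_Z(x)] in its place
  that would not be visible.\<close>

definition layer_kernel :: "'b \<Rightarrow> 'a set" where
  "layer_kernel x = {t \<in> T. \<forall>z\<in>Z. \<forall>u\<in>comm_fixed x. psi t (displ z u) = displ z u}"

lemma layer_kernel_subgroup: "subgroup (layer_kernel x) G"
proof (rule G.subgroup_finI[OF finG])
  show "layer_kernel x \<noteq> {}" unfolding layer_kernel_def using comm_fixed_closed by (auto intro!: exI[of _ \<one>])
qed (auto simp: layer_kernel_def psi_comp comm_fixed_closed)

lemma layer_kernel_A_invariant: assumes x: "x \<in> carrier A" shows "A_invariant (layer_kernel x)"
  unfolding A_invariant_def
proof (intro conjI ballI layer_kernel_subgroup)
  fix a t assume a: "a \<in> carrier A" and t: "t \<in> layer_kernel x"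
  have "psi (phi a t) (displ z u) = displ z u" if z: "z \<in> Z" and u: "u \<in> comm_fixed x" for z u
  proof -
    have uV: "u \<in> carrier V" by (rule comm_fixed_closed[OF u])
    define z' where "z' = phi (inv\<^bsub>A\<^esub> a) z"
    define u' where "u' = theta (inv\<^bsub>A\<^esub> a) u"
    have z': "z' \<in> Z" "phi a z' = z" and u'V: "u' \<in> carrier V" "theta a u' = u"
      using a z uV phi_Z unfolding z'_def u'_def by auto
    have "psi (phi x s) u' = psi s u'" if s: "s \<in> Z" for s
    proof -
      have sa: "phi a s \<in> Z" by (rule phi_Z[OF a s])
      have "phi a (phi x s) = phi x (phi a s)"
        using phi_comp[of a x s] phi_comp[of x a s] m_comm[of a x] a x s by simp
      then have "theta a (psi (phi x s) u') = psi (phi x (phi a s)) u"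
        using compat[of a "phi x s" u'] a x s u'V by simp
      also have "\<dots> = psi (phi a s) u" using u sa unfolding comm_fixed_def by blast
      also have "\<dots> = theta a (psi s u')" using compat[of a s u'] a s u'V by simp
      finally have "theta (inv\<^bsub>A\<^esub> a) (theta a (psi (phi x s) u')) = theta (inv\<^bsub>A\<^esub> a) (theta a (psi s u'))" by simp
      then show ?thesis using a x s u'V by simp
    qed
    then have "u' \<in> comm_fixed x" unfolding comm_fixed_def using u'V by blast
    then have "psi t (displ z' u') = displ z' u'" using t z' unfolding layer_kernel_def by blast
    then have "theta a (psi t (displ z' u')) = theta a (displ z' u')" by simp
    moreover have "t \<in> carrier G" using t unfolding layer_kernel_def by simp
    ultimately show ?thesis using a z' u'V Z.mem_carrier by (simp add: compat theta_displ)
  qed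
  then show "phi a t \<in> layer_kernel x" unfolding layer_kernel_def using phi_T[OF a] t unfolding layer_kernel_def by blast
qed

lemma layer_kernel_normal:
  assumes x: "nontriv x" and g: "g \<in> carrier G" and k: "k \<in> layer_kernel x"
  shows "g \<otimes> k \<otimes> inv g \<in> layer_kernel x"
proof -
  have kT: "k \<in> T" using k unfolding layer_kernel_def by blast
  have "psi (g \<otimes> k \<otimes> inv g) (displ z u) = displ z u" if z: "z \<in> Z" and u: "u \<in> comm_fixed x" for z u
  proof -
    have uV: "u \<in> carrier V" by (rule comm_fixed_closed[OF u])
    have "psi (inv g) (displ z u) = displ (inv g \<otimes> z \<otimes> g) (psi (inv g) u)"
      using psi_displ_conj[of "inv g" z u] g z uV by simp
    moreover have "psi k (displ (inv g \<otimes> z \<otimes> g) (psi (inv g) u)) = displ (inv g \<otimes> z \<otimes> g) (psi (inv g) u)"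
      using k Z_normal'[OF g z] comm_fixed_invariant[OF x _ u, of "inv g"] g unfolding layer_kernel_def by blast
    ultimately have "psi k (psi (inv g) (displ z u)) = psi (inv g) (displ z u)" by simp
    then show ?thesis using g kT z uV by (simp add: psi_comp)
  qed
  then show ?thesis unfolding layer_kernel_def using T_normal[OF g kT] by blast
qed

text \<open>By \<open>trivial_modulo\<close> it is enough that a fixed point of \<open>y\<close>
  outside \<open>cyc x\<close> acts trivially on every \<open>displ z u\<close> with
  \<open>u\<close> in \<open>comm_fixed x\<close>. By goodness there are two kinds of
  \<open>z\<close>: elements of [Z,x] do not move \<open>u\<close> at all, and for fixed points of
  \<open>x\<close> this is \<open>fixed_points_annihilate\<close>.\<close>

lemma comm_layer_kernel:
  assumes x: "nontriv x" and t: "t \<in> T"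
  shows "inv t \<otimes> phi x t \<in> layer_kernel x"
proof (rule trivial_modulo[OF T_A_invariant T_r layer_kernel_A_invariant _ _ x _ t])
  show "x \<in> carrier A" using x by simp
  show "layer_kernel x \<subseteq> T" unfolding layer_kernel_def by blast
  show "inv h \<otimes> k \<otimes> h \<in> layer_kernel x" if "h \<in> T" "k \<in> layer_kernel x" for h k
    using layer_kernel_normal[OF x _ that(2), of "inv h"] that(1) by simp
  show "fixed_pts y \<inter> T \<subseteq> layer_kernel x" if y: "nontriv y" "y \<notin> cyc x" for y
  proof
    fix s assume s: "s \<in> fixed_pts y \<inter> T"
    let ?D = "{z \<in> Z. \<forall>u\<in>comm_fixed x. psi s (displ z u) = displ z u}"
    have "Z \<subseteq> ?D"
    proof (rule good_gen[OF _ Z.subgroup_axioms])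
      show xA: "x \<in> carrier A" using x by simp
      show "phi x z \<in> Z" if "z \<in> Z" for z using phi_Z[OF xA that] .
      show "subgroup ?D G"
      proof (rule G.subgroup_finI[OF finG])
        have "displ \<one> u = \<one>\<^bsub>V\<^esub>" if "u \<in> comm_fixed x" for u using displ_one_iff[of \<one> u] comm_fixed_closed[OF that] by simp
        then show "?D \<noteq> {}" using s by (auto intro!: exI[of _ \<one>])
        fix a b assume ab: "a \<in> ?D" "b \<in> ?D"
        have "psi s (displ (a \<otimes> b) u) = displ (a \<otimes> b) u" if u: "u \<in> comm_fixed x" for u
          using ab s comm_fixed_closed[OF u] comm_fixed_closed[OF comm_fixed_psi_Z[OF xA u]] comm_fixed_psi_Z[OF xA u, of b] u
          by (simp add: displ_mult psi_mult)
        then show "a \<otimes> b \<in> ?D" using ab by blast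
      qed (use Z.subset in blast)
      fix z assume z: "z \<in> Z"
      have zx: "inv z \<otimes> phi x z \<in> Z" using z phi_Z[OF xA z] by simp
      have "psi s (displ (inv z \<otimes> phi x z) u) = displ (inv z \<otimes> phi x z) u" if u: "u \<in> comm_fixed x" for u
      proof -
        have "displ (inv z \<otimes> phi x z) u = \<one>\<^bsub>V\<^esub>"
          using comm_fixed_comm[OF xA u z] displ_one_iff[of "inv z \<otimes> phi x z" u] comm_fixed_closed[OF u] zx Z.mem_carrier by blast
        then show ?thesis using s by simp
      qed
      then show "inv z \<otimes> phi x z \<in> ?D" using zx by blast
      assume zf: "phi x z = z"
      have "psi s (displ z u) = displ z u" if u: "u \<in> comm_fixed x" for u
      proof -
        have uV: "u \<in> carrier V" by (rule comm_fixed_closed[OF u])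
        have "displ z (displ s u) = \<one>\<^bsub>V\<^esub>"
          by (rule fixed_points_annihilate[OF x y z zf _ _ uV]) (use s in \<open>auto simp: fixed_pts_def\<close>)
        then have "displ s (displ z u) = \<one>\<^bsub>V\<^esub>" using displ_commute[of z s u] s z uV by simp
        then show ?thesis using displ_one_iff[of s "displ z u"] s z uV by simp
      qed
      then show "z \<in> ?D" using z by blast
    qed
    then show "s \<in> layer_kernel x" unfolding layer_kernel_def using s by blast
  qed
qed

text \<open>Since \<open>x\<close> acts trivially on \<open>T\<close> modulo the kernel,
  \<open>n\<close> and \<open>phi x n\<close> induce the same automorphism of that quotient, so the
  displacement of \<open>n\<close> acts trivially on it. The elements with this property form the
  subgroup \<open>?D\<close>.\<close>

lemma comm_with_layer_kernel:
  assumes x: "nontriv x" and j: "j \<in> comm_with x" and t: "t \<in> T"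
  shows "j \<otimes> t \<otimes> inv j \<otimes> inv t \<in> layer_kernel x"
proof -
  interpret K: subgroup "layer_kernel x" G by (rule layer_kernel_subgroup)
  let ?D = "{m \<in> carrier G. \<forall>t\<in>T. m \<otimes> t \<otimes> inv m \<otimes> inv t \<in> layer_kernel x}"
  have sD: "subgroup ?D G"
  proof (rule G.subgroup_finI[OF finG])
    show "?D \<noteq> {}" by (auto intro!: exI[of _ \<one>])
    fix a b assume ab: "a \<in> ?D" "b \<in> ?D"
    have "(a \<otimes> b) \<otimes> t \<otimes> inv (a \<otimes> b) \<otimes> inv t \<in> layer_kernel x" if t: "t \<in> T" for t
    proof -
      have "b \<otimes> t \<otimes> inv b \<in> T" using T_normal ab t by blast
      then have 1: "a \<otimes> (b \<otimes> t \<otimes> inv b) \<otimes> inv a \<otimes> inv (b \<otimes> t \<otimes> inv b) \<in> layer_kernel x" using ab by blast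
      have 2: "b \<otimes> t \<otimes> inv b \<otimes> inv t \<in> layer_kernel x" using ab t by blast
      have "(a \<otimes> (b \<otimes> t \<otimes> inv b) \<otimes> inv a \<otimes> inv (b \<otimes> t \<otimes> inv b)) \<otimes> (b \<otimes> t \<otimes> inv b \<otimes> inv t) \<in> layer_kernel x"
        by (rule K.m_closed[OF 1 2])
      then show ?thesis using ab t by (simp add: G.m_assoc G.inv_mult_group)
    qed
    then show "a \<otimes> b \<in> ?D" using ab by simp
  qed blast
  have "inv n \<otimes> phi x n \<in> ?D" if n: "n \<in> carrier G" for n
  proof -
    have "(inv n \<otimes> phi x n) \<otimes> t \<otimes> inv (inv n \<otimes> phi x n) \<otimes> inv t \<in> layer_kernel x" if t: "t \<in> T" for t
    proof -
      have tG: "t \<in> carrier G" using t by simp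
      define s where "s = n \<otimes> t \<otimes> inv n"
      have sT: "s \<in> T" unfolding s_def by (rule T_normal[OF n t])
      define k1 where "k1 = inv t \<otimes> phi x t"
      define k2 where "k2 = inv s \<otimes> phi x s"
      have k: "k1 \<in> layer_kernel x" "k2 \<in> layer_kernel x" unfolding k1_def k2_def using comm_layer_kernel[OF x] t sT by auto
      have kG: "k1 \<in> carrier G" "k2 \<in> carrier G" using k K.mem_carrier by blast+
      let ?p = "phi x n"
      have pG: "?p \<in> carrier G" using x n by simp
      \<comment> \<open>Applying \<open>x\<close> to the definition of \<open>s\<close> compares
        conjugation by \<open>n\<close> with conjugation by \<open>phi x n\<close>, up to the kernel
        elements \<open>k1\<close> and \<open>k2\<close>.\<close>
      have "s \<otimes> k2 = phi x s" unfolding k2_def using sT x by simp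
      also have "\<dots> = ?p \<otimes> (t \<otimes> k1) \<otimes> inv ?p"
        unfolding s_def k1_def using n tG x by (simp add: phi_mult phi_inv)
      finally have eq: "?p \<otimes> t \<otimes> inv ?p = s \<otimes> k2 \<otimes> (?p \<otimes> inv k1 \<otimes> inv ?p)"
        using pG tG kG by (simp add: G.m_assoc G.inv_mult_group)
      have "(inv n \<otimes> ?p) \<otimes> t \<otimes> inv (inv n \<otimes> ?p) \<otimes> inv t = inv n \<otimes> (?p \<otimes> t \<otimes> inv ?p) \<otimes> n \<otimes> inv t"
        using pG tG n by (simp add: G.m_assoc G.inv_mult_group)
      also have "\<dots> = inv n \<otimes> (s \<otimes> k2 \<otimes> (?p \<otimes> inv k1 \<otimes> inv ?p)) \<otimes> n \<otimes> inv t"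
        unfolding eq ..
      also have "\<dots> = t \<otimes> (inv n \<otimes> (k2 \<otimes> (?p \<otimes> inv k1 \<otimes> inv ?p)) \<otimes> n) \<otimes> inv t"
        unfolding s_def using pG tG n kG by (simp add: G.m_assoc)
      also have "\<dots> \<in> layer_kernel x"
      proof (rule layer_kernel_normal[OF x tG])
        have "k2 \<otimes> (?p \<otimes> inv k1 \<otimes> inv ?p) \<in> layer_kernel x"
          by (rule K.m_closed[OF k(2) layer_kernel_normal[OF x pG K.m_inv_closed[OF k(1)]]])
        then show "inv n \<otimes> (k2 \<otimes> (?p \<otimes> inv k1 \<otimes> inv ?p)) \<otimes> n \<in> layer_kernel x"
          using layer_kernel_normal[OF x, of "inv n"] n by simp
      qed
      finally show ?thesis .
    qed
    then show ?thesis using n x by simp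
  qed
  then have "comm_with x \<subseteq> ?D"
    unfolding comm_with_def by (intro G.generate_subgroup_incl[OF _ sD]) blast
  then show ?thesis using j t by blast
qed

text \<open>The spanning lemma is used twice. The commutator lies in every kernel, so the first use
  shows that it fixes all displacements by \<open>Z\<close>; with the induction hypothesis on
  \<open>fixed_Z\<close> the second use covers \<open>V\<close>.\<close>

lemma layer_step:
  assumes j: "\<And>x. nontriv x \<Longrightarrow> j \<in> comm_with x" and t: "t \<in> T"
    and IH: "\<And>v. v \<in> fixed_Z \<Longrightarrow> psi (j \<otimes> t \<otimes> inv j \<otimes> inv t) v = v"
    and v: "v \<in> carrier V"
  shows "psi (j \<otimes> t \<otimes> inv j \<otimes> inv t) v = v"
proof -
  define u where "u = j \<otimes> t \<otimes> inv j \<otimes> inv t"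
  have uK: "u \<in> layer_kernel x" if "nontriv x" for x
    unfolding u_def using comm_with_layer_kernel[OF that j[OF that] t] .
  obtain x where x: "nontriv x" using ex_nontrivial by blast
  have uG: "u \<in> carrier G" by (rule subgroup.mem_carrier[OF layer_kernel_subgroup uK[OF x]])
  let ?W = "{v \<in> carrier V. \<forall>z\<in>Z. psi u (displ z v) = displ z v}"
  have sW: "subgroup ?W V"
  proof (rule V.subgroup_finI[OF finV])
    have "displ z \<one>\<^bsub>V\<^esub> = \<one>\<^bsub>V\<^esub>" if "z \<in> Z" for z using that displ_one_iff[of z "\<one>\<^bsub>V\<^esub>"] by simp
    then show "?W \<noteq> {}" using uG by (auto intro!: exI[of _ "\<one>\<^bsub>V\<^esub>"])
  qed (use uG in \<open>auto simp: displ_V_mult psi_mult\<close>)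
  have "?W = carrier V"
  proof (rule span_V[OF sW])
    show "fixed_Z \<subseteq> ?W"
    proof
      fix v assume v: "v \<in> fixed_Z"
      then have "displ z v = \<one>\<^bsub>V\<^esub>" if "z \<in> Z" for z
        using that displ_one_iff[of z v] unfolding fixed_Z_def by simp
      then show "v \<in> ?W" using v uG unfolding fixed_Z_def by simp
    qed
    fix x z v assume x: "nontriv x" and z: "z \<in> Z" "phi x z = z" and v: "v \<in> carrier V"
    then have "displ z v \<in> comm_fixed x" by (intro displ_comm_fixed) auto
    then show "displ z v \<in> ?W" using uK[OF x] comm_fixed_closed unfolding layer_kernel_def by blast
  qed
  then have W: "psi u (displ z v) = displ z v" if "z \<in> Z" "v \<in> carrier V" for z v using that by blast
  have "{v \<in> carrier V. \<forall>g\<in>{u}. psi g v = v} = carrier V"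
  proof (rule span_V)
    show "subgroup {v \<in> carrier V. \<forall>g\<in>{u}. psi g v = v} V" by (rule fixed_V_subgroup) (use uG in blast)
    show "fixed_Z \<subseteq> {v \<in> carrier V. \<forall>g\<in>{u}. psi g v = v}" using IH unfolding fixed_Z_def u_def by blast
  qed (use W in auto)
  then show ?thesis using v unfolding u_def by blast
qed

text \<open>\<open>Z\<close> is normal and invariant under \<open>A\<close>, so both actions
  preserve its fixed points; this is the smaller module of the induction.\<close>

lemma fixed_Z_module:
  "rank_two_module G A phi r (V\<lparr>carrier := fixed_Z\<rparr>) psi theta"
proof -
  interpret C: subgroup fixed_Z V by (rule fixed_Z_subgroup)
  have psiC: "psi g v \<in> fixed_Z" if g: "g \<in> carrier G" and v: "v \<in> fixed_Z" for g v
  proof -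
    have vV: "v \<in> carrier V" using v by simp
    have "psi z (psi g v) = psi g v" if z: "z \<in> Z" for z
    proof -
      have "psi z (psi g v) = psi g (psi (inv g \<otimes> z \<otimes> g) v)" using z g vV by (simp add: psi_comp)
      also have "psi (inv g \<otimes> z \<otimes> g) v = v" using v Z_normal'[OF g z] unfolding fixed_Z_def by blast
      finally show ?thesis .
    qed
    then show ?thesis unfolding fixed_Z_def using g vV by simp
  qed
  have thetaC: "theta a v \<in> fixed_Z" if a: "a \<in> carrier A" and v: "v \<in> fixed_Z" for a v
  proof -
    have vV: "v \<in> carrier V" using v by simp
    have "psi z (theta a v) = theta a v" if z: "z \<in> Z" for z
    proof -
      have z': "phi (inv\<^bsub>A\<^esub> a) z \<in> Z" using phi_Z a z by simp
      have "psi z (theta a v) = theta a (psi (phi (inv\<^bsub>A\<^esub> a) z) v)" using compat[of a "phi (inv\<^bsub>A\<^esub> a) z" v] z a vV by simp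
      also have "psi (phi (inv\<^bsub>A\<^esub> a) z) v = v" using v z' unfolding fixed_Z_def by blast
      finally show ?thesis .
    qed
    then show ?thesis unfolding fixed_Z_def using a vV by simp
  qed
  have psi_act': "aut_action G (V\<lparr>carrier := fixed_Z\<rparr>) psi"
    unfolding aut_action_def iso_def
  proof (intro conjI ballI)
    fix g assume g: "g \<in> carrier G"
    have "bij_betw (psi g) fixed_Z fixed_Z"
      by (rule bij_betw_byWitness[where f' = "psi (inv g)"]) (use g psiC in auto)
    then show "psi g \<in> {h \<in> hom (V\<lparr>carrier := fixed_Z\<rparr>) (V\<lparr>carrier := fixed_Z\<rparr>). bij_betw h (carrier (V\<lparr>carrier := fixed_Z\<rparr>)) (carrier (V\<lparr>carrier := fixed_Z\<rparr>))}"
      using g psiC by (auto simp: hom_def psi_mult)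
  qed (auto simp: psi_comp)
  have theta_act': "aut_action A (V\<lparr>carrier := fixed_Z\<rparr>) theta"
    unfolding aut_action_def iso_def
  proof (intro conjI ballI)
    fix a assume a: "a \<in> carrier A"
    have "bij_betw (theta a) fixed_Z fixed_Z"
      by (rule bij_betw_byWitness[where f' = "theta (inv\<^bsub>A\<^esub> a)"]) (use a thetaC in auto)
    then show "theta a \<in> {h \<in> hom (V\<lparr>carrier := fixed_Z\<rparr>) (V\<lparr>carrier := fixed_Z\<rparr>). bij_betw h (carrier (V\<lparr>carrier := fixed_Z\<rparr>)) (carrier (V\<lparr>carrier := fixed_Z\<rparr>))}"
      using a thetaC by (auto simp: hom_def theta_mult)
  qed (auto simp: theta_comp)
  have "card fixed_Z dvd order V" using V.subgroup_dvd[OF finV V.subgroup_self fixed_Z_subgroup C.subset] by (simp add: order_def)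
  then have "coprime r (card fixed_Z)" using coprime_r by (metis coprime_divisors dvd_refl)
  moreover have "comm_group (V\<lparr>carrier := fixed_Z\<rparr>)" 
    by (rule group.group_comm_groupI[OF C.subgroup_is_group[OF V.is_group]]) (auto intro: V.m_comm)
  moreover have "finite fixed_Z" using V.subgroup_pos_card[OF finV fixed_Z_subgroup] by simp
  ultimately show ?thesis
    unfolding rank_two_module_def rank_two_module_axioms_def
    using rank_two_action_axioms r_not_dvd psi_act' theta_act' compat C.mem_carrier by (simp add: order_def)
qed

end

section \<open>Choice of Z and induction on the order of the module\<close>

context rank_two_action
begin

text \<open>For minimal \<open>Z\<close> the subgroup [Z,T] is again normal and invariant, and it is
  proper because \<open>T\<close> is a \<open>q\<close>-group. By minimality it acts trivially,
  which is exactly that \<open>Z\<close> and \<open>T\<close> commute on \<open>V\<close>.\<close>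

lemma minimal_nontrivial_layer:
  assumes M: "rank_two_module G A phi r V psi theta"
    and T: "A_invariant T" "\<And>g t. g \<in> carrier G \<Longrightarrow> t \<in> T \<Longrightarrow> g \<otimes> t \<otimes> inv g \<in> T"
    and q: "Factorial_Ring.prime q" "card T = q ^ k" "coprime q (order V)"
    and centralizer_of: "\<And>x t v. nontriv x \<Longrightarrow> t \<in> T \<Longrightarrow> phi x t = t \<Longrightarrow> v \<in> carrier V \<Longrightarrow> theta x v = v \<Longrightarrow> psi t v = v"
    and nontriv: "t0 \<in> T" "v0 \<in> carrier V" "psi t0 v0 \<noteq> v0"
  shows "\<exists>Z. rank_two_layer G A phi r V psi theta T Z \<and> (\<exists>z\<in>Z. \<exists>v\<in>carrier V. psi z v \<noteq> v)"
proof -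
  interpret M: rank_two_module G A phi r V psi theta by fact
  interpret T: subgroup T G by (rule A_invariantD(1)[OF T(1)])
  define nl where "nl Z \<longleftrightarrow> A_invariant Z \<and> (\<forall>g\<in>carrier G. \<forall>z\<in>Z. g \<otimes> z \<otimes> inv g \<in> Z) \<and> Z \<subseteq> T" for Z
  define nt where "nt Z \<longleftrightarrow> (\<exists>z\<in>Z. \<exists>v\<in>carrier V. psi z v \<noteq> v)" for Z
  have "finite {Z. nl Z \<and> nt Z}"
    by (rule finite_subset[of _ "Pow T"])
      (use G.subgroup_pos_card[OF finG T.subgroup_axioms] in \<open>auto simp: nl_def\<close>)
  moreover have "T \<in> {Z. nl Z \<and> nt Z}" using T nontriv unfolding nl_def nt_def by blast
  ultimately obtain Z where Z: "nl Z" "nt Z" and min: "\<And>Y. nl Y \<Longrightarrow> nt Y \<Longrightarrow> Y \<subseteq> Z \<Longrightarrow> Y = Z"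
    using finite_has_minimal[of "{Z. nl Z \<and> nt Z}"] by blast
  have AZ: "A_invariant Z" and nZ: "\<And>g z. g \<in> carrier G \<Longrightarrow> z \<in> Z \<Longrightarrow> g \<otimes> z \<otimes> inv g \<in> Z" and ZT: "Z \<subseteq> T"
    using Z(1) unfolding nl_def by blast+
  interpret Z: subgroup Z G by (rule A_invariantD(1)[OF AZ])
  let ?C = "G.conj_comm Z T"
  let ?S = "{inv z \<otimes> (t \<otimes> z \<otimes> inv t) |z t. z \<in> Z \<and> t \<in> T}"
  have sSG: "?S \<subseteq> carrier G" by auto
  have "card Z dvd q ^ k" using G.subgroup_dvd[OF finG T.subgroup_axioms Z.subgroup_axioms ZT] q(2) by simp
  then obtain l where l: "card Z = q ^ l" using divides_primepow_nat[OF q(1)] by blast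
  have Zne: "Z \<noteq> {\<one>}" using Z(2) unfolding nt_def by auto
  note pr = G.conj_comm_proper[OF T.subgroup_axioms q(2) Z.subgroup_axioms l q(1) Zne nZ[OF T.mem_carrier]]
  have AC: "A_invariant ?C"
    unfolding G.conj_comm_def
  proof (rule A_invariant_generate[OF sSG])
    fix a s assume a: "a \<in> carrier A" and "s \<in> ?S"
    then obtain z t where zt: "z \<in> Z" "t \<in> T" "s = inv z \<otimes> (t \<otimes> z \<otimes> inv t)" by blast
    then have "phi a s = inv (phi a z) \<otimes> (phi a t \<otimes> phi a z \<otimes> inv (phi a t))"
      using a by (simp add: phi_mult phi_inv)
    then show "phi a s \<in> generate G ?S"
      using A_invariantD(2)[OF AZ a zt(1)] A_invariantD(2)[OF T(1) a zt(2)] by (intro generate.incl) blast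
  qed
  have sC: "subgroup ?C G" by (rule A_invariantD(1)[OF AC])
  have nC: "g \<otimes> c \<otimes> inv g \<in> ?C" if g: "g \<in> carrier G" and c: "c \<in> ?C" for g c
    unfolding G.conj_comm_def
  proof (rule G.generate_conj[OF sSG g _ c[unfolded G.conj_comm_def]])
    fix s assume "s \<in> ?S"
    then obtain z t where zt: "z \<in> Z" "t \<in> T" "s = inv z \<otimes> (t \<otimes> z \<otimes> inv t)" by blast
    let ?z = "g \<otimes> z \<otimes> inv g" and ?t = "g \<otimes> t \<otimes> inv g"
    have "inv ?z \<otimes> (?t \<otimes> ?z \<otimes> inv ?t) \<in> generate G ?S"
      by (rule generate.incl) (use nZ[OF g zt(1)] T(2)[OF g zt(2)] in blast)
    moreover have "inv ?z \<otimes> (?t \<otimes> ?z \<otimes> inv ?t) = g \<otimes> s \<otimes> inv g"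
      using g zt by (simp add: G.m_assoc G.inv_mult_group)
    ultimately show "g \<otimes> s \<otimes> inv g \<in> generate G ?S" by simp
  qed
  have "nl ?C" unfolding nl_def using AC nC pr(2) ZT by blast
  then have "\<not> nt ?C" using min[of ?C] pr by blast
  then have C1: "psi c v = v" if "c \<in> ?C" "v \<in> carrier V" for c v using that unfolding nt_def by blast
  have comm: "psi z (psi t v) = psi t (psi z v)" if z: "z \<in> Z" and t: "t \<in> T" and v: "v \<in> carrier V" for z t v
  proof -
    have c: "inv z \<otimes> (t \<otimes> z \<otimes> inv t) \<in> ?C"
      unfolding G.conj_comm_def by (rule generate.incl) (use z t in blast)
    have "psi (z \<otimes> (inv z \<otimes> (t \<otimes> z \<otimes> inv t)) \<otimes> t) v = psi z (psi (inv z \<otimes> (t \<otimes> z \<otimes> inv t)) (psi t v))"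
      using z t v by (simp add: M.psi_comp)
    also have "\<dots> = psi z (psi t v)" using C1[OF c] t v by simp
    also have "z \<otimes> (inv z \<otimes> (t \<otimes> z \<otimes> inv t)) \<otimes> t = t \<otimes> z" using z t by (simp add: G.m_assoc)
    finally show ?thesis using z t v by (simp add: M.psi_comp)
  qed
  have "coprime (card T) (order V)" using q by simp
  then have "rank_two_layer G A phi r V psi theta T Z"
    unfolding rank_two_layer_def rank_two_layer_axioms_def
    using M T AZ nZ ZT comm centralizer_of by blast
  then show ?thesis using Z(2) unfolding nt_def by blast
qed

text \<open>If \<open>T\<close> acts nontrivially, the chosen \<open>Z\<close> does as well, so its
  fixed points form a proper submodule and \<open>layer_step\<close> lifts the claim from
  there.\<close>

lemma commutator_acts_trivially:
  assumes "rank_two_module G A phi r V psi theta"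
    and T: "A_invariant T" "\<And>g t. g \<in> carrier G \<Longrightarrow> t \<in> T \<Longrightarrow> g \<otimes> t \<otimes> inv g \<in> T"
    and q: "Factorial_Ring.prime q" "card T = q ^ k" and "coprime q (order V)"
    and "\<And>x t v. nontriv x \<Longrightarrow> t \<in> T \<Longrightarrow> phi x t = t \<Longrightarrow> v \<in> carrier V \<Longrightarrow> theta x v = v \<Longrightarrow> psi t v = v"
    and j: "\<And>x. nontriv x \<Longrightarrow> j \<in> comm_with x" and t: "t \<in> T" and "v \<in> carrier V"
  shows "psi (j \<otimes> t \<otimes> inv j \<otimes> inv t) v = v"
  using assms(1,6,7,10)
proof (induction "order V" arbitrary: V v rule: less_induct)
  case less
  note centralizer_of = less.prems(3)
  interpret M: rank_two_module G A phi r V psi theta by (rule less.prems(1))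
  interpret T: subgroup T G by (rule A_invariantD(1)[OF T(1)])
  obtain x where x: "nontriv x" using ex_nontrivial by blast
  have "comm_with x \<subseteq> carrier G"
    unfolding comm_with_def by (rule G.generate_incl) (use x in auto)
  then have "j \<in> carrier G" using j[OF x] by blast
  then have u: "j \<otimes> t \<otimes> inv j \<otimes> inv t \<in> T" using T(2)[OF _ t] t by simp
  show ?case
  proof (cases "\<exists>t\<in>T. \<exists>v\<in>carrier V. psi t v \<noteq> v")
    case False
    then show ?thesis using u less.prems(4) by blast
  next
    case True
    then obtain t0 v0 where tv: "t0 \<in> T" "v0 \<in> carrier V" "psi t0 v0 \<noteq> v0" by blast
    have "\<exists>Z. rank_two_layer G A phi r V psi theta T Z \<and> (\<exists>z\<in>Z. \<exists>v\<in>carrier V. psi z v \<noteq> v)"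
      by (rule minimal_nontrivial_layer[OF less.prems(1) T q less.prems(2) centralizer_of tv])
    then obtain Z where L: "rank_two_layer G A phi r V psi theta T Z" and nt: "\<exists>z\<in>Z. \<exists>v\<in>carrier V. psi z v \<noteq> v"
      by blast
    interpret L: rank_two_layer G A phi r V psi theta T Z by (rule L)
    let ?V = "V\<lparr>carrier := L.fixed_Z\<rparr>"
    have sub: "L.fixed_Z \<subseteq> carrier V" unfolding L.fixed_Z_def by blast
    have "L.fixed_Z \<noteq> carrier V" using nt unfolding L.fixed_Z_def by blast
    then have lt: "order ?V < order V" using sub M.finV unfolding order_def
      by (simp add: psubset_card_mono psubset_eq)
    have "card L.fixed_Z dvd order V"
      using M.V.subgroup_dvd[OF M.finV M.V.subgroup_self L.fixed_Z_subgroup sub] by (simp add: order_def)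
    then have "coprime q (card L.fixed_Z)" using less.prems(2) coprime_divisors dvd_refl by blast
    then have cop: "coprime q (order ?V)" by (simp add: order_def)
    have IH: "psi (j \<otimes> t \<otimes> inv j \<otimes> inv t) w = w" if "w \<in> L.fixed_Z" for w
      by (rule less.hyps[OF lt L.fixed_Z_module cop]) (use centralizer_of sub that in auto)
    show ?thesis by (rule L.layer_step[OF j t IH less.prems(4)])
  qed
qed

end

section \<open>Action of a normalizer on a p-group\<close>

context rank_two_action
begin

lemma derived_conj:
  assumes H: "subgroup H G" and g: "g \<in> carrier G" and inv: "\<And>h. h \<in> H \<Longrightarrow> g \<otimes> h \<otimes> inv g \<in> H"
    and c: "c \<in> derived G H"
  shows "g \<otimes> c \<otimes> inv g \<in> derived G H"
  unfolding derived_def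
proof (rule G.generate_conj[OF _ g _ c[unfolded derived_def]])
  interpret H: subgroup H G by fact
  show "(\<Union>h1\<in>H. \<Union>h2\<in>H. {h1 \<otimes> h2 \<otimes> inv h1 \<otimes> inv h2}) \<subseteq> carrier G" by auto
  fix s assume "s \<in> (\<Union>h1\<in>H. \<Union>h2\<in>H. {h1 \<otimes> h2 \<otimes> inv h1 \<otimes> inv h2})"
  then obtain h1 h2 where h: "h1 \<in> H" "h2 \<in> H" "s = h1 \<otimes> h2 \<otimes> inv h1 \<otimes> inv h2" by blast
  let ?a = "g \<otimes> h1 \<otimes> inv g" and ?b = "g \<otimes> h2 \<otimes> inv g"
  have "g \<otimes> s \<otimes> inv g = ?a \<otimes> ?b \<otimes> inv ?a \<otimes> inv ?b"
    using g h by (simp add: G.m_assoc G.inv_mult_group)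
  then show "g \<otimes> s \<otimes> inv g \<in> generate G (\<Union>h1\<in>H. \<Union>h2\<in>H. {h1 \<otimes> h2 \<otimes> inv h1 \<otimes> inv h2})"
    using inv h by (intro generate.incl) blast
qed

lemma conj_set_coset:
  assumes D: "subgroup D G" and n: "n \<in> carrier G" and inv: "\<And>d. d \<in> D \<Longrightarrow> n \<otimes> d \<otimes> inv n \<in> D" and h: "h \<in> carrier G"
  shows "G.conj_set n (D #> h) = D #> (n \<otimes> h \<otimes> inv n)"
proof -
  interpret D: subgroup D G by fact
  have "G.conj_set n D = D"
    by (rule G.conj_set_eqI[OF _ n D.subset])
      (use inv G.subgroup_pos_card[OF finG D] in \<open>auto simp: G.conj_set_def\<close>)
  moreover have "G.conj_set n (D #> h) = G.conj_set n D #> (n \<otimes> h \<otimes> inv n)"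
  proof -
    have "n \<otimes> (d \<otimes> h) \<otimes> inv n = (n \<otimes> d \<otimes> inv n) \<otimes> (n \<otimes> h \<otimes> inv n)" if "d \<in> D" for d
      using that n h by (simp add: G.m_assoc)
    then have "(\<lambda>d. n \<otimes> (d \<otimes> h) \<otimes> inv n) ` D = (\<lambda>d. (n \<otimes> d \<otimes> inv n) \<otimes> (n \<otimes> h \<otimes> inv n)) ` D"
      by (rule image_cong[OF refl])
    moreover have "G.conj_set n (D #> h) = (\<lambda>d. n \<otimes> (d \<otimes> h) \<otimes> inv n) ` D"
      unfolding G.conj_set_def r_coset_def by blast
    moreover have "G.conj_set n D #> (n \<otimes> h \<otimes> inv n) = (\<lambda>d. (n \<otimes> d \<otimes> inv n) \<otimes> (n \<otimes> h \<otimes> inv n)) ` D"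
      unfolding G.conj_set_def r_coset_def by blast
    ultimately show ?thesis by simp
  qed
  ultimately show ?thesis by simp
qed

lemma abelian_section_module:
  assumes N: "A_invariant N" and rN: "\<not> r dvd card N" and H: "A_invariant H"
    and NH: "\<And>n h. n \<in> N \<Longrightarrow> h \<in> H \<Longrightarrow> n \<otimes> h \<otimes> inv n \<in> H"
    and p: "Factorial_Ring.prime p" "p \<noteq> r" "card H = p ^ m"
  shows "rank_two_module (G\<lparr>carrier := N\<rparr>) A phi r (G\<lparr>carrier := H\<rparr> Mod derived G H)
    (\<lambda>n R. G.conj_set n R) (\<lambda>a R. phi a ` R)"
proof -
  interpret N: subgroup N G by (rule A_invariantD(1)[OF N])
  interpret H: subgroup H G by (rule A_invariantD(1)[OF H])
  let ?N = "G\<lparr>carrier := N\<rparr>" and ?H = "G\<lparr>carrier := H\<rparr>" and ?D = "derived G H"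
  interpret NA: rank_two_action ?N A phi r by (rule restrict_rank_two[OF N])
  interpret HA: rank_two_action ?H A phi r by (rule restrict_rank_two[OF H])
  have nD: "?D \<lhd> ?H" by (rule G.derived_subgroup_is_normal[OF H.subgroup_axioms])
  interpret D: normal ?D ?H by (rule nD)
  have AD: "A_invariant ?D" by (rule A_invariant_derived[OF H])
  have HAD: "HA.A_invariant ?D" unfolding HA.A_invariant_def using D.subgroup_axioms A_invariantD(2)[OF AD] by auto
  have V: "comm_group (?H Mod ?D)" by (rule G.derived_quot_of_subgroup_is_comm_group[OF H.subgroup_axioms])
  have finV: "finite (carrier (?H Mod ?D))"
    using G.subgroup_pos_card[OF finG H.subgroup_axioms] by (simp add: FactGroup_def RCOSETS_def)
  have "order (?H Mod ?D) * card ?D = p ^ m"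
    using HA.G.lagrange[OF D.subgroup_axioms] p(3) by (simp add: order_def FactGroup_def)
  then have "order (?H Mod ?D) dvd p ^ m" by (metis dvd_triv_left)
  moreover have "coprime r (p ^ m)" using primes_coprime[OF prime_r p(1)] p(2) by simp
  ultimately have cop: "coprime r (order (?H Mod ?D))" by (metis coprime_divisors dvd_refl)
  have theta: "aut_action A (?H Mod ?D) (\<lambda>a R. phi a ` R)" by (rule HA.quotient_aut_action[OF nD HAD])
  have carr: "R \<in> carrier (?H Mod ?D) \<longleftrightarrow> (\<exists>h\<in>H. R = ?D #> h)" for R
    by (auto simp: carrier_FactGroup)
  have cos: "G.conj_set n (?D #> h) = ?D #> (n \<otimes> h \<otimes> inv n)" if "n \<in> N" "h \<in> H" for n h
    using conj_set_coset[OF A_invariantD(1)[OF AD], of n h] derived_conj[OF H.subgroup_axioms, of n] NH that by auto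
  have sub: "R \<subseteq> carrier G" if "R \<in> carrier (?H Mod ?D)" for R
  proof -
    from carr[THEN iffD1, OF that] obtain h where "h \<in> H" "R = ?D #> h" ..
    then show ?thesis using G.r_coset_subset_G[OF subgroup.subset[OF A_invariantD(1)[OF AD]], of h] by simp
  qed
  have cl: "G.conj_set n R \<in> carrier (?H Mod ?D)" if "n \<in> N" "R \<in> carrier (?H Mod ?D)" for n R
  proof -
    from carr[THEN iffD1, OF that(2)] obtain h where h: "h \<in> H" "R = ?D #> h" ..
    have "G.conj_set n R = ?D #> (n \<otimes> h \<otimes> inv n)" using cos[OF that(1) h(1)] h(2) by simp
    then show ?thesis using carr[THEN iffD2] NH[OF that(1) h(1)] by blast
  qed
  have psi: "aut_action ?N (?H Mod ?D) (\<lambda>n R. G.conj_set n R)"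
    unfolding aut_action_def iso_def
  proof (intro conjI ballI)
    fix n assume n: "n \<in> carrier ?N"
    have "bij_betw (G.conj_set n) (carrier (?H Mod ?D)) (carrier (?H Mod ?D))"
      by (rule bij_betw_byWitness[where f' = "G.conj_set (inv n)"])
        (use n cl sub in \<open>auto simp: G.conj_set_conj_set G.conj_set_one\<close>)
    moreover have "G.conj_set n \<in> hom (?H Mod ?D) (?H Mod ?D)"
    proof (rule homI)
      fix R S assume "R \<in> carrier (?H Mod ?D)" "S \<in> carrier (?H Mod ?D)"
      then obtain a b where ab: "a \<in> H" "b \<in> H" "R = ?D #> a" "S = ?D #> b" by (auto simp: carr)
      have "(?D #> a) <#> (?D #> b) = ?D #> (a \<otimes> b)" if "a \<in> H" "b \<in> H" for a b
        using D.rcos_sum[of a b] that by simp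
      moreover have "n \<otimes> (a \<otimes> b) \<otimes> inv n = (n \<otimes> a \<otimes> inv n) \<otimes> (n \<otimes> b \<otimes> inv n)"
        using ab n by (simp add: G.m_assoc)
      ultimately show "G.conj_set n (R \<otimes>\<^bsub>?H Mod ?D\<^esub> S) = G.conj_set n R \<otimes>\<^bsub>?H Mod ?D\<^esub> G.conj_set n S"
        using ab n NH by (simp add: cos)
    qed (use n cl in auto)
    ultimately show "G.conj_set n \<in> {h \<in> hom (?H Mod ?D) (?H Mod ?D). bij_betw h (carrier (?H Mod ?D)) (carrier (?H Mod ?D))}"
      by blast
  next
    fix R assume "R \<in> carrier (?H Mod ?D)"
    then show "G.conj_set \<one>\<^bsub>?N\<^esub> R = R" using G.conj_set_one[OF sub] by simp
    fix a b assume "a \<in> carrier ?N" "b \<in> carrier ?N"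
    then show "G.conj_set (a \<otimes>\<^bsub>?N\<^esub> b) R = G.conj_set a (G.conj_set b R)"
      using G.conj_set_conj_set[OF _ _ sub] \<open>R \<in> _\<close> by simp
  qed
  have compat: "phi a ` G.conj_set n R = G.conj_set (phi a n) (phi a ` R)"
    if "a \<in> carrier A" "n \<in> N" "R \<in> carrier (?H Mod ?D)" for a n R
    using phi_conj_set[OF that(1) _ sub[OF that(3)]] that(2) by simp
  show ?thesis
    unfolding rank_two_module_def rank_two_module_axioms_def
    using NA.rank_two_action_axioms V finV rN cop psi theta compat by (simp add: order_def)
qed

text \<open>Coprime action: triviality on \<open>H\<close> is detected on \<open>derived G H\<close> and on the abelian quotient.\<close>

lemma commutator_centralizes:
  assumes N: "A_invariant N" and rN: "\<not> r dvd card N"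
    and T: "A_invariant T" "T \<subseteq> N" "\<And>n t. n \<in> N \<Longrightarrow> t \<in> T \<Longrightarrow> n \<otimes> t \<otimes> inv n \<in> T"
    and q: "Factorial_Ring.prime q" "card T = q ^ k" "q \<noteq> p"
    and p: "Factorial_Ring.prime p" "p \<noteq> r"
    and centralizer_of: "\<And>x t h. nontriv x \<Longrightarrow> t \<in> T \<Longrightarrow> phi x t = t \<Longrightarrow> h \<in> P \<Longrightarrow> phi x h = h \<Longrightarrow> t \<otimes> h = h \<otimes> t"
    and j: "\<And>x. nontriv x \<Longrightarrow> j \<in> finite_good_action.comm_with (G\<lparr>carrier := N\<rparr>) phi x" and t: "t \<in> T"
    and H: "A_invariant H" "card H = p ^ m" "\<And>n h. n \<in> N \<Longrightarrow> h \<in> H \<Longrightarrow> n \<otimes> h \<otimes> inv n \<in> H" "H \<subseteq> P" and h: "h \<in> H"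
  shows "(j \<otimes> t \<otimes> inv j \<otimes> inv t) \<otimes> h = h \<otimes> (j \<otimes> t \<otimes> inv j \<otimes> inv t)"
  using H h
proof (induction "card H" arbitrary: H m h rule: less_induct)
  case less
  note H = less.prems(1) and NH = less.prems(3)
  interpret N: subgroup N G by (rule A_invariantD(1)[OF N])
  interpret H: subgroup H G by (rule A_invariantD(1)[OF H])
  interpret T: subgroup T G by (rule A_invariantD(1)[OF T(1)])
  let ?N = "G\<lparr>carrier := N\<rparr>" and ?H = "G\<lparr>carrier := H\<rparr>" and ?D = "derived G H"
  interpret NA: rank_two_action ?N A phi r by (rule restrict_rank_two[OF N])
  interpret HA: rank_two_action ?H A phi r by (rule restrict_rank_two[OF H])
  obtain x where x: "nontriv x" using ex_nontrivial by blast
  have "NA.comm_with x \<subseteq> carrier ?N"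
    unfolding NA.comm_with_def by (rule NA.G.generate_incl) (use x NA.phi_closed NA.G.m_closed NA.G.inv_closed in blast)
  then have "NA.comm_with x \<subseteq> N" by simp
  then have jN: "j \<in> N" using j[OF x] by blast
  define u where "u = j \<otimes> t \<otimes> inv j \<otimes> inv t"
  have uT: "u \<in> T" unfolding u_def using T(3)[OF jN t] t by simp
  have uG: "u \<in> carrier G" and uN: "u \<in> N" using uT T(2) by auto
  show ?case
  proof (cases "H = {\<one>}")
    case True
    then show ?thesis using less.prems(5) uG unfolding u_def by simp
  next
    case False
    have nD: "?D \<lhd> ?H" by (rule G.derived_subgroup_is_normal[OF H.subgroup_axioms])
    interpret D: normal ?D ?H by (rule nD)
    have AD: "A_invariant ?D" by (rule A_invariant_derived[OF H])
    have sD: "subgroup ?D G" by (rule A_invariantD(1)[OF AD])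
    have HAD: "HA.A_invariant ?D" unfolding HA.A_invariant_def using D.subgroup_axioms A_invariantD(2)[OF AD] by auto
    note DH = G.derived_proper[OF H.subgroup_axioms p(1) less.prems(2) False]
    note finH = G.subgroup_pos_card[OF finG H.subgroup_axioms]
    have "card ?D dvd p ^ m" using G.subgroup_dvd[OF finG H.subgroup_axioms sD DH(2)] less.prems(2) by simp
    then obtain i where i: "card ?D = p ^ i" using divides_primepow_nat[OF p(1)] by blast
    have uD: "u \<otimes> d = d \<otimes> u" if "d \<in> ?D" for d
      unfolding u_def
    proof (rule less.hyps[OF _ AD i _ _ that])
      show "card ?D < card H" using DH finH(2) by (simp add: psubset_card_mono psubset_eq)
      show "n \<otimes> c \<otimes> inv n \<in> ?D" if "n \<in> N" "c \<in> ?D" for n c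
        using derived_conj[OF H.subgroup_axioms _ _ that(2), of n] NH that(1) by auto
      show "?D \<subseteq> P" using DH(2) less.prems(4) by blast
    qed
    have M: "rank_two_module ?N A phi r (?H Mod ?D) (\<lambda>n R. G.conj_set n R) (\<lambda>a R. phi a ` R)"
      by (rule abelian_section_module[OF N rN H NH p less.prems(2)])
    have "order (?H Mod ?D) * card ?D = p ^ m"
      using HA.G.lagrange[OF D.subgroup_axioms] less.prems(2) by (simp add: order_def FactGroup_def)
    then have "order (?H Mod ?D) dvd p ^ m" by (metis dvd_triv_left)
    moreover have "coprime q (p ^ m)" using primes_coprime[OF q(1) p(1)] q(3) by simp
    ultimately have cop: "coprime q (order (?H Mod ?D))" by (metis coprime_divisors dvd_refl)
    have NAT: "NA.A_invariant T"
      unfolding NA.A_invariant_def using G.subgroup_incl[OF T.subgroup_axioms N.subgroup_axioms T(2)] A_invariantD(2)[OF T(1)] by auto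
    have cos: "G.conj_set n (?D #> h) = ?D #> (n \<otimes> h \<otimes> inv n)" if "n \<in> N" "h \<in> H" for n h
      using conj_set_coset[OF sD, of n h] derived_conj[OF H.subgroup_axioms, of n] NH that by auto
    have Ninv: "inv\<^bsub>?N\<^esub> n = inv n" if "n \<in> N" for n using G.m_inv_consistent[OF N.subgroup_axioms that] .
    have "G.conj_set (j \<otimes>\<^bsub>?N\<^esub> t \<otimes>\<^bsub>?N\<^esub> inv\<^bsub>?N\<^esub> j \<otimes>\<^bsub>?N\<^esub> inv\<^bsub>?N\<^esub> t) (?D #> h) = ?D #> h"
    proof (rule NA.commutator_acts_trivially[OF M NAT _ q(1,2) cop _ j t])
      show "g \<otimes>\<^bsub>?N\<^esub> t \<otimes>\<^bsub>?N\<^esub> inv\<^bsub>?N\<^esub> g \<in> T" if "g \<in> carrier ?N" "t \<in> T" for g t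
        using T(3) that Ninv by simp
      show "?D #> h \<in> carrier (?H Mod ?D)" using less.prems(5) by (auto simp: carrier_FactGroup)
      fix y s R assume y: "nontriv y" and s: "s \<in> T" "phi y s = s"
        and R: "R \<in> carrier (?H Mod ?D)" "phi y ` R = R"
      then obtain g where g: "g \<in> H" "R = ?D #> g" by (auto simp: carrier_FactGroup)
      have yA: "y \<in> carrier A" and gH: "g \<in> carrier ?H" using y g(1) by simp_all
      have "phi y ` (?D #>\<^bsub>?H\<^esub> g) = ?D #>\<^bsub>?H\<^esub> g" using R(2) g(2) by simp
      from HA.fixed_coset_lift[OF yA nD HAD gH this]
      obtain c where "c \<in> HA.fixed_pts y" "?D #>\<^bsub>?H\<^esub> g = ?D #>\<^bsub>?H\<^esub> c" by blast
      then have c: "c \<in> H" "phi y c = c" and "R = ?D #> c" using g(2) unfolding HA.fixed_pts_def by auto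
      moreover have "s \<otimes> c \<otimes> inv s = c"
      proof -
        have "c \<in> P" using c(1) less.prems(4) by blast
        then have "s \<otimes> c = c \<otimes> s" by (rule centralizer_of[OF y s _ c(2)])
        then show ?thesis using c(1) s(1) by (simp add: G.m_assoc)
      qed
      ultimately show "G.conj_set s R = R" using cos[of s c] s(1) T(2) c(1) by auto
    qed
    moreover have "j \<otimes>\<^bsub>?N\<^esub> t \<otimes>\<^bsub>?N\<^esub> inv\<^bsub>?N\<^esub> j \<otimes>\<^bsub>?N\<^esub> inv\<^bsub>?N\<^esub> t = u"
      unfolding u_def using Ninv jN t T(2) by auto
    ultimately have "?D #> (u \<otimes> h \<otimes> inv u) = ?D #> h" using cos[OF uN less.prems(5)] by simp
    then have d: "u \<otimes> h \<otimes> inv u \<otimes> inv h \<in> ?D"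
      using G.r_coset_eq_iff[OF sD, of "u \<otimes> h \<otimes> inv u" h] uG less.prems(5) by simp
    define d where "d = u \<otimes> h \<otimes> inv u \<otimes> inv h"
    have hG: "h \<in> carrier G" using less.prems(5) by simp
    have dD: "d \<in> ?D" using d unfolding d_def .
    have dG: "d \<in> carrier G" using dD subgroup.mem_carrier[OF sD] by blast
    have uh: "u \<otimes> h = d \<otimes> h \<otimes> u" unfolding d_def using uG hG by (simp add: G.m_assoc)
    \<comment> \<open>The error \<open>d\<close> lies in the derived subgroup, which
      \<open>u\<close> centralizes by induction, so errors accumulate as plain powers. At the
      exponent \<open>q ^ k\<close> the power of \<open>u\<close> disappears, and \<open>d\<close>,
      having \<open>p\<close>-power order, must be trivial.\<close>
    have "u [^] n \<otimes> h = d [^] n \<otimes> h \<otimes> u [^] n" for n :: nat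
    proof (induction n)
      case (Suc n)
      have ud: "u [^] n \<otimes> d = d \<otimes> u [^] n" for n :: nat
      proof (induction n)
        case (Suc n)
        have "u [^] Suc n \<otimes> d = u [^] n \<otimes> (u \<otimes> d)" using uG dG by (simp add: G.m_assoc)
        also have "\<dots> = (u [^] n \<otimes> d) \<otimes> u" using uD[OF dD] uG dG by (simp add: G.m_assoc)
        finally show ?case using Suc uG dG by (simp add: G.m_assoc)
      qed (use dG in simp)
      have "u [^] Suc n \<otimes> h = u [^] n \<otimes> (u \<otimes> h)" using uG hG by (simp add: G.m_assoc)
      also have "\<dots> = (u [^] n \<otimes> d) \<otimes> (h \<otimes> u)" unfolding uh using uG hG dG by (simp add: G.m_assoc)
      also have "\<dots> = d \<otimes> (u [^] n \<otimes> h) \<otimes> u" unfolding ud using uG hG dG by (simp add: G.m_assoc)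
      also have "\<dots> = (d \<otimes> d [^] n) \<otimes> h \<otimes> (u [^] n \<otimes> u)" unfolding Suc using uG hG dG by (simp add: G.m_assoc)
      finally show ?case using dG G.nat_pow_Suc2[OF dG, of n] by simp
    qed (use hG in simp)
    from this[of "q ^ k"] have eq: "u [^] (q ^ k) \<otimes> h = d [^] (q ^ k) \<otimes> h \<otimes> u [^] (q ^ k)" .
    have cardpow: "s [^] card S = \<one>" if S: "subgroup S G" "s \<in> S" for s S
      using group.pow_order_eq_1[OF subgroup.subgroup_is_group[OF S(1) G.is_group], of s] S(2)
      by (simp add: order_def nat_pow_def)
    have "u [^] (q ^ k) = \<one>" using cardpow[OF T.subgroup_axioms uT] q(2) by simp
    with eq have "d [^] (q ^ k) \<otimes> h = h" using hG dG by simp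
    then have "d [^] (q ^ k) = \<one>" using hG dG G.r_cancel_one' by (metis G.nat_pow_closed)
    moreover have "d [^] (p ^ i) = \<one>" using cardpow[OF sD dD] i by simp
    moreover have "coprime (q ^ k) (p ^ i)" using primes_coprime[OF q(1) p(1)] q(3) by simp
    ultimately have "d = \<one>" using G.coprime_pow_mem[OF G.triv_subgroup dG, of "q ^ k" "p ^ i"] by simp
    then have "u \<otimes> h = h \<otimes> u" using uh hG uG by simp
    then show ?thesis unfolding u_def .
  qed
qed

end

section \<open>Normal sections and p-cores\<close>

context group
begin

text \<open>Normality inside a subgroup, stated in the ambient group so that chains of subgroups
  share one operation; \<open>normal_in_carrier\<close> and \<open>normal_in_restrict\<close>
  translate.\<close>

definition normal_in :: "'a set \<Rightarrow> 'a set \<Rightarrow> bool" where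
  "normal_in N H \<longleftrightarrow> subgroup N G \<and> N \<subseteq> H \<and> (\<forall>h\<in>H. \<forall>n\<in>N. h \<otimes> n \<otimes> inv h \<in> N)"

lemma normal_inD: "normal_in N H \<Longrightarrow> subgroup N G" "normal_in N H \<Longrightarrow> N \<subseteq> H"
  "normal_in N H \<Longrightarrow> h \<in> H \<Longrightarrow> n \<in> N \<Longrightarrow> h \<otimes> n \<otimes> inv h \<in> N"
  unfolding normal_in_def by blast+

lemma normal_inD': "subgroup H G \<Longrightarrow> normal_in N H \<Longrightarrow> h \<in> H \<Longrightarrow> n \<in> N \<Longrightarrow> inv h \<otimes> n \<otimes> h \<in> N"
  using normal_inD(3)[of N H "inv h" n] subgroup.m_inv_closed[of H G h] subgroup.mem_carrier[of H G h] by simp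

lemma normal_in_carrier: "normal_in N (carrier G) \<longleftrightarrow> N \<lhd> G"
  unfolding normal_in_def normal_inv_iff using subgroup.subset by blast

lemma normal_in_restrict: "subgroup H G \<Longrightarrow> N \<lhd> G\<lparr>carrier := H\<rparr> \<longleftrightarrow> normal_in N H"
proof -
  assume H: "subgroup H G"
  interpret HG: group "G\<lparr>carrier := H\<rparr>" by (rule subgroup.subgroup_is_group[OF H is_group])
  have "subgroup N (G\<lparr>carrier := H\<rparr>) \<longleftrightarrow> subgroup N G \<and> N \<subseteq> H"
    using subgroup_incl[OF _ H] incl_subgroup[OF H] subgroup.subset[of N "G\<lparr>carrier := H\<rparr>"] by auto
  then show ?thesis
    unfolding HG.normal_inv_iff normal_in_def using m_inv_consistent[OF H] by auto
qed

lemma normal_in_self: "subgroup H G \<Longrightarrow> normal_in H H"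
  unfolding normal_in_def by (auto simp: subgroup.m_closed subgroup.m_inv_closed)

lemma normal_in_one: "subgroup H G \<Longrightarrow> normal_in {\<one>} H"
  unfolding normal_in_def using triv_subgroup by (auto dest: subgroup.mem_carrier subgroup.one_closed)

lemma normal_in_Int: "normal_in N H \<Longrightarrow> normal_in M H \<Longrightarrow> normal_in (N \<inter> M) H"
  unfolding normal_in_def using subgroups_Inter_pair by blast

lemma normal_in_mult_subgroup:
  assumes fin: "finite (carrier G)" and H: "subgroup H G" and N: "normal_in N H" and M: "subgroup M G" "M \<subseteq> H"
  shows "subgroup (N <#> M) G" "N \<subseteq> N <#> M" "M \<subseteq> N <#> M" "N <#> M \<subseteq> H"
proof -
  interpret H: subgroup H G by fact
  interpret N: subgroup N G by (rule normal_inD(1)[OF N])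
  interpret M: subgroup M G by fact
  show "N <#> M \<subseteq> H" unfolding set_mult_def using normal_inD(2)[OF N] M(2) H.m_closed by blast
  show "subgroup (N <#> M) G"
  proof (rule subgroup_finI[OF fin])
    show "N <#> M \<subseteq> carrier G" unfolding set_mult_def by auto
    have "\<one> \<otimes> \<one> \<in> N <#> M" unfolding set_mult_def using N.one_closed M.one_closed by blast
    then show "N <#> M \<noteq> {}" by blast
    fix x y assume "x \<in> N <#> M" "y \<in> N <#> M"
    then obtain a b c d where e: "a \<in> N" "b \<in> M" "x = a \<otimes> b" "c \<in> N" "d \<in> M" "y = c \<otimes> d"
      unfolding set_mult_def by blast
    have "b \<otimes> c \<otimes> inv b \<in> N" using normal_inD(3)[OF N] e M(2) by blast
    then have "a \<otimes> (b \<otimes> c \<otimes> inv b) \<in> N" "b \<otimes> d \<in> M" using e by auto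
    moreover have "x \<otimes> y = (a \<otimes> (b \<otimes> c \<otimes> inv b)) \<otimes> (b \<otimes> d)" using e by (simp add: m_assoc)
    ultimately show "x \<otimes> y \<in> N <#> M" unfolding set_mult_def by blast
  qed
  show "N \<subseteq> N <#> M"
  proof
    fix x assume x: "x \<in> N"
    then have "x \<otimes> \<one> \<in> N <#> M" unfolding set_mult_def using M.one_closed by blast
    then show "x \<in> N <#> M" using x by simp
  qed
  show "M \<subseteq> N <#> M"
  proof
    fix x assume x: "x \<in> M"
    then have "\<one> \<otimes> x \<in> N <#> M" unfolding set_mult_def using N.one_closed by blast
    then show "x \<in> N <#> M" using x by simp
  qed
qed

lemma normal_in_mult:
  assumes fin: "finite (carrier G)" and H: "subgroup H G" and N: "normal_in N H" "normal_in M H"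
  shows "normal_in (N <#> M) H"
proof -
  note m = normal_in_mult_subgroup[OF fin H N(1) normal_inD(1,2)[OF N(2)]]
  have "h \<otimes> x \<otimes> inv h \<in> N <#> M" if h: "h \<in> H" and x: "x \<in> N <#> M" for h x
  proof -
    obtain a b where ab: "a \<in> N" "b \<in> M" "x = a \<otimes> b" using x unfolding set_mult_def by blast
    have G: "a \<in> carrier G" "b \<in> carrier G" "h \<in> carrier G"
      using ab normal_inD(1)[OF N(1)] normal_inD(1)[OF N(2)] h H subgroup.mem_carrier by metis+
    have "(h \<otimes> a \<otimes> inv h) \<otimes> (h \<otimes> b \<otimes> inv h) \<in> N <#> M"
      unfolding set_mult_def using normal_inD(3)[OF N(1) h ab(1)] normal_inD(3)[OF N(2) h ab(2)] by blast
    then show ?thesis using ab G by (simp add: m_assoc)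
  qed
  then show ?thesis unfolding normal_in_def using m by blast
qed

text \<open>Modulo \<open>N\<close> the factor \<open>x\<close> disappears; the computation in the
  quotient is carried out upstairs.\<close>

lemma mult_pow_mod:
  assumes H: "subgroup H G" and N: "normal_in N H" and x: "x \<in> N" and y: "y \<in> H"
  shows "\<exists>z\<in>N. (x \<otimes> y) [^] (n::nat) = z \<otimes> y [^] n"
proof (induction n)
  case 0 then show ?case using subgroup.one_closed[OF normal_inD(1)[OF N]] by (auto intro!: bexI[of _ \<one>])
next
  case (Suc n)
  interpret H: subgroup H G by fact
  interpret N: subgroup N G by (rule normal_inD(1)[OF N])
  obtain z where z: "z \<in> N" "(x \<otimes> y) [^] n = z \<otimes> y [^] n" using Suc by blast
  have yn: "y [^] n \<in> H" by (rule subgroup_pow[OF H y])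
  have c: "y [^] n \<otimes> x \<otimes> inv (y [^] n) \<in> N" by (rule normal_inD(3)[OF N yn x])
  have "(x \<otimes> y) [^] Suc n = (z \<otimes> y [^] n) \<otimes> (x \<otimes> y)" using z by simp
  also have "\<dots> = (z \<otimes> (y [^] n \<otimes> x \<otimes> inv (y [^] n))) \<otimes> y [^] Suc n"
    using z x y yn by (simp add: m_assoc)
  finally show ?case using z c by (intro bexI[of _ "z \<otimes> (y [^] n \<otimes> x \<otimes> inv (y [^] n))"]) auto
qed

lemma pi_section_mult:
  assumes fin: "finite (carrier G)" and H: "subgroup H G" and N: "normal_in N H" and M: "subgroup M G" "M \<subseteq> H"
    and s: "pi_section G p s N L" "pi_section G p s M L" and L: "L \<subseteq> N"
  shows "pi_section G p s (N <#> M) L"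
proof (rule pi_section_trans[OF _ s(1)])
  interpret H: subgroup H G by fact
  interpret N: subgroup N G by (rule normal_inD(1)[OF N])
  show "N <#> M \<subseteq> carrier G" using normal_in_mult_subgroup(4)[OF fin H N M] H.subset by blast
  show "pi_section G p s (N <#> M) N"
    unfolding pi_section_def
  proof
    fix g assume "g \<in> N <#> M"
    then obtain x y where xy: "x \<in> N" "y \<in> M" "g = x \<otimes> y" unfolding set_mult_def by blast
    then obtain n where n: "pi_number p s n" "y [^] n \<in> L" using s(2) unfolding pi_section_def by blast
    obtain z where "z \<in> N" "g [^] n = z \<otimes> y [^] n" using mult_pow_mod[OF H N xy(1), of y n] xy M(2) by blast
    then show "\<exists>n. pi_number p s n \<and> g [^] n \<in> N" using n L by (intro exI[of _ n]) auto
  qed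
qed

text \<open>The preimage in \<open>H\<close> of the largest normal p-subgroup (or p'-subgroup) of H
  / K; with \<open>K\<close> trivial it is O_p(H) or O_p'(H). Iterating it gives the
  p,p'-series.\<close>

definition core :: "nat \<Rightarrow> bool \<Rightarrow> 'a set \<Rightarrow> 'a set \<Rightarrow> 'a set" where
  "core p s H K = \<Union>{N. normal_in N H \<and> K \<subseteq> N \<and> pi_section G p s N K}"

text \<open>The product of two members of the defining family is a member, so a maximal member
  contains all others and equals the union.\<close>

lemma core_props:
  assumes fin: "finite (carrier G)" and H: "subgroup H G" and K: "normal_in K H"
  shows "normal_in (core p s H K) H" "K \<subseteq> core p s H K" "pi_section G p s (core p s H K) K"
proof -
  let ?F = "{N. normal_in N H \<and> K \<subseteq> N \<and> pi_section G p s N K}"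
  have "finite ?F"
    by (rule finite_subset[of _ "Pow (carrier G)"]) (use fin in \<open>auto dest!: normal_inD(1) dest: subgroup.subset\<close>)
  moreover have KF: "K \<in> ?F" using K pi_section_refl[OF subgroup.subset[OF normal_inD(1)[OF K]]] by blast
  ultimately have "\<exists>N\<in>?F. \<forall>M\<in>?F. N \<subseteq> M \<longrightarrow> N = M" by (intro finite_has_maximal) blast+
  then obtain N where N: "N \<in> ?F" and mx: "\<forall>M\<in>?F. N \<subseteq> M \<longrightarrow> N = M" ..
  have max: "M = N" if "M \<in> ?F" "N \<subseteq> M" for M
    by (rule mp[OF bspec[OF mx that(1)] that(2), symmetric])
  have "M \<subseteq> N" if M: "M \<in> ?F" for M
  proof -
    have m: "normal_in N H" "normal_in M H" "K \<subseteq> N" "pi_section G p s N K" "pi_section G p s M K" using N M by auto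
    note ms = normal_in_mult_subgroup[OF fin H m(1) normal_inD(1,2)[OF m(2)]]
    have "N <#> M \<in> ?F"
      using normal_in_mult[OF fin H m(1,2)] subset_trans[OF m(3) ms(2)]
        pi_section_mult[OF fin H m(1) normal_inD(1,2)[OF m(2)] m(4,5,3)] by simp
    then have "N <#> M = N" using ms(2) by (rule max)
    then show ?thesis using ms(3) by simp
  qed
  then have "\<Union>?F = N" using N by (intro equalityI Union_least Union_upper)
  then have "core p s H K = N" unfolding core_def .
  with N show "normal_in (core p s H K) H" "K \<subseteq> core p s H K" "pi_section G p s (core p s H K) K" by auto
qed

lemma core_max: "normal_in N H \<Longrightarrow> K \<subseteq> N \<Longrightarrow> pi_section G p s N K \<Longrightarrow> N \<subseteq> core p s H K"
  unfolding core_def by blast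

text \<open>The image of the core is one of the subgroups in the defining union. It serves
  conjugations in \<open>core_normal_in\<close> and the automorphisms \<open>phi a\<close> in
  \<open>core_A_invariant\<close>.\<close>

lemma core_hom:
  assumes fin: "finite (carrier G)" and H: "subgroup H G" and K: "normal_in K H"
    and f: "group_hom G G f" and fH: "f ` H = H" and fK: "f ` K = K"
  shows "f ` core p s H K \<subseteq> core p s H K"
proof (rule core_max)
  interpret f: group_hom G G f by (rule f)
  interpret H: subgroup H G by fact
  note c = core_props[OF fin H K, of p s]
  interpret C: subgroup "core p s H K" G by (rule normal_inD(1)[OF c(1)])
  show "normal_in (f ` core p s H K) H"
    unfolding normal_in_def
  proof (intro conjI ballI)
    show "subgroup (f ` core p s H K) G" by (rule f.subgroup_img_is_subgroup[OF C.subgroup_axioms])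
    show "f ` core p s H K \<subseteq> H" using fH normal_inD(2)[OF c(1)] by blast
    fix h n assume h: "h \<in> H" and "n \<in> f ` core p s H K"
    then obtain m h' where m: "m \<in> core p s H K" "n = f m" "h' \<in> H" "h = f h'" using fH by (metis imageE)
    then have "h' \<otimes> m \<otimes> inv h' \<in> core p s H K" using normal_inD(3)[OF c(1)] by blast
    moreover have "h \<otimes> n \<otimes> inv h = f (h' \<otimes> m \<otimes> inv h')" using m by simp
    ultimately show "h \<otimes> n \<otimes> inv h \<in> f ` core p s H K" by blast
  qed
  show "K \<subseteq> f ` core p s H K" using fK c(2) by blast
  show "pi_section G p s (f ` core p s H K) K"
    unfolding pi_section_def
  proof
    fix g assume "g \<in> f ` core p s H K"
    then obtain m where m: "m \<in> core p s H K" "g = f m" by blast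
    then obtain n where n: "pi_number p s n" "m [^] n \<in> K" using c(3) unfolding pi_section_def by blast
    have "g [^] n = f (m [^] n)" using m f.hom_nat_pow[of m n] by simp
    then show "\<exists>n. pi_number p s n \<and> g [^] n \<in> K" using n fK by blast
  qed
qed

lemma conj_hom: "g \<in> carrier G \<Longrightarrow> group_hom G G (\<lambda>x. g \<otimes> x \<otimes> inv g)"
  by unfold_locales (auto simp: hom_def m_assoc)

lemma conj_image:
  assumes "finite (carrier G)" "subgroup H G" "normal_in N H" "h \<in> H"
  shows "(\<lambda>x. h \<otimes> x \<otimes> inv h) ` N = N"
  using conj_set_eqI[of N h] assms subgroup_pos_card[OF assms(1) normal_inD(1)[OF assms(3)]]
    subgroup.subset[OF normal_inD(1)[OF assms(3)]] subgroup.mem_carrier[OF assms(2,4)] normal_inD(3)[OF assms(3)]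
  unfolding conj_set_def by blast

lemma core_normal_in:
  assumes fin: "finite (carrier G)" and L: "subgroup L G" and H: "normal_in H L" and K: "normal_in K L" "K \<subseteq> H"
  shows "normal_in (core p s H K) L"
proof -
  have sH: "subgroup H G" by (rule normal_inD(1)[OF H])
  have KH: "normal_in K H" using K normal_inD(2)[OF H] unfolding normal_in_def by blast
  note c = core_props[OF fin sH KH, of p s]
  have "h \<otimes> n \<otimes> inv h \<in> core p s H K" if "h \<in> L" "n \<in> core p s H K" for h n
  proof -
    have "h \<in> carrier G" using subgroup.mem_carrier[OF L that(1)] .
    then have "(\<lambda>x. h \<otimes> x \<otimes> inv h) ` core p s H K \<subseteq> core p s H K"
      by (intro core_hom[OF fin sH KH conj_hom] conj_image[OF fin L H that(1)] conj_image[OF fin L K(1) that(1)])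
    then show ?thesis using that(2) by blast
  qed
  then show ?thesis unfolding normal_in_def using normal_inD[OF c(1)] normal_inD(2)[OF H] by blast
qed

text \<open>The series of a p-solvable group is only subnormal. Cut down to the interval from
  \<open>K\<close> to \<open>M\<close>, its first proper step above \<open>K\<close> is a section of
  one kind, and normality is regained by enlarging it to cores.\<close>

lemma p_solvable_normal_section:
  assumes fin: "finite (carrier G)" and p: "Factorial_Ring.prime p" and sol: "p_solvable p G"
    and K: "K \<lhd> G" and M: "M \<lhd> G" and KM: "K \<subset> M"
  shows "\<exists>N s. N \<lhd> G \<and> K \<subset> N \<and> N \<subseteq> M \<and> pi_section G p s N K"
proof -
  obtain n S where S: "S 0 = {\<one>}" "S n = carrier G" "\<And>i. i \<le> n \<Longrightarrow> subgroup (S i) G"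
    "\<And>i. i < n \<Longrightarrow> S i \<lhd> G\<lparr>carrier := S (Suc i)\<rparr>"
    "\<And>i. i < n \<Longrightarrow> is_p_group p (G\<lparr>carrier := S (Suc i)\<rparr> Mod S i) \<or> is_p'_group p (G\<lparr>carrier := S (Suc i)\<rparr> Mod S i)"
    using sol unfolding p_solvable_def by blast
  have nK: "normal_in K (carrier G)" and nM: "normal_in M (carrier G)" using K M normal_in_carrier by blast+
  have sK: "subgroup K G" and sM: "subgroup M G" using normal_inD(1) nK nM by blast+
  interpret K: subgroup K G by fact
  interpret M: subgroup M G by fact
  have Sn: "normal_in (S i) (S (Suc i))" if "i < n" for i
    using normal_in_restrict[OF S(3)[of "Suc i"]] S(4)[OF that] that by simp
  have pi_section: "\<exists>s. pi_section G p s (S (Suc i)) (S i)" if i: "i < n" for i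
  proof -
    interpret SG: group "G\<lparr>carrier := S (Suc i)\<rparr>"
      using subgroup.subgroup_is_group[OF S(3)[of "Suc i"] is_group] i by simp
    have fS: "finite (S (Suc i))" using subgroup_pos_card[OF fin S(3)[of "Suc i"]] i by simp
    have "\<exists>s. pi_number p s (card (rcosets\<^bsub>G\<lparr>carrier := S (Suc i)\<rparr>\<^esub> S i))"
      using S(5)[OF i] prime_imp_coprime[OF p] unfolding is_p_group_def is_p'_group_def pi_number_def order_def FactGroup_def
      by (auto intro: exI[of _ True] exI[of _ False])
    then show ?thesis using SG.index_pi_section[of "S i" p] fS S(4)[OF i] by auto
  qed
  \<comment> \<open>This series runs from \<open>K\<close> to \<open>M\<close> and inherits the
    sections of \<open>S\<close>.\<close>
  define H where "H i = K <#> (S i \<inter> M)" for i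
  have SM: "subgroup (S i \<inter> M) G" if "i \<le> n" for i using subgroups_Inter_pair[OF S(3)[OF that] sM] .
  have sMG: "S i \<inter> M \<subseteq> carrier G" for i using M.subset by blast
  note Hm = normal_in_mult_subgroup[OF fin subgroup_self nK SM sMG, folded H_def]
  have HM: "H i \<subseteq> M" for i unfolding H_def set_mult_def using KM by (auto intro: M.m_closed)
  have HH: "normal_in (H i) (H (Suc i))" if i: "i < n" for i
    unfolding normal_in_def
  proof (intro conjI ballI)
    show "subgroup (H i) G" using Hm(1)[of i] i by simp
    show "H i \<subseteq> H (Suc i)" unfolding H_def set_mult_def using normal_inD(2)[OF Sn[OF i]] by blast
    fix g x assume "g \<in> H (Suc i)" "x \<in> H i"
    then obtain a b c d where e: "a \<in> K" "b \<in> S (Suc i)" "b \<in> M" "g = a \<otimes> b" "c \<in> K" "d \<in> S i" "d \<in> M" "x = c \<otimes> d"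
      unfolding H_def set_mult_def by blast
    have G: "a \<in> carrier G" "b \<in> carrier G" "c \<in> carrier G" "d \<in> carrier G" using e by auto
    let ?d = "b \<otimes> d \<otimes> inv b"
    have d: "?d \<in> S i" "?d \<in> M" using normal_inD(3)[OF Sn[OF i]] e by auto
    have "?d \<otimes> inv a \<otimes> inv ?d \<in> K" using normal_inD(3)[OF nK, of ?d "inv a"] e G by simp
    moreover have "b \<otimes> c \<otimes> inv b \<in> K" using normal_inD(3)[OF nK, of b c] e G by simp
    ultimately have "a \<otimes> (b \<otimes> c \<otimes> inv b) \<otimes> (?d \<otimes> inv a \<otimes> inv ?d) \<in> K" using e by simp
    then have "(a \<otimes> (b \<otimes> c \<otimes> inv b) \<otimes> (?d \<otimes> inv a \<otimes> inv ?d)) \<otimes> ?d \<in> H i"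
      unfolding H_def set_mult_def using d by blast
    moreover have "(a \<otimes> (b \<otimes> c \<otimes> inv b) \<otimes> (?d \<otimes> inv a \<otimes> inv ?d)) \<otimes> ?d = g \<otimes> x \<otimes> inv g"
      using e G by (simp add: m_assoc inv_mult_group)
    ultimately show "g \<otimes> x \<otimes> inv g \<in> H i" by simp
  qed
  have KHi: "normal_in K (H i)" if "i \<le> n" for i
  proof -
    have "H i \<subseteq> carrier G" by (rule subgroup.subset[OF Hm(1)[OF that]])
    then show ?thesis unfolding normal_in_def using sK Hm(2)[OF that] normal_inD(3)[OF nK] by blast
  qed
  have "S n \<inter> M \<subseteq> H n" using Hm(3)[of n] by simp
  then have Hn: "H n = M" using HM S(2) M.subset by blast
  have "H 0 = K" unfolding H_def S(1) set_mult_def using M.one_closed by auto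
  then have "\<exists>i<n. H i = K \<and> H (Suc i) \<noteq> K"
  proof -
    assume H0: "H 0 = K"
    have "\<exists>i. H i \<noteq> K" using Hn KM by blast
    define i where "i = (LEAST i. H i \<noteq> K)"
    have i: "H i \<noteq> K" unfolding i_def using \<open>\<exists>i. H i \<noteq> K\<close> by (rule LeastI_ex)
    then obtain j where j: "i = Suc j" using H0 by (cases i) auto
    have "H j = K" using not_less_Least[of j "\<lambda>i. H i \<noteq> K"] j unfolding i_def by auto
    moreover have "i \<le> n" unfolding i_def using Least_le[of "\<lambda>i. H i \<noteq> K" n] Hn KM by blast
    ultimately show ?thesis using i j by (intro exI[of _ j]) auto
  qed
  then obtain i where i: "i < n" "H i = K" "H (Suc i) \<noteq> K" by blast
  obtain s where s: "pi_section G p s (S (Suc i)) (S i)" using pi_section[OF i(1)] by blast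
  have sH: "pi_section G p s (H (Suc i)) K"
    unfolding pi_section_def
  proof
    fix g assume "g \<in> H (Suc i)"
    then obtain a b where ab: "a \<in> K" "b \<in> S (Suc i)" "b \<in> M" "g = a \<otimes> b" unfolding H_def set_mult_def by blast
    then obtain m where m: "pi_number p s m" "b [^] m \<in> S i" using s unfolding pi_section_def by blast
    have "b [^] m \<in> S i \<inter> M" using m subgroup_pow[OF sM ab(3)] by blast
    then have bK: "b [^] m \<in> K" using Hm(3)[of i] i by auto
    have "b \<in> carrier G" using ab by simp
    then obtain z where "z \<in> K" "g [^] m = z \<otimes> b [^] m" using mult_pow_mod[OF subgroup_self nK ab(1), of b m] ab(4) by blast
    then show "\<exists>n. pi_number p s n \<and> g [^] n \<in> K" using m(1) bK by (intro exI[of _ m]) auto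
  qed
  \<comment> \<open>The core of each term over \<open>K\<close> is normal in the next term, hence
    contained in the next core; so the first step above \<open>K\<close> ends up in the core of
    \<open>M\<close>, which is normal in \<open>G\<close>.\<close>
  have "H (Suc i) \<subseteq> core p s (H j) K" if "Suc i \<le> j" "j \<le> n" for j
    using that
  proof (induction j rule: dec_induct)
    case base
    then show ?case
      using core_max[OF normal_in_self[OF Hm(1)] Hm(2) sH] by simp
  next
    case (step j)
    have jn: "j < n" using step by simp
    have sHj: "subgroup (H (Suc j)) G" using Hm(1)[of "Suc j"] jn by simp
    have KHj: "normal_in K (H (Suc j))" "K \<subseteq> H j" "normal_in K (H j)" using KHi[of "Suc j"] KHi[of j] Hm(2)[of j] jn by auto
    have "normal_in (core p s (H j) K) (H (Suc j))" by (rule core_normal_in[OF fin sHj HH[OF jn] KHj(1,2)])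
    moreover have "K \<subseteq> core p s (H j) K" "pi_section G p s (core p s (H j) K) K"
      using core_props[OF fin normal_inD(1)[OF HH[OF jn]] KHj(3)] by blast+
    ultimately have "core p s (H j) K \<subseteq> core p s (H (Suc j)) K" by (rule core_max)
    then show ?case using step by auto
  qed
  from this[of n] have sub: "H (Suc i) \<subseteq> core p s M K" using i(1) Hn by simp
  have KM': "normal_in K M" using KHi[of n] Hn by simp
  note c = core_props[OF fin sM KM', of p s]
  have "normal_in (core p s M K) (carrier G)" by (rule core_normal_in[OF fin subgroup_self nM nK]) (use KM in blast)
  then have "core p s M K \<lhd> G" using normal_in_carrier by blast
  moreover have "K \<subset> core p s M K" using sub i(3) Hm(2)[of "Suc i"] i(1) c(2) by auto
  ultimately show ?thesis using c(3) normal_inD(2)[OF c(1)] by blast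
qed

end

section \<open>Central transfer and the Hall--Higman lemma\<close>

context group
begin

text \<open>The homomorphism is the transfer into the central subgroup \<open>Z\<close>.\<close>

lemma central_transfer:
  assumes fin: "finite (carrier G)" and Z: "subgroup Z G"
    and cen: "\<And>z g. z \<in> Z \<Longrightarrow> g \<in> carrier G \<Longrightarrow> z \<otimes> g = g \<otimes> z"
  shows "\<exists>t. (\<forall>x\<in>carrier G. t x \<in> Z) \<and> (\<forall>x\<in>carrier G. \<forall>y\<in>carrier G. t (x \<otimes> y) = t x \<otimes> t y) \<and>
    (\<forall>z\<in>Z. t z = z [^] card (rcosets Z))"
proof -
  interpret Z: subgroup Z G by fact
  let ?Z = "G\<lparr>carrier := Z\<rparr>"
  interpret ZG: comm_group ?Z
  proof (rule group.group_comm_groupI[OF Z.subgroup_is_group[OF is_group]])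
    fix x y assume "x \<in> carrier ?Z" "y \<in> carrier ?Z"
    then show "x \<otimes>\<^bsub>?Z\<^esub> y = y \<otimes>\<^bsub>?Z\<^esub> x" using cen[of x y] Z.mem_carrier[of y] by simp
  qed
  define rep where "rep R = (SOME g. g \<in> R)" for R :: "'a set"
  have rep: "rep R \<in> R" "rep R \<in> carrier G" "Z #> rep R = R" if "R \<in> rcosets Z" for R
  proof -
    from that obtain g where g: "g \<in> carrier G" "R = Z #> g" unfolding RCOSETS_def by blast
    then have "g \<in> R" using rcos_self[OF g(1) Z] by simp
    then show r: "rep R \<in> R" unfolding rep_def by (rule someI)
    show "rep R \<in> carrier G" using Z.rcosets_carrier[OF is_group that] r by blast
    show "Z #> rep R = R" using repr_independence[of "rep R" Z g] r g Z by simp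
  qed
  have cos: "R #> x \<in> rcosets Z" "R #> x = Z #> (rep R \<otimes> x)" if "R \<in> rcosets Z" "x \<in> carrier G" for R x
  proof -
    show eq: "R #> x = Z #> (rep R \<otimes> x)"
      using coset_mult_assoc[OF Z.subset rep(2)[OF that(1)] that(2)] rep(3)[OF that(1)] by simp
    show "R #> x \<in> rcosets Z" unfolding eq using rcosetsI[OF Z.subset] rep(2)[OF that(1)] that(2) by simp
  qed
  \<comment> \<open>The factor by which multiplication with \<open>x\<close> misses the chosen
    representative; the cocycle identity \<open>cm\<close> makes the product over all cosets
    multiplicative.\<close>
  define c where "c x R = rep R \<otimes> x \<otimes> inv (rep (R #> x))" for x R
  have cZ: "c x R \<in> Z" if "R \<in> rcosets Z" "x \<in> carrier G" for x R
    unfolding c_def using r_coset_eq_iff[OF Z, of "rep R \<otimes> x" "rep (R #> x)"] that cos[OF that] rep[OF that(1)] rep[OF cos(1)[OF that]]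
    by simp
  have cm: "c (x \<otimes> y) R = c x R \<otimes> c y (R #> x)" if R: "R \<in> rcosets Z" and x: "x \<in> carrier G" "y \<in> carrier G" for x y R
  proof -
    have "R \<subseteq> carrier G" by (rule Z.rcosets_carrier[OF is_group R])
    then have "R #> x #> y = R #> (x \<otimes> y)" using coset_mult_assoc x by blast
    moreover have "rep (R #> x) \<in> carrier G" "rep (R #> x #> y) \<in> carrier G"
      using rep(2)[OF cos(1)[OF R x(1)]] rep(2)[OF cos(1)[OF cos(1)[OF R x(1)] x(2)]] by blast+
    ultimately show ?thesis unfolding c_def using rep(2)[OF R] x by (simp add: m_assoc)
  qed
  define t where "t x = finprod ?Z (c x) (rcosets Z)" for x
  have tZ: "t x \<in> Z" if "x \<in> carrier G" for x
  proof -
    have "t x \<in> carrier ?Z" unfolding t_def by (rule ZG.finprod_closed) (use cZ that in auto)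
    then show ?thesis by simp
  qed
  have tm: "t (x \<otimes> y) = t x \<otimes> t y" if x: "x \<in> carrier G" "y \<in> carrier G" for x y
  proof -
    have "t (x \<otimes> y) = finprod ?Z (\<lambda>R. c x R \<otimes>\<^bsub>?Z\<^esub> c y (R #> x)) (rcosets Z)"
      unfolding t_def by (rule ZG.finprod_cong') (use cm cZ cos x in auto)
    also have "\<dots> = finprod ?Z (c x) (rcosets Z) \<otimes>\<^bsub>?Z\<^esub> finprod ?Z (\<lambda>R. c y (R #> x)) (rcosets Z)"
      by (rule ZG.finprod_multf) (use cZ cos x in auto)
    also have "finprod ?Z (\<lambda>R. c y (R #> x)) (rcosets Z) = t y"
    proof -
      have cancel: "R #> x #> inv x = R" "R #> inv x #> x = R" if "R \<in> rcosets Z" for R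
        using Z.rcosets_carrier[OF is_group that] x by (simp_all add: coset_mult_assoc)
      have img: "(\<lambda>R. R #> x) ` (rcosets Z) = rcosets Z"
      proof
        show "rcosets Z \<subseteq> (\<lambda>R. R #> x) ` (rcosets Z)"
        proof
          fix R assume R: "R \<in> rcosets Z"
          then have "R = (R #> inv x) #> x" "R #> inv x \<in> rcosets Z" using cancel(2)[OF R] cos(1)[OF R, of "inv x"] x by auto
          then show "R \<in> (\<lambda>R. R #> x) ` (rcosets Z)" by blast
        qed
      qed (use cos x in auto)
      have "inj_on (\<lambda>R. R #> x) (rcosets Z)" by (rule inj_on_inverseI[of _ "\<lambda>R. R #> inv x"]) (rule cancel)
      moreover have "c y \<in> (\<lambda>R. R #> x) ` (rcosets Z) \<rightarrow> carrier ?Z" unfolding img using cZ x by auto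
      ultimately show ?thesis
        using ZG.finprod_reindex[of "c y" "\<lambda>R. R #> x" "rcosets Z"] unfolding img t_def by simp
    qed
    finally show ?thesis unfolding t_def by simp
  qed
  have tz: "t z = z [^] card (rcosets Z)" if z: "z \<in> Z" for z
  proof -
    have "c z R = z" if R: "R \<in> rcosets Z" for R
    proof -
      have zG: "z \<in> carrier G" and rG: "rep R \<in> carrier G" using z rep(2)[OF R] by auto
      have "R #> z = Z #> (z \<otimes> rep R)" using cos(2)[OF R zG] cen[OF z rG] by simp
      also have "\<dots> = (Z #> z) #> rep R" using coset_mult_assoc[OF Z.subset zG rG] by simp
      also have "Z #> z = Z" by (rule coset_join2[OF zG Z z])
      finally have "R #> z = R" using rep(3)[OF R] by simp
      moreover have "rep R \<otimes> z = z \<otimes> rep R" using cen[OF z rG] by simp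
      ultimately show ?thesis unfolding c_def using zG rG by (simp add: m_assoc)
    qed
    then have "t z = finprod ?Z (\<lambda>R. z) (rcosets Z)"
      unfolding t_def by (intro ZG.finprod_cong') (use z in auto)
    also have "\<dots> = z [^] card (rcosets Z)" using ZG.finprod_const[of z "rcosets Z"] z by (simp add: nat_pow_def)
    finally show ?thesis .
  qed
  show ?thesis using tZ tm tz by blast
qed

text \<open>The set is the kernel of the transfer. Its values lie in the \<open>p\<close>-group
  \<open>Z\<close>, so elements of exponent prime to \<open>p\<close> are killed; conversely, if
  \<open>g\<close> is killed, the power of \<open>g\<close> that lies in \<open>Z\<close> has order
  dividing the index of \<open>Z\<close>, which is prime to \<open>p\<close>.\<close>

lemma central_p_complement:
  assumes fin: "finite (carrier G)" and p: "Factorial_Ring.prime p" and Z: "subgroup Z G"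
    and cen: "\<And>z g. z \<in> Z \<Longrightarrow> g \<in> carrier G \<Longrightarrow> z \<otimes> g = g \<otimes> z"
    and s1: "pi_section G p False (carrier G) Z" and s2: "pi_section G p True Z {\<one>}"
  shows "subgroup {g \<in> carrier G. \<exists>n. coprime p n \<and> g [^] n = \<one>} G"
proof -
  interpret Z: subgroup Z G by fact
  obtain t where t: "\<And>x. x \<in> carrier G \<Longrightarrow> t x \<in> Z"
    "\<And>x y. x \<in> carrier G \<Longrightarrow> y \<in> carrier G \<Longrightarrow> t (x \<otimes> y) = t x \<otimes> t y"
    "\<And>z. z \<in> Z \<Longrightarrow> t z = z [^] card (rcosets Z)"
    using central_transfer[OF fin Z cen] by blast
  have nZ: "Z \<lhd> G" unfolding normal_inv_iff
  proof (intro conjI ballI Z)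
    fix x z assume x: "x \<in> carrier G" and z: "z \<in> Z"
    have "x \<otimes> z \<otimes> inv x = z \<otimes> x \<otimes> inv x" using cen[OF z x] by simp
    also have "\<dots> = z" using x z by (simp add: m_assoc)
    finally show "x \<otimes> z \<otimes> inv x \<in> Z" using z by simp
  qed
  have m: "coprime p (card (rcosets Z))" using pi_section_index[OF fin nZ p s1] unfolding pi_number_def by simp
  have t1: "t \<one> = \<one>" using t(3)[OF Z.one_closed] by simp
  have tp: "t (x [^] n) = t x [^] n" if "x \<in> carrier G" for x and n :: nat
    by (induction n) (use that t1 t(2) in auto)
  have iff: "(\<exists>n. coprime p n \<and> g [^] n = \<one>) \<longleftrightarrow> t g = \<one>" if g: "g \<in> carrier G" for g
  proof
    assume "\<exists>n. coprime p n \<and> g [^] n = \<one>"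
    then obtain n where n: "coprime p n" "g [^] n = \<one>" by blast
    have "t g [^] n = \<one>" using tp[OF g, of n] n(2) t1 by simp
    moreover obtain k where "t g [^] (p ^ k) = \<one>" using s2 t(1)[OF g] unfolding pi_section_def pi_number_def by auto
    moreover have "coprime n (p ^ k)" using n(1) by (simp add: coprime_commute)
    ultimately show "t g = \<one>" using coprime_pow_mem[OF triv_subgroup, of "t g" n "p ^ k"] t(1)[OF g] by simp
  next
    assume tg: "t g = \<one>"
    obtain n where n: "coprime p n" "g [^] n \<in> Z" using s1 g unfolding pi_section_def pi_number_def by auto
    have "(g [^] n) [^] card (rcosets Z) = \<one>" using t(3)[OF n(2)] tp[OF g, of n] tg by simp
    then have "g [^] (n * card (rcosets Z)) = \<one>" using g by (simp add: nat_pow_pow)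
    then show "\<exists>n. coprime p n \<and> g [^] n = \<one>" using n(1) m by (intro exI[of _ "n * card (rcosets Z)"]) simp
  qed
  have "{g \<in> carrier G. \<exists>n. coprime p n \<and> g [^] n = \<one>} = {g \<in> carrier G. t g = \<one>}" using iff by blast
  moreover have "subgroup {g \<in> carrier G. t g = \<one>} G"
    by (rule subgroup_finI[OF fin]) (use t1 t(2) in auto)
  ultimately show ?thesis by simp
qed

text \<open>The form in which p-solvability is used from here on: it concerns normal subgroups only
  and passes to quotients without rebuilding a series.\<close>

definition p_sections :: "nat \<Rightarrow> bool" where
  "p_sections p \<longleftrightarrow> (\<forall>K M. K \<lhd> G \<longrightarrow> M \<lhd> G \<longrightarrow> K \<subset> M \<longrightarrow>
     (\<exists>N s. N \<lhd> G \<and> K \<subset> N \<and> N \<subseteq> M \<and> pi_section G p s N K))"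

lemma one_core: "finite (carrier G) \<Longrightarrow> core p s (carrier G) {\<one>} \<lhd> G"
  "finite (carrier G) \<Longrightarrow> pi_section G p s (core p s (carrier G) {\<one>}) {\<one>}"
  using core_props[OF _ subgroup_self normal_in_one[OF subgroup_self]] normal_in_carrier by blast+

definition centralizer_of :: "'a set \<Rightarrow> 'a set" where
  "centralizer_of S = {g \<in> carrier G. \<forall>x\<in>S. g \<otimes> x = x \<otimes> g}"

definition normalizer_of :: "'a set \<Rightarrow> 'a set" where
  "normalizer_of S = {g \<in> carrier G. \<forall>x\<in>S. g \<otimes> x \<otimes> inv g \<in> S}"

lemma centralizer_of_subgroup: assumes fin: "finite (carrier G)" and S: "S \<subseteq> carrier G" shows "subgroup (centralizer_of S) G"
proof (rule subgroup_finI[OF fin])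
  show "centralizer_of S \<noteq> {}" unfolding centralizer_of_def using S by (auto intro!: exI[of _ \<one>])
  fix a b assume ab: "a \<in> centralizer_of S" "b \<in> centralizer_of S"
  have "a \<otimes> b \<otimes> x = x \<otimes> (a \<otimes> b)" if x: "x \<in> S" for x
  proof -
    have G: "a \<in> carrier G" "b \<in> carrier G" "x \<in> carrier G" and e: "a \<otimes> x = x \<otimes> a" "b \<otimes> x = x \<otimes> b"
      using ab x S unfolding centralizer_of_def by auto
    have "a \<otimes> b \<otimes> x = a \<otimes> (x \<otimes> b)" using G e by (simp add: m_assoc)
    also have "\<dots> = (a \<otimes> x) \<otimes> b" using G by (simp add: m_assoc)
    finally show ?thesis using G e by (simp add: m_assoc)
  qed
  then show "a \<otimes> b \<in> centralizer_of S" using ab unfolding centralizer_of_def by simp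
qed (auto simp: centralizer_of_def)

lemma normalizer_subgroup:
  assumes fin: "finite (carrier G)" and S: "S \<subseteq> carrier G" shows "subgroup (normalizer_of S) G"
proof (rule subgroup_finI[OF fin])
  show "normalizer_of S \<noteq> {}" unfolding normalizer_of_def using S by (auto intro!: exI[of _ \<one>])
  fix a b assume ab: "a \<in> normalizer_of S" "b \<in> normalizer_of S"
  have "a \<otimes> b \<otimes> x \<otimes> inv (a \<otimes> b) \<in> S" if x: "x \<in> S" for x
  proof -
    have "a \<otimes> (b \<otimes> x \<otimes> inv b) \<otimes> inv a \<in> S" using ab x unfolding normalizer_of_def by blast
    moreover have "a \<in> carrier G" "b \<in> carrier G" "x \<in> carrier G" using ab x S unfolding normalizer_of_def by auto
    ultimately show ?thesis by (simp add: m_assoc inv_mult_group)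
  qed
  then show "a \<otimes> b \<in> normalizer_of S" using ab unfolding normalizer_of_def by simp
qed (auto simp: normalizer_of_def)

lemma centralizer_of_conj:
  assumes g: "g \<in> normalizer_of S" and S: "S \<subseteq> carrier G" and fin: "finite (carrier G)" and c: "c \<in> centralizer_of S"
  shows "g \<otimes> c \<otimes> inv g \<in> centralizer_of S"
proof -
  have gG: "g \<in> carrier G" using g unfolding normalizer_of_def by blast
  have "inv g \<in> normalizer_of S" by (rule subgroup.m_inv_closed[OF normalizer_subgroup[OF fin S] g])
  then have "inv g \<otimes> x \<otimes> inv (inv g) \<in> S" if "x \<in> S" for x using that unfolding normalizer_of_def by blast
  then have S': "inv g \<otimes> x \<otimes> g \<in> S" if "x \<in> S" for x using that gG by simp
  have cG: "c \<in> carrier G" using c unfolding centralizer_of_def by blast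
  have "g \<otimes> c \<otimes> inv g \<otimes> x = x \<otimes> (g \<otimes> c \<otimes> inv g)" if x: "x \<in> S" for x
  proof -
    have xG: "x \<in> carrier G" using x S by blast
    have e: "c \<otimes> (inv g \<otimes> x \<otimes> g) = (inv g \<otimes> x \<otimes> g) \<otimes> c" using c S'[OF x] unfolding centralizer_of_def by blast
    have "g \<otimes> c \<otimes> inv g \<otimes> x = g \<otimes> (c \<otimes> (inv g \<otimes> x \<otimes> g)) \<otimes> inv g"
      using gG cG xG by (simp add: m_assoc)
    also have "\<dots> = x \<otimes> (g \<otimes> c \<otimes> inv g)" unfolding e using gG cG xG by (simp add: m_assoc)
    finally show ?thesis .
  qed
  then show ?thesis unfolding centralizer_of_def using gG cG by simp
qed

text \<open>Otherwise there is a normal section N / Z of one kind, where Z is the intersection of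
  the centralizer C with P and N lies in C. If it is a p-section, N is a normal p-subgroup and lies
  in P. If it is a p'-section, Z is central in N, so by \<open>central_p_complement\<close> the
  p'-elements of N form a normal p'-subgroup of G, which is trivial, and N = Z.\<close>

lemma hall_higman:
  assumes fin: "finite (carrier G)" and p: "Factorial_Ring.prime p" and sol: "p_sections p"
    and O: "core p False (carrier G) {\<one>} = {\<one>}"
    and g: "g \<in> carrier G" and cen: "\<And>x. x \<in> core p True (carrier G) {\<one>} \<Longrightarrow> g \<otimes> x = x \<otimes> g"
  shows "g \<in> core p True (carrier G) {\<one>}"
proof -
  define P where "P = core p True (carrier G) {\<one>}"
  define C where "C = centralizer_of P"
  have P: "normal_in P (carrier G)" "pi_section G p True P {\<one>}" unfolding P_def using one_core[OF fin] normal_in_carrier by blast+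
  interpret P: subgroup P G by (rule normal_inD(1)[OF P(1)])
  have Pmax: "N \<subseteq> P" if "N \<lhd> G" "pi_section G p True N {\<one>}" for N
    unfolding P_def using that core_max[of N "carrier G" "{\<one>}" p True] normal_in_carrier
      subgroup.one_closed[OF normal_imp_subgroup[OF that(1)]] by blast
  have sC: "subgroup C G" unfolding C_def by (rule centralizer_of_subgroup[OF fin P.subset])
  have "normalizer_of P = carrier G" unfolding normalizer_of_def using normal_inD(3)[OF P(1)] by blast
  then have nC: "normal_in C (carrier G)"
    unfolding normal_in_def using sC subgroup.subset[OF sC] centralizer_of_conj[OF _ P.subset fin] unfolding C_def by blast
  define Z where "Z = C \<inter> P"
  have nZ: "normal_in Z (carrier G)" unfolding Z_def by (rule normal_in_Int[OF nC P(1)])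
  have "C \<subseteq> P"
  proof (rule ccontr)
    assume "\<not> C \<subseteq> P"
    then have "Z \<subset> C" unfolding Z_def by blast
    then obtain N s where N: "N \<lhd> G" "Z \<subset> N" "N \<subseteq> C" "pi_section G p s N Z"
      using sol nZ nC normal_in_carrier unfolding p_sections_def by metis
    interpret N: subgroup N G by (rule normal_imp_subgroup[OF N(1)])
    have sZ: "pi_section G p True Z {\<one>}" using P(2) unfolding Z_def by (rule pi_section_mono) auto
    show False
    proof (cases s)
      case True
      then have "pi_section G p True N {\<one>}" using pi_section_trans[OF _ sZ N.subset] N(4) by simp
      then have "N \<subseteq> P" using Pmax N(1) by blast
      then show False using N(2,3) unfolding Z_def by blast
    next
      case False
      let ?N = "G\<lparr>carrier := N\<rparr>"
      interpret NG: group ?N by (rule N.subgroup_is_group[OF is_group])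
      let ?R = "{g \<in> N. \<exists>n. coprime p n \<and> g [^] n = \<one>}"
      have "subgroup {g \<in> carrier ?N. \<exists>n::nat. coprime p n \<and> g [^]\<^bsub>?N\<^esub> n = \<one>\<^bsub>?N\<^esub>} ?N"
      proof (rule NG.central_p_complement[OF _ p])
        show "finite (carrier ?N)" using subgroup_pos_card[OF fin N.subgroup_axioms] by simp
        show "subgroup Z ?N" using subgroup_incl[OF normal_inD(1)[OF nZ] N.subgroup_axioms] N(2) by blast
        show "z \<otimes>\<^bsub>?N\<^esub> g = g \<otimes>\<^bsub>?N\<^esub> z" if "z \<in> Z" "g \<in> carrier ?N" for z g
          using that N(3) unfolding Z_def C_def centralizer_of_def by auto
        show "pi_section ?N p False (carrier ?N) Z" "pi_section ?N p True Z {\<one>\<^bsub>?N\<^esub>}" using N(4) False sZ by simp_all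
      qed
      moreover have "{g \<in> carrier ?N. \<exists>n::nat. coprime p n \<and> g [^]\<^bsub>?N\<^esub> n = \<one>\<^bsub>?N\<^esub>} = ?R"
        by (simp add: nat_pow_def)
      ultimately have sR: "subgroup ?R G" using incl_subgroup[OF N.subgroup_axioms] by simp
      have "normal_in ?R (carrier G)"
        unfolding normal_in_def
      proof (intro conjI ballI sR)
        show "?R \<subseteq> carrier G" by auto
        fix h x assume h: "h \<in> carrier G" and x: "x \<in> ?R"
        then obtain n where n: "coprime p n" "x [^] n = \<one>" "x \<in> N" by blast
        interpret f: group_hom G G "\<lambda>x. h \<otimes> x \<otimes> inv h" by (rule conj_hom[OF h])
        have "(h \<otimes> x \<otimes> inv h) [^] n = h \<otimes> x [^] n \<otimes> inv h" using f.hom_nat_pow[of x n] n(3) by simp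
        then have "(h \<otimes> x \<otimes> inv h) [^] n = \<one>" using n h by simp
        moreover have "h \<otimes> x \<otimes> inv h \<in> N" using N(1) h n(3) unfolding normal_inv_iff by blast
        ultimately show "h \<otimes> x \<otimes> inv h \<in> ?R" using n(1) by blast
      qed
      moreover have "pi_section G p False ?R {\<one>}" unfolding pi_section_def pi_number_def by simp
      ultimately have "?R \<subseteq> core p False (carrier G) {\<one>}"
        using core_max[of ?R "carrier G" "{\<one>}"] subgroup.one_closed[OF sR] by blast
      then have R1: "?R \<subseteq> {\<one>}" using O by simp
      have "N \<subseteq> Z"
      proof
        fix x assume x: "x \<in> N"
        then obtain n where n: "coprime p n" "x [^] n \<in> Z" using N(4) False unfolding pi_section_def pi_number_def by auto
        then obtain k where k: "(x [^] n) [^] (p ^ k) = \<one>" using sZ unfolding pi_section_def pi_number_def by auto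
        have xG: "x \<in> carrier G" using x by simp
        have "(x [^] (p ^ k)) [^] n = \<one>" using k xG by (simp add: nat_pow_pow mult.commute)
        then have "x [^] (p ^ k) \<in> ?R" using n(1) subgroup_pow[OF N.subgroup_axioms x] by blast
        then have "x [^] (p ^ k) = \<one>" using R1 by blast
        then have "x [^] (p ^ k) \<in> Z" using subgroup.one_closed[OF normal_inD(1)[OF nZ]] by simp
        moreover have "coprime n (p ^ k)" using n(1) by (simp add: coprime_commute)
        ultimately show "x \<in> Z" using coprime_pow_mem[OF normal_inD(1)[OF nZ] xG n(2)] by blast
      qed
      with N(2) show False by blast
    qed
  qed
  moreover have "g \<in> C" unfolding C_def centralizer_of_def using g cen unfolding P_def by blast
  ultimately show ?thesis unfolding P_def by blast
qed

end

section \<open>Factorizations through centralizers of Sylow subgroups\<close>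

context group
begin

lemma pi_section_card:
  assumes fin: "finite (carrier G)" and p: "Factorial_Ring.prime p" and H: "subgroup H G" and K: "normal_in K H"
    and s: "pi_section G p s H K"
  shows "\<exists>m. card H = m * card K \<and> pi_number p s m"
proof -
  interpret HG: group "G\<lparr>carrier := H\<rparr>" by (rule subgroup.subgroup_is_group[OF H is_group])
  have K': "K \<lhd> G\<lparr>carrier := H\<rparr>" using normal_in_restrict[OF H] K by blast
  have "pi_number p s (card (rcosets\<^bsub>G\<lparr>carrier := H\<rparr>\<^esub> K))"
    by (rule HG.pi_section_index[OF _ K' p]) (use s subgroup_pos_card[OF fin H] in simp_all)
  moreover have "card (rcosets\<^bsub>G\<lparr>carrier := H\<rparr>\<^esub> K) * card K = card H"
    using HG.lagrange[OF normal_imp_subgroup[OF K']] by (simp add: order_def)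
  ultimately show ?thesis by metis
qed

text \<open>The index of the product in \<open>H\<close> is a power of \<open>p\<close>, as it
  contains \<open>K\<close>, and prime to \<open>p\<close>, as it contains \<open>S\<close>.\<close>

lemma sylow_in_supplement:
  assumes fin: "finite (carrier G)" and p: "Factorial_Ring.prime p" and H: "subgroup H G" and K: "normal_in K H"
    and s: "pi_section G p True H K" and S: "sylow_in p S H"
  shows "K <#> S = H"
proof -
  have sS: "subgroup S G" "S \<subseteq> H" using S unfolding sylow_in_def by blast+
  obtain k m where km: "card S = p ^ k" "card H = p ^ k * m" "\<not> p dvd m" using S unfolding sylow_in_def by blast
  note L = normal_in_mult_subgroup[OF fin H K sS]
  note cH = subgroup_pos_card[OF fin H]
  obtain a where a: "card H = card (K <#> S) * a" using subgroup_dvd[OF fin H L(1,4)] by blast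
  obtain c where c: "card (K <#> S) = card S * c" using subgroup_dvd[OF fin L(1) sS(1) L(3)] by blast
  obtain d where d: "card (K <#> S) = card K * d" using subgroup_dvd[OF fin L(1) normal_inD(1)[OF K] L(2)] by blast
  obtain e where e: "card H = p ^ e * card K" using pi_section_card[OF fin p H K s] unfolding pi_number_def by auto
  have "p ^ k * m = p ^ k * (c * a)" using km(1,2) a[unfolded c] by (simp only: mult.assoc)
  then have m: "m = c * a" using prime_gt_0_nat[OF p] by (metis mult_left_cancel not_gr_zero power_not_zero)
  have "card K * (d * a) = card H" using a[unfolded d] by (simp only: mult.assoc)
  also have "\<dots> = card K * p ^ e" using e by (simp only: mult.commute)
  finally have "card K * (d * a) = card K * p ^ e" .
  then have "d * a = p ^ e" using subgroup_pos_card(1)[OF fin normal_inD(1)[OF K]] by (metis mult_left_cancel not_gr_zero)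
  then have "a dvd p ^ e" by (metis dvd_triv_right)
  then obtain i where i: "a = p ^ i" using divides_primepow_nat[OF p] by blast
  have "i = 0"
  proof (rule ccontr)
    assume "i \<noteq> 0"
    then have "p dvd a" using i by simp
    with km(3) m show False by simp
  qed
  then have "card (K <#> S) = card H" using a i by simp
  then show ?thesis by (rule card_subset_eq[OF cH(2) L(4)])
qed

lemma pi_section_Int:
  assumes "subgroup L G" "subgroup M G" "pi_section G p s S L" "pi_section G p s S M" "S \<subseteq> carrier G"
  shows "pi_section G p s S (L \<inter> M)"
  unfolding pi_section_def
proof
  fix g assume g: "g \<in> S"
  then have gG: "g \<in> carrier G" using assms(5) by blast
  obtain m where m: "pi_number p s m" "g [^] m \<in> L" using assms(3) g unfolding pi_section_def by blast
  obtain n where n: "pi_number p s n" "g [^] n \<in> M" using assms(4) g unfolding pi_section_def by blast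
  have "g [^] (m * n) \<in> L" using subgroup_pow[OF assms(1) m(2), of n] gG by (simp add: nat_pow_pow)
  moreover have "g [^] (m * n) \<in> M" using subgroup_pow[OF assms(2) n(2), of m] gG by (simp add: nat_pow_pow mult.commute)
  ultimately show "\<exists>n. pi_number p s n \<and> g [^] n \<in> L \<inter> M" using m n pi_number_mult by blast
qed

text \<open>The factor \<open>carrier G\<close> gives the empty intersection its intended
  value.\<close>

lemma pi_section_Inter:
  assumes "finite I" "S \<subseteq> carrier G" "\<And>i. i \<in> I \<Longrightarrow> subgroup (L i) G" "\<And>i. i \<in> I \<Longrightarrow> pi_section G p s S (L i)"
  shows "pi_section G p s S (carrier G \<inter> (\<Inter>i\<in>I. L i)) \<and> subgroup (carrier G \<inter> (\<Inter>i\<in>I. L i)) G"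
  using assms(1,3,4)
proof (induction I rule: finite_induct)
  case empty
  then show ?case using pi_section_mono[OF pi_section_refl[OF assms(2)] order_refl assms(2)] subgroup_self by simp
next
  case (insert i F)
  let ?M = "carrier G \<inter> (\<Inter>i\<in>F. L i)"
  have IH: "pi_section G p s S ?M" "subgroup ?M G" using insert by blast+
  have "carrier G \<inter> (\<Inter>j\<in>insert i F. L j) = L i \<inter> ?M" by blast
  then show ?case
    using pi_section_Int[OF insert.prems(1) IH(2) insert.prems(2) IH(1) assms(2), of i]
      subgroups_Inter_pair[OF insert.prems(1) IH(2), of i] by simp
qed

text \<open>The product is normalized by \<open>K\<close>, which it contains, and by
  \<open>N\<close>, which normalizes both factors.\<close>

lemma normal_in_supplement:
  assumes fin: "finite (carrier G)" and K: "normal_in K (carrier G)" and N: "subgroup N G" and Y: "normal_in Y N"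
    and KN: "\<And>g. g \<in> carrier G \<Longrightarrow> \<exists>k\<in>K. \<exists>n\<in>N. g = k \<otimes> n"
  shows "normal_in (K <#> Y) (carrier G)"
proof -
  interpret K: subgroup K G by (rule normal_inD(1)[OF K])
  interpret N: subgroup N G by fact
  interpret Y: subgroup Y G by (rule normal_inD(1)[OF Y])
  note m = normal_in_mult_subgroup[OF fin subgroup_self K Y.subgroup_axioms Y.subset]
  have "g \<otimes> x \<otimes> inv g \<in> K <#> Y" if g: "g \<in> carrier G" and x: "x \<in> K <#> Y" for g x
  proof -
    obtain k n where kn: "k \<in> K" "n \<in> N" "g = k \<otimes> n" using KN[OF g] by blast
    obtain a b where ab: "a \<in> K" "b \<in> Y" "x = a \<otimes> b" using x unfolding set_mult_def by blast
    have 1: "n \<otimes> a \<otimes> inv n \<in> K <#> Y" using normal_inD(3)[OF K, of n a] kn ab m(2) by auto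
    have 2: "n \<otimes> b \<otimes> inv n \<in> K <#> Y" using normal_inD(3)[OF Y kn(2) ab(2)] m(3) by blast
    have 3: "k \<in> K <#> Y" "inv k \<in> K <#> Y" using kn(1) m(2) K.m_inv_closed by blast+
    have "k \<otimes> ((n \<otimes> a \<otimes> inv n) \<otimes> (n \<otimes> b \<otimes> inv n)) \<otimes> inv k \<in> K <#> Y"
      by (intro subgroup.m_closed[OF m(1)] 1 2 3)
    moreover have "k \<otimes> ((n \<otimes> a \<otimes> inv n) \<otimes> (n \<otimes> b \<otimes> inv n)) \<otimes> inv k = g \<otimes> x \<otimes> inv g"
      using kn ab by (simp add: m_assoc inv_mult_group)
    ultimately show ?thesis by simp
  qed
  then show ?thesis unfolding normal_in_def using m by blast
qed

lemma pi_section_supplement: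
  assumes K: "normal_in K (carrier G)" and N: "N \<subseteq> carrier G" and s: "pi_section G p s N Y"
  shows "pi_section G p s (K <#> N) (K <#> Y)"
  unfolding pi_section_def
proof
  fix g assume "g \<in> K <#> N"
  then obtain a b where ab: "a \<in> K" "b \<in> N" "g = a \<otimes> b" unfolding set_mult_def by blast
  then obtain n where n: "pi_number p s n" "b [^] n \<in> Y" using s unfolding pi_section_def by blast
  obtain z where "z \<in> K" "g [^] n = z \<otimes> b [^] n"
    using mult_pow_mod[OF subgroup_self K ab(1), of b n] ab N by blast
  then show "\<exists>n. pi_number p s n \<and> g [^] n \<in> K <#> Y"
    using n unfolding set_mult_def by blast
qed

lemma generated_normal_in:
  assumes "S \<subseteq> carrier G" and "\<And>g s. g \<in> carrier G \<Longrightarrow> s \<in> S \<Longrightarrow> g \<otimes> s \<otimes> inv g \<in> generate G S"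
  shows "normal_in (generate G S) (carrier G)"
  unfolding normal_in_def using generate_is_subgroup[OF assms(1)] generate_incl[OF assms(1)] generate_conj[OF assms(1)] assms(2)
  by blast

lemma normal_in_Int_subgroup:
  assumes N: "normal_in N H" and C: "subgroup C G" "C \<subseteq> H"
  shows "normal_in (N \<inter> C) C"
proof -
  interpret C: subgroup C G by fact
  have "h \<otimes> n \<otimes> inv h \<in> N \<inter> C" if "h \<in> C" "n \<in> N \<inter> C" for h n
    using normal_inD(3)[OF N, of h n] that C(2) by auto
  then show ?thesis
    unfolding normal_in_def using subgroups_Inter_pair[OF normal_inD(1)[OF N] C(1)] by blast
qed

lemma frattini:
  assumes fin: "finite (carrier G)" and K: "normal_in K (carrier G)" and q: "Factorial_Ring.prime q" and T: "sylow_in q T K"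
    and g: "g \<in> carrier G"
  shows "\<exists>k\<in>K. \<exists>n\<in>normalizer_of T. g = k \<otimes> n"
proof -
  interpret K: subgroup K G by (rule normal_inD(1)[OF K])
  have TG: "T \<subseteq> carrier G" using T K.subset unfolding sylow_in_def by blast
  have "conj_set g K \<subseteq> K" unfolding conj_set_def using normal_inD(3)[OF K g] by blast
  then have "sylow_in q (conj_set g T) K" using sylow_in_conj_set[OF K.subgroup_axioms T g] by blast
  then obtain h where h: "h \<in> K" "conj_set h T = conj_set g T" using sylow_in_conjugate[OF fin K.subgroup_axioms q T] by blast
  have hG: "h \<in> carrier G" using h by simp
  have "conj_set (inv h \<otimes> g) T = conj_set (inv h) (conj_set g T)" using conj_set_conj_set[OF _ g TG, of "inv h"] hG by simp
  also have "\<dots> = conj_set (inv h \<otimes> h) T" unfolding h(2)[symmetric] using conj_set_conj_set[OF _ hG TG, of "inv h"] hG by simp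
  also have "\<dots> = T" using hG conj_set_one[OF TG] by simp
  finally have "conj_set (inv h \<otimes> g) T = T" .
  then have "inv h \<otimes> g \<in> normalizer_of T" unfolding normalizer_of_def conj_set_def using hG g by auto
  moreover have "g = h \<otimes> (inv h \<otimes> g)" using hG g by simp
  ultimately show ?thesis using h(1) by blast
qed

text \<open>A section \<open>N0 / K\<close> that is a \<open>p\<close>-group and is covered by the centralizers of Sylow
  subgroups of \<open>K\<close> has a Sylow \<open>p\<close>-subgroup acting trivially on \<open>K / P\<close>, which is therefore normal.\<close>

lemma covered_section_trivial:
  assumes fin: "finite (carrier G)" and p: "Factorial_Ring.prime p"
  defines "P \<equiv> core p True (carrier G) {\<one>}"
  defines "K \<equiv> core p False (carrier G) P"
  assumes N0: "normal_in N0 (carrier G)" "K \<subseteq> N0" "pi_section G p True N0 K"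
    and cov: "\<And>q. Factorial_Ring.prime q \<Longrightarrow> q dvd card K \<Longrightarrow> q \<noteq> p \<Longrightarrow> \<exists>T. sylow_in q T K \<and> N0 \<subseteq> K <#> centralizer_of T"
  shows "N0 \<subseteq> K"
proof -
  have P: "normal_in P (carrier G)" "pi_section G p True P {\<one>}" unfolding P_def using one_core[OF fin] normal_in_carrier by blast+
  note K = core_props[OF fin subgroup_self P(1), of p False, folded K_def]
  interpret P: subgroup P G by (rule normal_inD(1)[OF P(1)])
  interpret K: subgroup K G by (rule normal_inD(1)[OF K(1)])
  interpret N: subgroup N0 G by (rule normal_inD(1)[OF N0(1)])
  have KN: "normal_in K N0" using K(1) N0(2) unfolding normal_in_def using N.subset by blast
  have PK: "normal_in P K" using P(1) K(2) unfolding normal_in_def using K.subset by blast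
  obtain S where S: "sylow_in p S N0" using sylow_in_exists[OF fin N.subgroup_axioms p] by blast
  have sS: "subgroup S G" "S \<subseteq> N0" using S unfolding sylow_in_def by blast+
  interpret S: subgroup S G by fact
  have KS: "K <#> S = N0" by (rule sylow_in_supplement[OF fin p N.subgroup_axioms KN N0(3) S])
  have Sp: "pi_section G p True S {\<one>}"
    using S pi_section_one_card[OF fin sS(1) p, of True] unfolding sylow_in_def pi_number_def by auto
  \<comment> \<open>A conjugate of the \<open>p\<close>-subgroup \<open>P\<close> lies in
    \<open>S\<close>, and \<open>P\<close> is normal.\<close>
  have PS: "P \<subseteq> S"
  proof -
    obtain i where "card P = p ^ i" using pi_section_one_card[OF fin P.subgroup_axioms p, of True] P(2) unfolding pi_number_def by auto
    then obtain h where h: "h \<in> N0" "conj_set h P \<subseteq> S"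
      using sylow_in_absorbs[OF fin N.subgroup_axioms p S P.subgroup_axioms _] K(2) N0(2) by blast
    have "conj_set h P = P" unfolding conj_set_def by (rule conj_image[OF fin subgroup_self P(1)]) (use h in simp)
    with h(2) show ?thesis by simp
  qed
  \<comment> \<open>The part of \<open>K\<close> on which \<open>S\<close> acts trivially modulo
    \<open>P\<close>; it is compared with \<open>K\<close> one prime at a time.\<close>
  let ?E = "{k \<in> K. \<forall>x\<in>S. x \<otimes> k \<otimes> inv x \<otimes> inv k \<in> P}"
  have sE: "subgroup ?E G"
  proof (rule subgroup_finI[OF fin])
    show "?E \<noteq> {}" by (auto intro!: exI[of _ \<one>])
    fix a b assume ab: "a \<in> ?E" "b \<in> ?E"
    have "x \<otimes> (a \<otimes> b) \<otimes> inv x \<otimes> inv (a \<otimes> b) \<in> P" if x: "x \<in> S" for x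
    proof -
      have aG: "a \<in> carrier G" using ab by auto
      have 1: "x \<otimes> a \<otimes> inv x \<otimes> inv a \<in> P" using ab x by blast
      have 2: "a \<otimes> (x \<otimes> b \<otimes> inv x \<otimes> inv b) \<otimes> inv a \<in> P" by (rule normal_inD(3)[OF P(1) aG]) (use ab x in blast)
      from P.m_closed[OF 1 2] show ?thesis using ab x by (simp add: m_assoc inv_mult_group)
    qed
    then show "a \<otimes> b \<in> ?E" using ab by simp
  qed (use K.subset in blast)
  have "?E = K"
  proof (rule subgroup_eq_of_sylow_in[OF fin K.subgroup_axioms sE])
    fix q assume q: "Factorial_Ring.prime q" "q dvd card K"
    show "\<exists>T. sylow_in q T K \<and> T \<subseteq> ?E"
    proof (cases "q = p")
      case True
      obtain m where m: "card K = m * card P" "coprime p m"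
        using pi_section_card[OF fin p K.subgroup_axioms PK K(3)] unfolding pi_number_def by auto
      obtain i where "card P = p ^ i" using pi_section_one_card[OF fin P.subgroup_axioms p, of True] P(2) unfolding pi_number_def by auto
      moreover have "\<not> p dvd m" using m(2) p by (metis coprime_absorb_left not_prime_unit)
      ultimately have "sylow_in p P K" unfolding sylow_in_def using m(1) K(2) P.subgroup_axioms by (auto simp: mult.commute)
      moreover have "P \<subseteq> ?E"
      proof
        fix k assume k: "k \<in> P"
        have "x \<otimes> k \<otimes> inv x \<otimes> inv k \<in> P" if "x \<in> S" for x
          using normal_inD(3)[OF P(1) _ k, of x] that k by simp
        then show "k \<in> ?E" using k K(2) by blast
      qed
      ultimately show ?thesis using True by blast
    next
      case False
      obtain T where T: "sylow_in q T K" "N0 \<subseteq> K <#> centralizer_of T" using cov[OF q False] by blast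
      have TK: "subgroup T G" "T \<subseteq> K" using T(1) unfolding sylow_in_def by blast+
      have TG: "T \<subseteq> carrier G" using TK(2) K.subset by blast
      let ?C = "N0 \<inter> centralizer_of T"
      have sC: "subgroup ?C G" by (rule subgroups_Inter_pair[OF N.subgroup_axioms centralizer_of_subgroup[OF fin TG]])
      obtain Y where Y: "sylow_in p Y ?C" using sylow_in_exists[OF fin sC p] by blast
      have sY: "subgroup Y G" "Y \<subseteq> ?C" using Y unfolding sylow_in_def by blast+
      obtain j where j: "card Y = p ^ j" using Y unfolding sylow_in_def by blast
      have nKC: "normal_in (K \<inter> ?C) ?C"
        by (rule normal_in_Int_subgroup[OF KN sC]) blast
      have "pi_section G p True ?C (K \<inter> ?C)"
        unfolding pi_section_def
      proof
        fix g assume g: "g \<in> ?C"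
        then obtain n where "pi_number p True n" "g [^] n \<in> K" using N0(3) unfolding pi_section_def by blast
        then show "\<exists>n. pi_number p True n \<and> g [^] n \<in> K \<inter> ?C" using subgroup_pow[OF sC g] by blast
      qed
      then have CY: "(K \<inter> ?C) <#> Y = ?C" by (rule sylow_in_supplement[OF fin p sC nKC _ Y])
      \<comment> \<open>A Sylow \<open>p\<close>-subgroup of the centralizer of \<open>T\<close> in
        \<open>N0\<close> already covers \<open>N0\<close> modulo \<open>K\<close>, because the rest
        of that centralizer lies in \<open>K\<close>.\<close>
      have NKY: "\<exists>k\<in>K. \<exists>y\<in>Y. g = k \<otimes> y" if g: "g \<in> N0" for g
      proof -
        obtain k c where kc: "k \<in> K" "c \<in> centralizer_of T" "g = k \<otimes> c" using T(2) g unfolding set_mult_def by blast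
        have cG: "c \<in> carrier G" using kc(2) unfolding centralizer_of_def by blast
        have "c \<in> N0" using subgroup_cancel_left[OF N.subgroup_axioms _ cG, of k] kc g N0(2) by blast
        then have "c \<in> (K \<inter> ?C) <#> Y" unfolding CY using kc(2) by blast
        then obtain k' y where k': "k' \<in> K" "y \<in> Y" "c = k' \<otimes> y" unfolding set_mult_def by blast
        have yG: "y \<in> carrier G" using k'(2) sY(1) subgroup.mem_carrier by metis
        have "g = (k \<otimes> k') \<otimes> y" using kc k' yG by (simp add: m_assoc)
        then show ?thesis using kc(1) k' K.m_closed by blast
      qed
      have "Y \<subseteq> N0" using sY(2) by blast
      then obtain h where h: "h \<in> N0" "conj_set h Y \<subseteq> S" using sylow_in_absorbs[OF fin N.subgroup_axioms p S sY(1) _ j] by blast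
      have hG: "h \<in> carrier G" using h(1) by simp
      have "sylow_in q (conj_set h T) K"
        by (rule sylow_in_conj_set[OF K.subgroup_axioms T(1) hG]) (use normal_inD(3)[OF K(1) hG] in \<open>auto simp: conj_set_def\<close>)
      moreover have "conj_set h T \<subseteq> ?E"
      proof
        fix u assume "u \<in> conj_set h T"
        then obtain t where t: "t \<in> T" "u = h \<otimes> t \<otimes> inv h" unfolding conj_set_def by blast
        have tG: "t \<in> carrier G" using t TG by blast
        have uK: "u \<in> K" using t normal_inD(3)[OF K(1) hG, of t] TK(2) by blast
        have uG: "u \<in> carrier G" using uK by simp
        have "x \<otimes> u \<otimes> inv x \<otimes> inv u \<in> P" if x: "x \<in> S" for x
        proof -
          have xG: "x \<in> carrier G" using x by simp
          have "inv h \<otimes> x \<otimes> h \<in> N0" using h(1) x sS(2) by auto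
          then obtain k y where ky: "k \<in> K" "y \<in> Y" "inv h \<otimes> x \<otimes> h = k \<otimes> y" using NKY by blast
          have kG: "k \<in> carrier G" and yG: "y \<in> carrier G" using ky subgroup.mem_carrier[OF sY(1)] by auto
          define k' where "k' = h \<otimes> k \<otimes> inv h"
          define y' where "y' = h \<otimes> y \<otimes> inv h"
          have x': "x = k' \<otimes> y'"
          proof -
            have "x = h \<otimes> (inv h \<otimes> x \<otimes> h) \<otimes> inv h" using hG xG by (simp add: m_assoc)
            also have "\<dots> = k' \<otimes> y'" unfolding ky(3) k'_def y'_def using hG kG yG by (simp add: m_assoc)
            finally show ?thesis .
          qed
          have y'S: "y' \<in> S" using h(2) ky(2) unfolding y'_def conj_set_def by blast
          have k'K: "k' \<in> K" unfolding k'_def by (rule normal_inD(3)[OF K(1) hG ky(1)])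
          have k'G: "k' \<in> carrier G" using k'K by simp
          \<comment> \<open>\<open>x\<close> and \<open>y'\<close> lie in \<open>S\<close>, so
            \<open>k'\<close> is an element of \<open>K\<close> of \<open>p\<close>-power order. As
            K / P is a p'-group it lies in \<open>P\<close>, while \<open>y'\<close> centralizes the
            conjugated Sylow subgroup.\<close>
          have "k' \<in> S" using subgroup_cancel_right[OF sS(1) k'G y'S] x x' by simp
          then obtain n where n: "pi_number p True n" "k' [^] n = \<one>" using Sp unfolding pi_section_def by blast
          have k'P: "k' \<in> P"
            by (rule pi_section_opposite[OF K(3) P.subgroup_axioms K.subset k'K]) (use n in auto)
          have "y \<otimes> t = t \<otimes> y" using ky(2) t(1) sY(2) unfolding centralizer_of_def by blast
          then have yt: "y \<otimes> t \<otimes> inv y = t" using yG tG by (simp add: m_assoc)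
          have y'u: "y' \<otimes> u \<otimes> inv y' = u"
          proof -
            have "y' \<otimes> u \<otimes> inv y' = h \<otimes> (y \<otimes> t \<otimes> inv y) \<otimes> inv h"
              unfolding y'_def t(2) using hG yG tG by (simp add: m_assoc inv_mult_group)
            then show ?thesis unfolding yt t(2) .
          qed
          have y'G: "y' \<in> carrier G" using y'S by simp
          have "x \<otimes> u \<otimes> inv x \<otimes> inv u = k' \<otimes> (y' \<otimes> u \<otimes> inv y') \<otimes> inv k' \<otimes> inv u"
            unfolding x' using k'G y'G uG by (simp add: m_assoc inv_mult_group)
          also have "\<dots> = k' \<otimes> (u \<otimes> inv k' \<otimes> inv u)" unfolding y'u using k'G uG by (simp add: m_assoc)
          also have "\<dots> \<in> P"
            by (rule P.m_closed[OF k'P normal_inD(3)[OF P(1) uG P.m_inv_closed[OF k'P]]])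
          finally show ?thesis .
        qed
        then show "u \<in> ?E" using uK by blast
      qed
      ultimately show ?thesis by blast
    qed
  qed blast
  then have E: "x \<otimes> k \<otimes> inv x \<otimes> inv k \<in> P" if "k \<in> K" "x \<in> S" for k x using that by blast
  have "normal_in S N0"
    unfolding normal_in_def
  proof (intro conjI ballI sS)
    fix g x assume g: "g \<in> N0" and x: "x \<in> S"
    obtain k y where ky: "k \<in> K" "y \<in> S" "g = k \<otimes> y" using g unfolding KS[symmetric] set_mult_def by blast
    define z where "z = y \<otimes> x \<otimes> inv y"
    have zS: "z \<in> S" unfolding z_def using ky(2) x by simp
    have "inv (z \<otimes> k \<otimes> inv z \<otimes> inv k) \<otimes> z \<in> S" 
      by (rule S.m_closed[OF S.m_inv_closed[OF subsetD[OF PS E[OF ky(1) zS]]] zS])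
    moreover have "inv (z \<otimes> k \<otimes> inv z \<otimes> inv k) \<otimes> z = k \<otimes> z \<otimes> inv k"
      using zS ky(1) by (simp add: m_assoc inv_mult_group)
    moreover have "k \<otimes> z \<otimes> inv k = g \<otimes> x \<otimes> inv g" unfolding z_def using ky x by (simp add: m_assoc inv_mult_group)
    ultimately show "g \<otimes> x \<otimes> inv g \<in> S" by simp
  qed
  then have "S \<subseteq> core p True N0 {\<one>}" using core_max[OF _ _ Sp] S.one_closed by blast
  moreover have "core p True N0 {\<one>} \<subseteq> P"
    unfolding P_def
  proof (rule core_max)
    show "normal_in (core p True N0 {\<one>}) (carrier G)"
      by (rule core_normal_in[OF fin subgroup_self N0(1) normal_in_one[OF subgroup_self]]) simp
    show "{\<one>} \<subseteq> core p True N0 {\<one>}" "pi_section G p True (core p True N0 {\<one>}) {\<one>}"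
      using core_props[OF fin N.subgroup_axioms normal_in_one[OF N.subgroup_axioms]] by blast+
  qed
  ultimately have "S \<subseteq> K" using K(2) by blast
  then show ?thesis unfolding KS[symmetric] set_mult_def using K.m_closed by blast
qed

end

section \<open>Quotients\<close>

context finite_good_action
begin

lemma comm_with_normal_in: assumes x: "x \<in> carrier A" shows "G.normal_in (comm_with x) (carrier G)"
  unfolding comm_with_def
proof (rule G.generated_normal_in)
  let ?S = "{inv g \<otimes> phi x g |g. g \<in> carrier G}"
  show SG: "?S \<subseteq> carrier G" using x by auto
  fix g s assume g: "g \<in> carrier G" and "s \<in> ?S"
  then obtain h where h: "h \<in> carrier G" "s = inv h \<otimes> phi x h" by blast
  have in1: "inv k \<otimes> phi x k \<in> generate G ?S" if "k \<in> carrier G" for k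
    by (rule generate.incl) (use that in blast)
  have sg: "subgroup (generate G ?S) G" by (rule G.generate_is_subgroup[OF SG])
  \<comment> \<open>The conjugate by \<open>g\<close> of the displacement of \<open>h\<close> is the
    quotient of the displacements of \<open>h\<close> times the inverse of \<open>g\<close> and of
    the inverse of \<open>g\<close>.\<close>
  have "(inv (h \<otimes> inv g) \<otimes> phi x (h \<otimes> inv g)) \<otimes> inv (inv (inv g) \<otimes> phi x (inv g)) \<in> generate G ?S"
    by (intro subgroup.m_closed[OF sg] subgroup.m_inv_closed[OF sg] in1) (use g h in auto)
  moreover have "(inv (h \<otimes> inv g) \<otimes> phi x (h \<otimes> inv g)) \<otimes> inv (inv (inv g) \<otimes> phi x (inv g)) = g \<otimes> s \<otimes> inv g"
    using g h x by (simp add: phi_mult phi_inv G.m_assoc G.inv_mult_group)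
  ultimately show "g \<otimes> s \<otimes> inv g \<in> generate G ?S" by simp
qed

lemma comm_with_supplement:
  assumes x: "x \<in> carrier A" and g: "g \<in> carrier G"
  shows "\<exists>k\<in>comm_with x. \<exists>n\<in>fixed_pts x. g = k \<otimes> n"
proof -
  note nC = comm_with_normal_in[OF x]
  note m = G.normal_in_mult_subgroup[OF finG G.subgroup_self nC fixed_pts_subgroup[OF x] subgroup.subset[OF fixed_pts_subgroup[OF x]]]
  have "carrier G \<subseteq> comm_with x <#> fixed_pts x"
  proof (rule good_gen[OF x G.subgroup_self phi_closed[OF x] m(1)])
    fix h assume h: "h \<in> carrier G"
    have "inv h \<otimes> phi x h \<in> comm_with x" unfolding comm_with_def by (rule generate.incl) (use h in blast)
    then show "inv h \<otimes> phi x h \<in> comm_with x <#> fixed_pts x" using m(2) by blast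
    assume "phi x h = h"
    then show "h \<in> comm_with x <#> fixed_pts x" using m(3) h unfolding fixed_pts_def by blast
  qed
  then show ?thesis using g unfolding set_mult_def by blast
qed

text \<open>By goodness G / [G,x] is an image of the fixed points of \<open>x\<close>, so the
  product of [G,x] with their p-complement \<open>R\<close> gives its p-complement.\<close>

lemma comm_with_section:
  assumes x: "x \<in> carrier A" and R: "G.normal_in R (fixed_pts x)" "pi_section G p False R {\<one>}" "pi_section G p True (fixed_pts x) R"
  shows "\<exists>Y. G.normal_in Y (carrier G) \<and> pi_section G p True (carrier G) Y \<and> pi_section G p False Y (comm_with x)"
proof -
  note nC = comm_with_normal_in[OF x]
  interpret C: subgroup "comm_with x" G by (rule G.normal_inD(1)[OF nC])
  have carr: "comm_with x <#> fixed_pts x = carrier G"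
    using comm_with_supplement[OF x] subgroup.mem_carrier[OF fixed_pts_subgroup[OF x]] unfolding set_mult_def by auto
  have "comm_with x <#> {\<one>} = comm_with x" unfolding set_mult_def using C.mem_carrier by auto
  then have "pi_section G p False (comm_with x <#> R) (comm_with x)"
    using G.pi_section_supplement[OF nC subgroup.subset[OF G.normal_inD(1)[OF R(1)]] R(2)] by simp
  moreover have "pi_section G p True (carrier G) (comm_with x <#> R)"
    using G.pi_section_supplement[OF nC subgroup.subset[OF fixed_pts_subgroup[OF x]] R(3)] carr by simp
  moreover have "G.normal_in (comm_with x <#> R) (carrier G)"
    by (rule G.normal_in_supplement[OF finG nC fixed_pts_subgroup[OF x] R(1) comm_with_supplement[OF x]])
  ultimately show ?thesis by blast
qed

end

section \<open>Action on r-groups, and commutation of fixed p'- and p-elements\<close>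

context rank_two_action
begin

text \<open>[H,A] is proper in \<open>H\<close>, so by induction \<open>A\<close> fixes it
  pointwise; goodness then writes \<open>H\<close> as a product of two groups of fixed
  points.\<close>

lemma trivial_on_r_group:
  assumes "A_invariant H" "card H = r ^ k" "a \<in> carrier A" "h \<in> H"
  shows "phi a h = h"
  using assms
proof (induction "card H" arbitrary: H k a h rule: less_induct)
  case less
  interpret H: subgroup H G by (rule A_invariantD(1)[OF less.prems(1)])
  show ?case
  proof (cases "H = {\<one>}")
    case True then show ?thesis using less.prems by simp
  next
    case False
    let ?H = "G\<lparr>carrier := H\<rparr>" and ?S = "{inv h \<otimes> phi a h |a h. a \<in> carrier A \<and> h \<in> H}"
    interpret HA: rank_two_action ?H A phi r by (rule restrict_rank_two[OF less.prems(1)])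
    have inv: "inv\<^bsub>?H\<^esub> h = inv h" if "h \<in> H" for h using G.m_inv_consistent[OF H.subgroup_axioms that] .
    obtain M where M: "subgroup M ?H" "M \<noteq> H" "\<And>h a. h \<in> H \<Longrightarrow> a \<in> carrier A \<Longrightarrow> inv h \<otimes> phi a h \<in> M"
      using p_group_action_proper[OF A.is_group prime_r order_A HA.G.is_group _ _ HA.aut, of k] less.prems(2) False inv
      by (auto simp: order_def)
    have sM: "subgroup M G" "M \<subseteq> H" using G.incl_subgroup[OF H.subgroup_axioms M(1)] subgroup.subset[OF M(1)] by simp_all
    have finH: "finite H" using G.subgroup_pos_card[OF finG H.subgroup_axioms] by simp
    have SM: "?S \<subseteq> M" using M(3) by blast
    have "?S \<subseteq> carrier G" using SM sM(2) H.subset by blast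
    then have AS: "A_invariant (generate G ?S)"
    proof (rule A_invariant_generate)
      fix b s assume b: "b \<in> carrier A" and "s \<in> ?S"
      then obtain a h where h: "a \<in> carrier A" "h \<in> H" "s = inv h \<otimes> phi a h" by blast
      have "phi b s = inv (phi b h) \<otimes> phi (b \<otimes>\<^bsub>A\<^esub> a \<otimes>\<^bsub>A\<^esub> inv\<^bsub>A\<^esub> b) (phi b h)"
        using b h by (simp add: phi_mult phi_inv phi_comp)
      then show "phi b s \<in> generate G ?S"
        using b h A_invariantD(2)[OF less.prems(1) b] by (intro generate.incl) blast
    qed
    have gM: "generate G ?S \<subseteq> M" by (rule G.generate_subgroup_incl[OF SM sM(1)])
    then have "generate G ?S \<subset> H" using sM(2) M(2) by blast
    then have lt: "card (generate G ?S) < card H" by (rule psubset_card_mono[OF finH])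
    have "card (generate G ?S) dvd r ^ k"
      using G.subgroup_dvd[OF finG H.subgroup_axioms A_invariantD(1)[OF AS] subset_trans[OF gM sM(2)]] less.prems(2) by simp
    then obtain j where j: "card (generate G ?S) = r ^ j" using divides_primepow_nat[OF prime_r] by blast
    let ?D = "{h \<in> carrier G. \<forall>a\<in>carrier A. phi a h = h}"
    have "H \<subseteq> ?D"
    proof (rule good_gen_all[OF less.prems(1)])
      show "subgroup ?D G" by (rule all_fixed_subgroup)
      show "inv h \<otimes> phi a h \<in> ?D" if ah: "a \<in> carrier A" "h \<in> H" for a h
      proof -
        have "inv h \<otimes> phi a h \<in> generate G ?S" by (rule generate.incl) (use ah in blast)
        then have "phi b (inv h \<otimes> phi a h) = inv h \<otimes> phi a h" if "b \<in> carrier A" for b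
          using less.hyps[OF lt AS j that] by blast
        then show ?thesis using ah by simp
      qed
      show "h \<in> ?D" if "h \<in> H" "\<And>a. a \<in> carrier A \<Longrightarrow> phi a h = h" for h using that by simp
    qed
    then show ?thesis using less.prems by blast
  qed
qed

text \<open>The exponent of \<open>t\<close> puts it into the p-complement \<open>R\<close> of the
  fixed points. Its commutator with \<open>h\<close> lies in \<open>P\<close> and in
  \<open>R\<close>, hence has exponents of both kinds and is trivial.\<close>

lemma fixed_commute:
  assumes P: "G.normal_in P (carrier G)" "pi_section G p True P {\<one>}"
    and R: "G.normal_in R (fixed_pts x)" "pi_section G p False R {\<one>}" "pi_section G p True (fixed_pts x) R"
    and t: "t \<in> fixed_pts x" "t [^] (n::nat) = \<one>" "coprime p n" and h: "h \<in> P" "h \<in> fixed_pts x"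
    and x: "x \<in> carrier A"
  shows "t \<otimes> h = h \<otimes> t"
proof -
  interpret P: subgroup P G by (rule G.normal_inD(1)[OF P(1)])
  interpret R: subgroup R G by (rule G.normal_inD(1)[OF R(1)])
  interpret F: subgroup "fixed_pts x" G by (rule fixed_pts_subgroup[OF x])
  have tR: "t \<in> R"
    by (rule G.pi_section_opposite[OF R(3) R.subgroup_axioms F.subset t(1), of n]) (use t in \<open>auto simp: pi_number_def\<close>)
  define c where "c = t \<otimes> h \<otimes> inv t \<otimes> inv h"
  have tG: "t \<in> carrier G" and hG: "h \<in> carrier G" using t(1) h(1) by auto
  have "c \<in> P" unfolding c_def using G.normal_inD(3)[OF P(1) tG h(1)] h(1) by simp
  moreover have "c \<in> R"
  proof -
    have "t \<otimes> (h \<otimes> inv t \<otimes> inv h) \<in> R"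
      by (rule R.m_closed[OF tR G.normal_inD(3)[OF R(1) h(2) R.m_inv_closed[OF tR]]])
    then show ?thesis unfolding c_def using tG hG by (simp add: G.m_assoc)
  qed
  then obtain m where m: "pi_number p False m" "c [^] m = \<one>" using R(2) unfolding pi_section_def by blast
  ultimately have "c \<in> {\<one>}"
    using G.pi_section_opposite[OF P(2) G.triv_subgroup P.subset, of c m] by simp
  then have "c \<otimes> (h \<otimes> t) = h \<otimes> t" using tG hG by simp
  then show ?thesis unfolding c_def using tG hG by (simp add: G.m_assoc)
qed

end

section \<open>Transfer of sections and cores to quotient groups\<close>

context group
begin

definition preimage :: "'a set \<Rightarrow> 'a set set \<Rightarrow> 'a set" where
  "preimage M L = {g \<in> carrier G. M #> g \<in> L}"

lemma quot_hom: assumes M: "M \<lhd> G" shows "group_hom G (G Mod M) (\<lambda>g. M #> g)"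
  by (intro group_hom.intro group_hom_axioms.intro is_group normal.factorgroup_is_group[OF M] normal.r_coset_hom_Mod[OF M])

lemma quot_carrier: "carrier (G Mod M) = (\<lambda>g. M #> g) ` carrier G"
  by (rule carrier_FactGroup)

lemma preimage_subgroup:
  assumes M: "M \<lhd> G" and fin: "finite (carrier G)" and L: "subgroup L (G Mod M)"
  shows "subgroup (preimage M L) G"
proof (rule subgroup_finI[OF fin])
  interpret h: group_hom G "G Mod M" "\<lambda>g. M #> g" by (rule quot_hom[OF M])
  interpret L: subgroup L "G Mod M" by fact
  have "\<one> \<in> preimage M L" unfolding preimage_def using h.hom_one L.one_closed by simp
  then show "preimage M L \<noteq> {}" by blast
  show "preimage M L \<subseteq> carrier G" unfolding preimage_def by blast
  fix x y assume "x \<in> preimage M L" "y \<in> preimage M L"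
  then show "x \<otimes> y \<in> preimage M L" unfolding preimage_def using h.hom_mult[of x y] L.m_closed by simp
qed

lemma preimage_image:
  assumes "L \<subseteq> carrier (G Mod M)" shows "(\<lambda>g. M #> g) ` preimage M L = L"
  using assms unfolding preimage_def quot_carrier by auto

lemma preimage_one: assumes M: "M \<lhd> G" shows "preimage M {M} = M"
  unfolding preimage_def using coset_join1[of M] coset_join2[of _ M] normal_imp_subgroup[OF M] subgroup.subset by blast

lemma preimage_normal:
  assumes M: "M \<lhd> G" and fin: "finite (carrier G)" and L: "L \<lhd> G Mod M"
  shows "preimage M L \<lhd> G"
  unfolding normal_inv_iff
proof (intro conjI ballI preimage_subgroup[OF M fin normal_imp_subgroup[OF L]])
  interpret h: group_hom G "G Mod M" "\<lambda>g. M #> g" by (rule quot_hom[OF M])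
  fix x g assume x: "x \<in> carrier G" and g: "g \<in> preimage M L"
  have gG: "g \<in> carrier G" "M #> g \<in> L" using g unfolding preimage_def by auto
  have "(M #> x) \<otimes>\<^bsub>G Mod M\<^esub> (M #> g) \<otimes>\<^bsub>G Mod M\<^esub> inv\<^bsub>G Mod M\<^esub> (M #> x) \<in> L"
    using L h.H.normal_inv_iff[of L] gG(2) h.hom_closed[OF x] by blast
  moreover have "M #> (x \<otimes> g \<otimes> inv x) = (M #> x) \<otimes>\<^bsub>G Mod M\<^esub> (M #> g) \<otimes>\<^bsub>G Mod M\<^esub> inv\<^bsub>G Mod M\<^esub> (M #> x)"
    using h.hom_mult[of "x \<otimes> g" "inv x"] h.hom_mult[of x g] h.hom_inv[OF x] x gG(1) by simp
  ultimately show "x \<otimes> g \<otimes> inv x \<in> preimage M L" unfolding preimage_def using x gG by simp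
qed

lemma image_normal_in:
  assumes M: "M \<lhd> G" and F: "subgroup F G" and N: "normal_in N F"
  shows "group.normal_in (G Mod M) ((\<lambda>g. M #> g) ` N) ((\<lambda>g. M #> g) ` F)"
proof -
  interpret h: group_hom G "G Mod M" "\<lambda>g. M #> g" by (rule quot_hom[OF M])
  show ?thesis
    unfolding h.H.normal_in_def
  proof (intro conjI ballI h.subgroup_img_is_subgroup[OF normal_inD(1)[OF N]])
    show "(\<lambda>g. M #> g) ` N \<subseteq> (\<lambda>g. M #> g) ` F" using normal_inD(2)[OF N] by blast
    fix a b assume "a \<in> (\<lambda>g. M #> g) ` F" "b \<in> (\<lambda>g. M #> g) ` N"
    then obtain x g where xg: "x \<in> F" "a = M #> x" "g \<in> N" "b = M #> g" by blast
    have G: "x \<in> carrier G" "g \<in> carrier G"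
      using subgroup.mem_carrier[OF F xg(1)] subgroup.mem_carrier[OF normal_inD(1)[OF N] xg(3)] .
    have "M #> (x \<otimes> g \<otimes> inv x) = a \<otimes>\<^bsub>G Mod M\<^esub> b \<otimes>\<^bsub>G Mod M\<^esub> inv\<^bsub>G Mod M\<^esub> a"
      using h.hom_mult[of "x \<otimes> g" "inv x"] h.hom_mult[of x g] h.hom_inv[of x] xg G by simp
    then show "a \<otimes>\<^bsub>G Mod M\<^esub> b \<otimes>\<^bsub>G Mod M\<^esub> inv\<^bsub>G Mod M\<^esub> a \<in> (\<lambda>g. M #> g) ` N"
      using normal_inD(3)[OF N xg(1,3)] by (metis imageI)
  qed
qed

lemma image_normal:
  assumes M: "M \<lhd> G" and N: "N \<lhd> G" shows "(\<lambda>g. M #> g) ` N \<lhd> G Mod M"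
proof -
  interpret h: group_hom G "G Mod M" "\<lambda>g. M #> g" by (rule quot_hom[OF M])
  show ?thesis
    using image_normal_in[OF M subgroup_self, of N] N normal_in_carrier h.H.normal_in_carrier unfolding quot_carrier by simp
qed

lemma image_pi_section:
  assumes M: "M \<lhd> G" and S: "S \<subseteq> carrier G" and s: "pi_section G p s S N"
  shows "pi_section (G Mod M) p s ((\<lambda>g. M #> g) ` S) ((\<lambda>g. M #> g) ` N)"
  unfolding pi_section_def
proof
  fix a assume "a \<in> (\<lambda>g. M #> g) ` S"
  then obtain g where g: "g \<in> S" "a = M #> g" by blast
  then obtain n where n: "pi_number p s n" "g [^] n \<in> N" using s unfolding pi_section_def by blast
  have "a [^]\<^bsub>G Mod M\<^esub> n = M #> (g [^] n)" using coset_pow[OF M, of g n] g S by auto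
  then show "\<exists>n. pi_number p s n \<and> a [^]\<^bsub>G Mod M\<^esub> n \<in> (\<lambda>g. M #> g) ` N" using n by blast
qed

lemma preimage_pi_section:
  assumes M: "M \<lhd> G" and s: "pi_section (G Mod M) p s L L'"
  shows "pi_section G p s (preimage M L) (preimage M L')"
  unfolding pi_section_def
proof
  fix g assume g: "g \<in> preimage M L"
  then have gG: "g \<in> carrier G" "M #> g \<in> L" unfolding preimage_def by auto
  then obtain n where n: "pi_number p s n" "(M #> g) [^]\<^bsub>G Mod M\<^esub> n \<in> L'" using s unfolding pi_section_def by blast
  then have "M #> (g [^] n) \<in> L'" using coset_pow[OF M gG(1), of n] by simp
  then show "\<exists>n. pi_number p s n \<and> g [^] n \<in> preimage M L'" using n(1) gG(1) unfolding preimage_def by auto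
qed

lemma finite_quot: "finite (carrier G) \<Longrightarrow> finite (carrier (G Mod M))"
  unfolding quot_carrier by simp

lemma image_self: assumes M: "M \<lhd> G" shows "(\<lambda>g. M #> g) ` M = {M}"
proof -
  interpret M: subgroup M G by (rule normal_imp_subgroup[OF M])
  have "M #> m = M" if "m \<in> M" for m by (rule coset_join2[OF _ M.subgroup_axioms that]) (use that in simp)
  then have "(\<lambda>g. M #> g) ` M = (\<lambda>g. M) ` M" by (rule image_cong[OF refl])
  then show ?thesis using M.one_closed by (simp add: image_constant)
qed

lemma quotient_p_nilpotent:
  assumes fin: "finite (carrier G)" and p: "Factorial_Ring.prime p" and M: "M \<lhd> G" and K: "K \<lhd> G" 
    and s: "pi_section G p False K M" "pi_section G p True (carrier G) K"
  shows "p_nilpotent p (G Mod M)"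
proof -
  interpret h: group_hom G "G Mod M" "\<lambda>g. M #> g" by (rule quot_hom[OF M])
  have "pi_section (G Mod M) p False ((\<lambda>g. M #> g) ` K) {\<one>\<^bsub>G Mod M\<^esub>}"
    using image_pi_section[OF M subgroup.subset[OF normal_imp_subgroup[OF K]] s(1)] image_self[OF M] by simp
  moreover have "pi_section (G Mod M) p True (carrier (G Mod M)) ((\<lambda>g. M #> g) ` K)"
    using image_pi_section[OF M order_refl s(2)] unfolding quot_carrier .
  ultimately show ?thesis
    using h.H.p_nilpotent_iff[OF finite_quot[OF fin] p] image_normal[OF M K] by blast
qed

lemma quotient_p_sections:
  assumes fin: "finite (carrier G)" and M: "M \<lhd> G" and sol: "p_sections p"
  shows "group.p_sections (G Mod M) p"
proof -
  interpret h: group_hom G "G Mod M" "\<lambda>g. M #> g" by (rule quot_hom[OF M])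
  show ?thesis
    unfolding h.H.p_sections_def
  proof (intro allI impI)
    fix K L assume K: "K \<lhd> G Mod M" and L: "L \<lhd> G Mod M" and KL: "K \<subset> L"
    have sub: "K \<subseteq> carrier (G Mod M)" "L \<subseteq> carrier (G Mod M)"
      using normal_imp_subgroup K L subgroup.subset by blast+
    note im = preimage_image[OF sub(1)] preimage_image[OF sub(2)]
    have "preimage M K \<subseteq> preimage M L" using KL unfolding preimage_def by blast
    moreover have "preimage M K \<noteq> preimage M L"
    proof
      assume eq: "preimage M K = preimage M L"
      have "K = L" by (rule trans[OF im(1)[unfolded eq, symmetric] im(2)])
      with KL show False by blast
    qed
    ultimately have "preimage M K \<subset> preimage M L" by blast
    then have "\<exists>N s. N \<lhd> G \<and> preimage M K \<subset> N \<and> N \<subseteq> preimage M L \<and> pi_section G p s N (preimage M K)"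
      using sol preimage_normal[OF M fin K] preimage_normal[OF M fin L] unfolding p_sections_def by simp
    then obtain N s where N: "N \<lhd> G" "preimage M K \<subset> N" "N \<subseteq> preimage M L" "pi_section G p s N (preimage M K)"
      by (elim exE conjE)
    let ?N = "(\<lambda>g. M #> g) ` N"
    have NG: "N \<subseteq> carrier G" using normal_imp_subgroup[OF N(1)] subgroup.subset by blast
    have "?N \<lhd> G Mod M" by (rule image_normal[OF M N(1)])
    moreover have "K \<subseteq> ?N" using im(1) N(2) by blast
    moreover have "K \<noteq> ?N"
    proof
      assume eq: "K = ?N"
      then have "N \<subseteq> preimage M K" unfolding preimage_def using NG by blast
      then show False using N(2) by blast
    qed
    moreover have "?N \<subseteq> L" using im(2) N(3) by blast
    moreover have "pi_section (G Mod M) p s ?N K" using image_pi_section[OF M NG N(4)] im(1) by simp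
    ultimately show "\<exists>N s. N \<lhd> G Mod M \<and> K \<subset> N \<and> N \<subseteq> L \<and> pi_section (G Mod M) p s N K" by blast
  qed
qed

lemma quotient_core:
  fixes p :: nat
  assumes fin: "finite (carrier G)"
  defines "M \<equiv> core p False (carrier G) {\<one>}"
  shows "group.core (G Mod M) p False (carrier (G Mod M)) {\<one>\<^bsub>G Mod M\<^esub>} = {\<one>\<^bsub>G Mod M\<^esub>}"
proof -
  have M: "M \<lhd> G" "pi_section G p False M {\<one>}" unfolding M_def using one_core[OF fin] by blast+
  interpret h: group_hom G "G Mod M" "\<lambda>g. M #> g" by (rule quot_hom[OF M(1)])
  let ?C = "h.H.core p False (carrier (G Mod M)) {\<one>\<^bsub>G Mod M\<^esub>}"
  have C: "?C \<lhd> G Mod M" "pi_section (G Mod M) p False ?C {M}"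
    using h.H.one_core[OF finite_quot[OF fin]] by auto
  have sub: "?C \<subseteq> carrier (G Mod M)" using normal_imp_subgroup[OF C(1)] subgroup.subset by blast
  have n: "preimage M ?C \<lhd> G" by (rule preimage_normal[OF M(1) fin C(1)])
  have s: "subgroup (preimage M ?C) G" by (rule normal_imp_subgroup[OF n])
  have "pi_section G p False (preimage M ?C) M" using preimage_pi_section[OF M(1) C(2)] preimage_one[OF M(1)] by simp
  then have "pi_section G p False (preimage M ?C) {\<one>}" using pi_section_trans[OF _ M(2) subgroup.subset[OF s]] by blast
  then have "preimage M ?C \<subseteq> M"
    unfolding M_def using core_max[of "preimage M ?C" "carrier G" "{\<one>}"] n normal_in_carrier subgroup.one_closed[OF s]
    unfolding M_def by blast
  then have "?C \<subseteq> {M}" using preimage_image[OF sub] image_self[OF M(1)] by (metis image_mono)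
  moreover have "M \<in> ?C" using subgroup.one_closed[OF normal_imp_subgroup[OF C(1)]] by simp
  ultimately show ?thesis by auto
qed

end

section \<open>Groups without normal subgroups of coprime order\<close>

context rank_two_action
begin

text \<open>A subgroup of the quotient is decomposed by applying goodness to its preimage in
  \<open>G\<close> and projecting: commutators go to commutators and fixed points to fixed
  points.\<close>

lemma quotient_action:
  assumes M: "M \<lhd> G" "A_invariant M"
  shows "rank_two_action (G Mod M) A (\<lambda>a R. phi a ` R) r"
proof -
  interpret h: group_hom G "G Mod M" "\<lambda>g. M #> g" by (rule G.quot_hom[OF M(1)])
  have act: "aut_action A (G Mod M) (\<lambda>a R. phi a ` R)" by (rule quotient_aut_action[OF M])
  have "good_action A (G Mod M) (\<lambda>a R. phi a ` R)"
    unfolding good_action_def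
  proof (intro allI impI)
    fix B L assume B: "subgroup B A" and L: "subgroup L (G Mod M)" and inv: "\<forall>b\<in>B. (\<lambda>R. phi b ` R) ` L \<subseteq> L"
    interpret B: subgroup B A by fact
    interpret L: subgroup L "G Mod M" by fact
    let ?H = "G.preimage M L" and ?phi = "\<lambda>a R. phi a ` R"
    interpret H: subgroup ?H G by (rule G.preimage_subgroup[OF M(1) finG L])
    have phiH: "phi b g \<in> ?H" if "b \<in> B" "g \<in> ?H" for b g
    proof -
      have g: "g \<in> carrier G" "M #> g \<in> L" using that(2) unfolding G.preimage_def by auto
      then have "phi b ` (M #> g) \<in> L" using inv that(1) by blast
      then have "M #> phi b g \<in> L" using phi_coset[OF M(2) B.mem_carrier[OF that(1)] g(1)] by simp
      then show ?thesis using g(1) that(1) unfolding G.preimage_def by simp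
    qed
    have eq: "?H = comm_act G phi ?H B <#> fixed_by phi ?H B"
      using good B H.subgroup_axioms phiH unfolding good_action_def by blast
    let ?gens = "{inv\<^bsub>G Mod M\<^esub> R \<otimes>\<^bsub>G Mod M\<^esub> ?phi b R |R b. R \<in> L \<and> b \<in> B}"
    let ?C = "comm_act (G Mod M) ?phi L B" and ?F = "fixed_by ?phi L B"
    have gensL: "?gens \<subseteq> L"
    proof
      fix U assume "U \<in> ?gens"
      then obtain R b where R: "U = inv\<^bsub>G Mod M\<^esub> R \<otimes>\<^bsub>G Mod M\<^esub> ?phi b R" "R \<in> L" "b \<in> B" by blast
      have "?phi b R \<in> L" using inv R(2,3) by blast
      then show "U \<in> L" unfolding R(1) by (rule L.m_closed[OF L.m_inv_closed[OF R(2)]])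
    qed
    have sC: "subgroup ?C (G Mod M)" unfolding comm_act_def
      by (rule h.H.generate_is_subgroup) (use gensL L.subset in blast)
    have CL: "?C \<subseteq> L" unfolding comm_act_def by (rule h.H.generate_subgroup_incl[OF gensL L])
    have sub: "?C <#>\<^bsub>G Mod M\<^esub> ?F \<subseteq> L"
      using CL L.m_closed unfolding set_mult_def fixed_by_def by blast
    have pC: "comm_act G phi ?H B \<subseteq> G.preimage M ?C"
      unfolding comm_act_def[of G]
    proof (rule G.generate_subgroup_incl[OF _ G.preimage_subgroup[OF M(1) finG sC]], safe)
      fix g b assume g: "g \<in> ?H" and b: "b \<in> B"
      have gG: "g \<in> carrier G" "M #> g \<in> L" using g unfolding G.preimage_def by auto
      have "M #> (inv g \<otimes> phi b g) = inv\<^bsub>G Mod M\<^esub> (M #> g) \<otimes>\<^bsub>G Mod M\<^esub> ?phi b (M #> g)"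
        using h.hom_mult[of "inv g" "phi b g"] h.hom_inv[OF gG(1)] phi_coset[OF M(2) _ gG(1), of b] gG b by simp
      moreover have "\<dots> \<in> ?C" unfolding comm_act_def by (rule generate.incl) (use gG b in blast)
      ultimately show "inv g \<otimes> phi b g \<in> G.preimage M ?C" unfolding G.preimage_def using gG b by simp
    qed
    have "L \<subseteq> ?C <#>\<^bsub>G Mod M\<^esub> ?F"
    proof
      fix R assume R: "R \<in> L"
      then obtain g where g: "g \<in> carrier G" "R = M #> g" using L.subset unfolding G.quot_carrier by blast
      then have "g \<in> ?H" using R unfolding G.preimage_def by simp
      then have "g \<in> comm_act G phi ?H B <#> fixed_by phi ?H B" using eq by simp
      then obtain c f where cf: "c \<in> comm_act G phi ?H B" "f \<in> fixed_by phi ?H B" "g = c \<otimes> f"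
        unfolding set_mult_def by blast
      have f: "f \<in> carrier G" "M #> f \<in> L" "\<And>b. b \<in> B \<Longrightarrow> phi b f = f"
        using cf(2) unfolding fixed_by_def G.preimage_def by auto
      have "c \<in> G.preimage M ?C" using cf(1) pC by blast
      then have c: "c \<in> carrier G" "M #> c \<in> ?C" unfolding G.preimage_def by auto
      have "M #> f \<in> ?F" unfolding fixed_by_def using f phi_coset[OF M(2) _ f(1)] by simp
      moreover have "R = (M #> c) \<otimes>\<^bsub>G Mod M\<^esub> (M #> f)" unfolding g(2) cf(3) by (rule h.hom_mult[OF c(1) f(1)])
      ultimately show "R \<in> ?C <#>\<^bsub>G Mod M\<^esub> ?F" unfolding set_mult_def using c(2) by blast
    qed
    then show "L = ?C <#>\<^bsub>G Mod M\<^esub> ?F" using sub by blast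
  qed
  then have "finite_good_action (G Mod M) A (\<lambda>a R. phi a ` R)"
    by (intro finite_good_action.intro finite_good_action_axioms.intro h.H.is_group A.is_group
        G.finite_quot finG finA act)
  then show ?thesis unfolding rank_two_action_def using rank_two_axioms by blast
qed

text \<open>The nontrivial inclusion is \<open>fixed_coset_lift\<close>; it carries p-nilpotency of
  the fixed points over to the quotient.\<close>

lemma quotient_fixed_pts:
  assumes M: "M \<lhd> G" "A_invariant M" and x: "x \<in> carrier A"
  shows "finite_good_action.fixed_pts (G Mod M) (\<lambda>a R. phi a ` R) x = (\<lambda>g. M #> g) ` fixed_pts x"
proof -
  interpret Q: rank_two_action "G Mod M" A "\<lambda>a R. phi a ` R" r by (rule quotient_action[OF M])
  show ?thesis
  proof
    show "(\<lambda>g. M #> g) ` fixed_pts x \<subseteq> Q.fixed_pts x"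
    proof
      fix R assume "R \<in> (\<lambda>g. M #> g) ` fixed_pts x"
      then obtain g where g: "g \<in> carrier G" "phi x g = g" "R = M #> g" unfolding fixed_pts_def by blast
      then have "phi x ` R = R" using phi_coset[OF M(2) x g(1)] by simp
      moreover have "R \<in> carrier (G Mod M)" unfolding G.quot_carrier using g by blast
      ultimately show "R \<in> Q.fixed_pts x" unfolding Q.fixed_pts_def by blast
    qed
    show "Q.fixed_pts x \<subseteq> (\<lambda>g. M #> g) ` fixed_pts x"
    proof
      fix R assume "R \<in> Q.fixed_pts x"
      then have "R \<in> carrier (G Mod M)" and fR: "phi x ` R = R" unfolding Q.fixed_pts_def by auto
      then obtain g where g: "g \<in> carrier G" "R = M #> g" unfolding G.quot_carrier by blast
      from fixed_coset_lift[OF x M g(1)] fR g(2) show "R \<in> (\<lambda>g. M #> g) ` fixed_pts x" by auto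
    qed
  qed
qed

lemma core_A_invariant:
  assumes K: "G.normal_in K (carrier G)" "A_invariant K"
  shows "A_invariant (G.core p s (carrier G) K)"
proof -
  note c = G.core_props[OF finG G.subgroup_self K(1), of p s]
  have "phi a ` G.core p s (carrier G) K \<subseteq> G.core p s (carrier G) K" if "a \<in> carrier A" for a
    by (rule G.core_hom[OF finG G.subgroup_self K(1) phi_hom[OF that] phi_image[OF A_invariant_carrier that] phi_image[OF K(2) that]])
  then show ?thesis unfolding A_invariant_def using G.normal_inD(1)[OF c(1)] by blast
qed

lemma one_A_invariant: "A_invariant {\<one>}"
  unfolding A_invariant_def using G.triv_subgroup by simp

lemma normalizer_A_invariant:
  assumes T: "A_invariant T" shows "A_invariant (G.normalizer_of T)"
proof -
  have TG: "T \<subseteq> carrier G" using subgroup.subset[OF A_invariantD(1)[OF T]] .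
  have "phi a g \<in> G.normalizer_of T" if a: "a \<in> carrier A" and g: "g \<in> G.normalizer_of T" for a g
  proof -
    have gG: "g \<in> carrier G" using g unfolding G.normalizer_of_def by blast
    have "phi a g \<otimes> t \<otimes> inv (phi a g) \<in> T" if t: "t \<in> T" for t
    proof -
      define s where "s = phi (inv\<^bsub>A\<^esub> a) t"
      have s: "s \<in> T" "phi a s = t" using A_invariantD(2)[OF T, of "inv\<^bsub>A\<^esub> a" t] a t TG unfolding s_def by auto
      have "g \<otimes> s \<otimes> inv g \<in> T" using g s(1) unfolding G.normalizer_of_def by blast
      then have "phi a (g \<otimes> s \<otimes> inv g) \<in> T" by (rule A_invariantD(2)[OF T a])
      moreover have "s \<in> carrier G" using s(1) TG by blast
      ultimately show ?thesis using a gG s(2) by (simp add: phi_mult phi_inv)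
    qed
    then show ?thesis unfolding G.normalizer_of_def using a gG by simp
  qed
  then show ?thesis unfolding A_invariant_def using G.normalizer_subgroup[OF finG TG] by blast
qed

text \<open>All displacements centralize O_r(G), hence lie in it, where \<open>A\<close> acts
  trivially; by goodness \<open>A\<close> then fixes all of \<open>G\<close>. So \<open>G\<close> is
  itself a group of fixed points, and its r-complement is trivial because O_r'(G) is.\<close>

lemma r_case:
  assumes sol: "G.p_sections r" and O: "G.core r False (carrier G) {\<one>} = {\<one>}"
    and nilp: "\<And>x. nontriv x \<Longrightarrow> \<exists>R. G.normal_in R (fixed_pts x) \<and> pi_section G r False R {\<one>} \<and> pi_section G r True (fixed_pts x) R"
  shows "pi_section G r True (carrier G) (G.core r True (carrier G) {\<one>})"
proof -
  let ?P = "G.core r True (carrier G) {\<one>}"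
  have P: "G.normal_in ?P (carrier G)" "pi_section G r True ?P {\<one>}" using G.one_core[OF finG] G.normal_in_carrier by blast+
  interpret P: subgroup ?P G by (rule G.normal_inD(1)[OF P(1)])
  have AP: "A_invariant ?P" by (rule core_A_invariant[OF G.normal_in_one[OF G.subgroup_self] one_A_invariant])
  obtain k where k: "card ?P = r ^ k"
    using G.pi_section_one_card[OF finG P.subgroup_axioms prime_r, of True] P(2) unfolding pi_number_def by auto
  have triv: "phi a h = h" if "a \<in> carrier A" "h \<in> ?P" for a h by (rule trivial_on_r_group[OF AP k that])
  let ?D = "{h \<in> carrier G. \<forall>a\<in>carrier A. phi a h = h}"
  have "carrier G \<subseteq> ?D"
  proof (rule good_gen_all[OF A_invariant_carrier])
    show "subgroup ?D G" by (rule all_fixed_subgroup)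
    show "h \<in> ?D" if "h \<in> carrier G" "\<And>a. a \<in> carrier A \<Longrightarrow> phi a h = h" for h using that by simp
    fix a g assume a: "a \<in> carrier A" and g: "g \<in> carrier G"
    have "inv g \<otimes> phi a g \<in> ?P"
    proof (rule G.hall_higman[OF finG prime_r sol O])
      show "inv g \<otimes> phi a g \<in> carrier G" using a g by simp
      fix x assume x: "x \<in> ?P"
      have xG: "x \<in> carrier G" using x by simp
      have "phi a (g \<otimes> x \<otimes> inv g) = g \<otimes> x \<otimes> inv g" by (rule triv[OF a G.normal_inD(3)[OF P(1) g x]])
      then have e: "phi a g \<otimes> x \<otimes> inv (phi a g) = g \<otimes> x \<otimes> inv g"
        using a g xG triv[OF a x] by (simp add: phi_mult phi_inv)
      have "inv g \<otimes> phi a g \<otimes> x = inv g \<otimes> (phi a g \<otimes> x \<otimes> inv (phi a g)) \<otimes> phi a g"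
        using a g xG by (simp add: G.m_assoc)
      also have "\<dots> = x \<otimes> (inv g \<otimes> phi a g)" unfolding e using a g xG by (simp add: G.m_assoc)
      finally show "inv g \<otimes> phi a g \<otimes> x = x \<otimes> (inv g \<otimes> phi a g)" .
    qed
    then have "phi b (inv g \<otimes> phi a g) = inv g \<otimes> phi a g" if "b \<in> carrier A" for b using triv[OF that] by blast
    then show "inv g \<otimes> phi a g \<in> ?D" using a g by simp
  qed
  moreover obtain x where x: "nontriv x" using ex_nontrivial by blast
  ultimately have fx: "fixed_pts x = carrier G" unfolding fixed_pts_def by blast
  obtain R where R: "G.normal_in R (carrier G)" "pi_section G r False R {\<one>}" "pi_section G r True (carrier G) R"
    using nilp[OF x] unfolding fx by blast
  have oR: "\<one> \<in> R" using subgroup.one_closed[OF G.normal_inD(1)[OF R(1)]] .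
  then have "R \<subseteq> {\<one>}" using G.core_max[OF R(1) _ R(2)] O by blast
  then have "R = {\<one>}" using oR by blast
  then show ?thesis using pi_section_mono[OF R(3) order_refl, of ?P] P.one_closed by simp
qed

lemma coprime_case:
  assumes p: "Factorial_Ring.prime p" "p \<noteq> r" and sol: "G.p_sections p"
    and O: "G.core p False (carrier G) {\<one>} = {\<one>}"
    and nilp: "\<And>x. nontriv x \<Longrightarrow> \<exists>R. G.normal_in R (fixed_pts x) \<and> pi_section G p False R {\<one>} \<and> pi_section G p True (fixed_pts x) R"
  shows "pi_section G p True (carrier G) (G.core p False (carrier G) (G.core p True (carrier G) {\<one>}))"
proof -
  define P where "P = G.core p True (carrier G) {\<one>}"
  define K where "K = G.core p False (carrier G) P"
  have P: "G.normal_in P (carrier G)" "pi_section G p True P {\<one>}" unfolding P_def using G.one_core[OF finG] G.normal_in_carrier by blast+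
  interpret P: subgroup P G by (rule G.normal_inD(1)[OF P(1)])
  have AP: "A_invariant P" unfolding P_def by (rule core_A_invariant[OF G.normal_in_one[OF G.subgroup_self] one_A_invariant])
  obtain m where m: "card P = p ^ m"
    using G.pi_section_one_card[OF finG P.subgroup_axioms p(1), of True] P(2) unfolding pi_number_def by auto
  note Kp = G.core_props[OF finG G.subgroup_self P(1), of p False, folded K_def]
  interpret K: subgroup K G by (rule G.normal_inD(1)[OF Kp(1)])
  have AK: "A_invariant K" unfolding K_def by (rule core_A_invariant[OF P(1) AP])
  have HH: "g \<in> P" if "g \<in> carrier G" "\<And>x. x \<in> P \<Longrightarrow> g \<otimes> x = x \<otimes> g" for g
    using G.hall_higman[OF finG p(1) sol O that(1)] that(2) unfolding P_def by blast
  have commute: "t \<otimes> h = h \<otimes> t"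
    if "nontriv x" "t \<in> fixed_pts x" "t [^] (n::nat) = \<one>" "coprime p n" "h \<in> P" "h \<in> fixed_pts x" for x t n h
    using nilp[OF that(1)] fixed_commute[OF P _ _ _ that(2-6)] that(1) by blast
  have Pel: "g = \<one>" if g: "g \<in> P" and n: "g [^] (n::nat) = \<one>" "coprime p n" for g n
    using G.pi_section_opposite[OF P(2) G.triv_subgroup P.subset g, of n] n unfolding pi_number_def by simp
  have rP: "\<not> r dvd card P"
    unfolding m using p prime_r by (metis prime_dvd_power primes_dvd_imp_eq)
  have rG: "\<not> r dvd order G"
  proof
    assume rG: "r dvd order G"
    let ?F = "{g \<in> carrier G. \<forall>a\<in>carrier A. phi a g = g}"
    have sF: "subgroup ?F G" by (rule all_fixed_subgroup)
    interpret FG: group "G\<lparr>carrier := ?F\<rparr>" by (rule subgroup.subgroup_is_group[OF sF G.is_group])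
    \<comment> \<open>If \<open>r\<close> divides the order of \<open>G\<close>, it divides the
      number of points fixed by \<open>A\<close>, and Cauchy's theorem yields the fixed element of
      order \<open>r\<close> to be excluded.\<close>
    have "card (carrier G) mod r = card ?F mod r"
      by (rule fixed_points_mod_prime[OF A.is_group prime_r order_A finG]) (auto simp: phi_id phi_comp)
    then have "r dvd order (G\<lparr>carrier := ?F\<rparr>)" using rG by (simp add: order_def dvd_eq_mod_eq_0)
    then obtain z where z: "z \<in> ?F" "z \<noteq> \<one>" "z [^] r = \<one>"
      using FG.cauchy[OF _ prime_r] finG by (auto simp: nat_pow_def)
    have zG: "z \<in> carrier G" using z(1) by blast
    have cop: "coprime p r" by (rule primes_coprime[OF p(1) prime_r p(2)])
    have sz: "subgroup (G.centralizer_of {z}) G" by (rule G.centralizer_of_subgroup[OF finG]) (use zG in blast)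
    have "P \<subseteq> G.centralizer_of {z}"
    proof (rule generated_by_fixed_points[OF AP rP sz])
      fix x assume x: "nontriv x"
      have zx: "z \<in> fixed_pts x" using z(1) x unfolding fixed_pts_def by blast
      have "h \<otimes> z = z \<otimes> h" if "h \<in> P" "h \<in> fixed_pts x" for h
        using commute[OF x zx z(3) cop that] by simp
      then show "fixed_pts x \<inter> P \<subseteq> G.centralizer_of {z}" unfolding G.centralizer_of_def by auto
    qed
    then have "z \<in> P" using zG by (intro HH) (auto simp: G.centralizer_of_def)
    then show False using Pel[OF _ z(3) cop] z(2) by blast
  qed
  have sub_r: "\<not> r dvd card H" if "subgroup H G" for H
    using G.subgroup_dvd[OF finG G.subgroup_self that subgroup.subset[OF that]] rG
    unfolding order_def by (auto dest: dvd_trans)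
  \<comment> \<open>For each prime \<open>q\<close> other than \<open>p\<close>, \<open>W\<close> is
    the preimage of a normal p-complement of the quotient of \<open>G\<close> by K C_G(T).\<close>
  have layer: "\<exists>T W. G.sylow_in q T K \<and> G.normal_in W (carrier G) \<and> K \<subseteq> W \<and> pi_section G p True (carrier G) W \<and>
      pi_section G p False W (K <#> G.centralizer_of T) \<and> G.normal_in (K <#> G.centralizer_of T) (carrier G)"
    if q: "Factorial_Ring.prime q" "q \<noteq> p" for q
  proof -
    obtain T where T: "G.sylow_in q T K" "A_invariant T" using invariant_sylow[OF AK sub_r[OF K.subgroup_axioms] q(1)] by blast
    interpret T: subgroup T G by (rule A_invariantD(1)[OF T(2)])
    obtain k where k: "card T = q ^ k" "T \<subseteq> K" using T(1) unfolding G.sylow_in_def by blast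
    let ?N = "G.normalizer_of T"
    have AN: "A_invariant ?N" by (rule normalizer_A_invariant[OF T(2)])
    interpret N: subgroup ?N G by (rule A_invariantD(1)[OF AN])
    let ?NG = "G\<lparr>carrier := ?N\<rparr>"
    interpret NA: rank_two_action ?NG A phi r by (rule restrict_rank_two[OF AN])
    have TN: "T \<subseteq> ?N" unfolding G.normalizer_of_def by auto
    have nT: "n \<otimes> t \<otimes> inv n \<in> T" if "n \<in> ?N" "t \<in> T" for n t
      using that unfolding G.normalizer_of_def by blast
    have Tpow: "t [^] (q ^ k) = \<one>" if "t \<in> T" for t
      using group.pow_order_eq_1[OF T.subgroup_is_group[OF G.is_group], of t] that k(1)
      by (simp add: order_def nat_pow_def)
    have copq: "coprime p (q ^ k)" using primes_coprime[OF p(1) q(1)] q(2) by simp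
    have fx: "NA.fixed_pts x = fixed_pts x \<inter> ?N" for x unfolding NA.fixed_pts_def fixed_pts_def by auto
    have nsubN: "NA.G.normal_in Y ?N \<longleftrightarrow> G.normal_in Y ?N" for Y
      using NA.G.normal_in_carrier[of Y] G.normal_in_restrict[OF N.subgroup_axioms, of Y] by simp
    have "\<exists>Y. G.normal_in Y ?N \<and> pi_section G p True ?N Y \<and> pi_section G p False Y (NA.comm_with x)" if x: "nontriv x" for x
    proof -
      have xA: "x \<in> carrier A" using x by simp
      obtain R where R: "G.normal_in R (fixed_pts x)" "pi_section G p False R {\<one>}" "pi_section G p True (fixed_pts x) R" using nilp[OF x] by blast
      have sF: "subgroup (fixed_pts x \<inter> ?N) G" by (rule G.subgroups_Inter_pair[OF fixed_pts_subgroup[OF xA] N.subgroup_axioms])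
      have "R \<inter> (fixed_pts x \<inter> ?N) = R \<inter> ?N" using G.normal_inD(2)[OF R(1)] by blast
      then have nR: "G.normal_in (R \<inter> ?N) (fixed_pts x \<inter> ?N)" using G.normal_in_Int_subgroup[OF R(1) sF] by simp
      have sFN: "subgroup (fixed_pts x \<inter> ?N) ?NG" by (rule G.subgroup_incl[OF sF N.subgroup_axioms]) blast
      have "NA.G.normal_in (R \<inter> ?N) (fixed_pts x \<inter> ?N)"
        using nR G.subgroup_incl[OF _ N.subgroup_axioms, of "R \<inter> ?N"] G.m_inv_consistent[OF N.subgroup_axioms]
        unfolding NA.G.normal_in_def G.normal_in_def by auto
      moreover have "pi_section G p False (R \<inter> ?N) {\<one>}" by (rule pi_section_mono[OF R(2)]) auto
      moreover have "pi_section G p True (fixed_pts x \<inter> ?N) (R \<inter> ?N)"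
        unfolding pi_section_def
      proof
        fix g assume g: "g \<in> fixed_pts x \<inter> ?N"
        then obtain n where "pi_number p True n" "g [^] n \<in> R" using R(3) unfolding pi_section_def by blast
        then show "\<exists>n. pi_number p True n \<and> g [^] n \<in> R \<inter> ?N" using G.subgroup_pow[OF N.subgroup_axioms] g by blast
      qed
      ultimately show ?thesis using NA.comm_with_section[OF xA, of "R \<inter> ?N" p] nsubN unfolding fx by simp
    qed
    then obtain Y where Y: "\<And>x. nontriv x \<Longrightarrow> G.normal_in (Y x) ?N"
      "\<And>x. nontriv x \<Longrightarrow> pi_section G p True ?N (Y x)" "\<And>x. nontriv x \<Longrightarrow> pi_section G p False (Y x) (NA.comm_with x)"
      by metis
    let ?I = "{x. nontriv x}"
    have finI: "finite ?I" by (rule finite_subset[OF _ finA]) blast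
    let ?Y = "carrier G \<inter> (\<Inter>x\<in>?I. Y x)" and ?J = "carrier G \<inter> (\<Inter>x\<in>?I. NA.comm_with x)"
    obtain x0 where x0: "nontriv x0" using ex_nontrivial by blast
    have Y1: "pi_section G p True ?N ?Y" "subgroup ?Y G"
      using G.pi_section_Inter[OF finI N.subset, of Y p True] G.normal_inD(1)[OF Y(1)] Y(2) by auto
    have nY: "G.normal_in ?Y ?N"
      unfolding G.normal_in_def
    proof (intro conjI ballI Y1(2))
      show "?Y \<subseteq> ?N" using G.normal_inD(2)[OF Y(1)[OF x0]] x0 by blast
      fix h n assume h: "h \<in> ?N" and n: "n \<in> ?Y"
      have "h \<otimes> n \<otimes> inv h \<in> Y x" if "nontriv x" for x using G.normal_inD(3)[OF Y(1)[OF that] h] n that by blast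
      moreover have "h \<otimes> n \<otimes> inv h \<in> carrier G" using h n by simp
      ultimately show "h \<otimes> n \<otimes> inv h \<in> ?Y" by blast
    qed
    have scomm: "subgroup (NA.comm_with x) G" if "nontriv x" for x
    proof -
      have "x \<in> carrier A" using that by simp
      then show ?thesis using G.incl_subgroup[OF N.subgroup_axioms NA.G.normal_inD(1)[OF NA.comm_with_normal_in]] by blast
    qed
    have YJ: "pi_section G p False ?Y ?J"
    proof -
      have "pi_section G p False ?Y (NA.comm_with x)" if "nontriv x" for x
        by (rule pi_section_mono[OF Y(3)[OF that]]) (use that in auto)
      then show ?thesis using G.pi_section_Inter[OF finI, of ?Y "NA.comm_with" p False] scomm by auto
    qed
    have Jc: "?J \<subseteq> G.centralizer_of T"
    proof
      fix j assume j: "j \<in> ?J"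
      then have jx: "j \<in> NA.comm_with x" if "nontriv x" for x using that by blast
      have "NA.comm_with x0 \<subseteq> ?N" using NA.G.normal_inD(2)[OF NA.comm_with_normal_in[of x0]] x0 by simp
      then have jN: "j \<in> ?N" using jx[OF x0] by blast
      have jG: "j \<in> carrier G" using jN by simp
      have "j \<otimes> t = t \<otimes> j" if t: "t \<in> T" for t
      proof -
        let ?u = "j \<otimes> t \<otimes> inv j \<otimes> inv t"
        have uT: "?u \<in> T" using nT[OF jN t] t by simp
        have tG: "t \<in> carrier G" using t by simp
        \<comment> \<open>The commutator centralizes \<open>P\<close> by
          \<open>commutator_centralizes\<close> and so lies in \<open>P\<close>; being also an
          element of the \<open>q\<close>-group \<open>T\<close>, it is trivial.\<close>
        have "?u \<in> P"
        proof (rule HH)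
          show "?u \<in> carrier G" using uT by simp
          fix h assume h: "h \<in> P"
          show "?u \<otimes> h = h \<otimes> ?u"
          proof (rule commutator_centralizes[OF AN sub_r[OF N.subgroup_axioms] T(2) TN nT q(1) k(1) q(2) p _ jx t AP m _ order_refl h])
            show "n \<otimes> h \<otimes> inv n \<in> P" if "n \<in> ?N" "h \<in> P" for n h using G.normal_inD(3)[OF P(1)] that by simp
            show "t \<otimes> h = h \<otimes> t" if "nontriv x" "t \<in> T" "phi x t = t" "h \<in> P" "phi x h = h" for x t h
              by (rule commute[OF that(1) _ Tpow[OF that(2)] copq that(4)]) (use that in \<open>auto simp: fixed_pts_def\<close>)
          qed
        qed
        then have u1: "?u = \<one>" using Pel[OF _ Tpow[OF uT] copq] by blast
        have "j \<otimes> t = ?u \<otimes> (t \<otimes> j)" using jG tG by (simp add: G.m_assoc)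
        then show ?thesis unfolding u1 using jG tG by simp
      qed
      then show "j \<in> G.centralizer_of T" unfolding G.centralizer_of_def using jG by blast
    qed
    have sc: "subgroup (G.centralizer_of T) G" by (rule G.centralizer_of_subgroup[OF finG T.subset])
    have fr: "\<exists>k\<in>K. \<exists>n\<in>?N. g = k \<otimes> n" if "g \<in> carrier G" for g
      by (rule G.frattini[OF finG Kp(1) q(1) T(1) that])
    have "G.normal_in (K <#> ?Y) (carrier G)" by (rule G.normal_in_supplement[OF finG Kp(1) N.subgroup_axioms nY fr])
    moreover have "K \<subseteq> K <#> ?Y" using G.normal_in_mult_subgroup(2)[OF finG G.subgroup_self Kp(1) Y1(2)] by blast
    moreover have "pi_section G p True (carrier G) (K <#> ?Y)"
    proof -
      have "K <#> ?N = carrier G" using fr unfolding set_mult_def by auto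
      then show ?thesis using G.pi_section_supplement[OF Kp(1) N.subset Y1(1)] by simp
    qed
    moreover have "pi_section G p False (K <#> ?Y) (K <#> G.centralizer_of T)"
      by (rule G.pi_section_supplement[OF Kp(1) _ pi_section_mono[OF YJ order_refl Jc]]) blast
    moreover have "G.normal_in (G.centralizer_of T) ?N"
      unfolding G.normal_in_def
    proof (intro conjI ballI sc)
      show "G.centralizer_of T \<subseteq> ?N"
      proof
        fix c assume c: "c \<in> G.centralizer_of T"
        then have cG: "c \<in> carrier G" unfolding G.centralizer_of_def by blast
        have "c \<otimes> t \<otimes> inv c \<in> T" if t: "t \<in> T" for t
        proof -
          have "c \<otimes> t = t \<otimes> c" using c t unfolding G.centralizer_of_def by blast
          then show ?thesis using t cG by (simp add: G.m_assoc)
        qed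
        then show "c \<in> ?N" unfolding G.normalizer_of_def using cG by blast
      qed
      show "h \<otimes> n \<otimes> inv h \<in> G.centralizer_of T" if "h \<in> ?N" "n \<in> G.centralizer_of T" for h n
        by (rule G.centralizer_of_conj[OF that(1) T.subset finG that(2)])
    qed
    then have "G.normal_in (K <#> G.centralizer_of T) (carrier G)" by (rule G.normal_in_supplement[OF finG Kp(1) N.subgroup_axioms _ fr])
    ultimately show ?thesis using T(1) by blast
  qed
  then obtain T W where TW: "\<And>q. Factorial_Ring.prime q \<Longrightarrow> q \<noteq> p \<Longrightarrow> G.sylow_in q (T q) K \<and> G.normal_in (W q) (carrier G) \<and> K \<subseteq> W q \<and>
      pi_section G p True (carrier G) (W q) \<and> pi_section G p False (W q) (K <#> G.centralizer_of (T q)) \<and> G.normal_in (K <#> G.centralizer_of (T q)) (carrier G)"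
    by metis
  \<comment> \<open>Restricting to the prime divisors of \<open>card K\<close> keeps the
    intersections finite, as \<open>pi_section_Inter\<close> requires.\<close>
  let ?Q = "{q. Factorial_Ring.prime q \<and> q dvd card K \<and> q \<noteq> p}"
  have finQ: "finite ?Q"
    by (rule finite_subset[of _ "{..card K}"])
      (use G.subgroup_pos_card[OF finG K.subgroup_axioms] in \<open>auto intro: dvd_imp_le\<close>)
  let ?W = "carrier G \<inter> (\<Inter>q\<in>?Q. W q)" and ?M = "carrier G \<inter> (\<Inter>q\<in>?Q. K <#> G.centralizer_of (T q))"
  have nI: "G.normal_in (carrier G \<inter> (\<Inter>q\<in>?Q. L q)) (carrier G)"
    if L: "\<And>q. q \<in> ?Q \<Longrightarrow> G.normal_in (L q) (carrier G)" "subgroup (carrier G \<inter> (\<Inter>q\<in>?Q. L q)) G" for L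
    unfolding G.normal_in_def
  proof (intro conjI ballI L(2))
    fix h n assume h: "h \<in> carrier G" and n: "n \<in> carrier G \<inter> (\<Inter>q\<in>?Q. L q)"
    have "h \<otimes> n \<otimes> inv h \<in> L q" if "q \<in> ?Q" for q using G.normal_inD(3)[OF L(1)[OF that] h] n that by blast
    moreover have "h \<otimes> n \<otimes> inv h \<in> carrier G" using h n by simp
    ultimately show "h \<otimes> n \<otimes> inv h \<in> carrier G \<inter> (\<Inter>q\<in>?Q. L q)" by blast
  qed blast
  have Wq: "G.normal_in (W q) (carrier G)" "K \<subseteq> W q" "pi_section G p True (carrier G) (W q)"
    "pi_section G p False (W q) (K <#> G.centralizer_of (T q))" "G.normal_in (K <#> G.centralizer_of (T q)) (carrier G)" "G.sylow_in q (T q) K" if "q \<in> ?Q" for q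
    using TW[of q] that by simp_all
  have W1: "pi_section G p True (carrier G) ?W" "subgroup ?W G"
    using G.pi_section_Inter[OF finQ order_refl, of W p True] G.normal_inD(1)[OF Wq(1)] Wq(3) by blast+
  have WMq: "pi_section G p False ?W (K <#> G.centralizer_of (T q))" if "q \<in> ?Q" for q
    by (rule pi_section_mono[OF Wq(4)[OF that]]) (use that in auto)
  have W2: "pi_section G p False ?W ?M" "subgroup ?M G"
    using G.pi_section_Inter[OF finQ, of ?W "\<lambda>q. K <#> G.centralizer_of (T q)" p False] G.normal_inD(1)[OF Wq(5)] WMq by blast+
  have nM: "G.normal_in ?M (carrier G)" by (rule nI[OF Wq(5) W2(2)])
  have nW: "G.normal_in ?W (carrier G)" by (rule nI[OF Wq(1) W1(2)])
  have KM: "K \<subseteq> ?M"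
  proof -
    have "K \<subseteq> K <#> G.centralizer_of (T q)" if "q \<in> ?Q" for q
    proof -
      have "T q \<subseteq> carrier G" using Wq(6)[OF that] K.subset unfolding G.sylow_in_def by blast
      then have c: "subgroup (G.centralizer_of (T q)) G" by (rule G.centralizer_of_subgroup[OF finG])
      show ?thesis by (rule G.normal_in_mult_subgroup(2)[OF finG G.subgroup_self Kp(1) c subgroup.subset[OF c]])
    qed
    then show ?thesis using K.subset by blast
  qed
  \<comment> \<open>A normal section above \<open>K\<close> inside \<open>?M\<close> cannot be of
    either kind: a p-section is excluded by \<open>covered_section_trivial\<close>, and a p'-section
    would be absorbed by the core that defines \<open>K\<close>.\<close>
  have "?M = K"
  proof (rule ccontr)
    assume "?M \<noteq> K"
    then have "K \<subset> ?M" using KM by blast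
    from sol[unfolded G.p_sections_def, rule_format, OF G.normal_in_carrier[THEN iffD1, OF Kp(1)] G.normal_in_carrier[THEN iffD1, OF nM] this]
    obtain N s where N: "N \<lhd> G" "K \<subset> N" "N \<subseteq> ?M" "pi_section G p s N K" by (elim exE conjE)
    have nN: "G.normal_in N (carrier G)" using N(1) G.normal_in_carrier by blast
    have "N \<subseteq> K"
    proof (cases s)
      case True
      show ?thesis
        unfolding K_def P_def
      proof (rule G.covered_section_trivial[OF finG p(1) nN], fold P_def, fold K_def)
        show "K \<subseteq> N" using N(2) by blast
        show "pi_section G p True N K" using N(4) True by simp
        show "\<exists>T. G.sylow_in q T K \<and> N \<subseteq> K <#> G.centralizer_of T" if "Factorial_Ring.prime q" "q dvd card K" "q \<noteq> p" for q
        proof -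
          have "q \<in> ?Q" using that by simp
          then show ?thesis using Wq(6) N(3) by blast
        qed
      qed
    next
      case False
      then have "pi_section G p False N P" using G.pi_section_trans[OF _ Kp(3) G.normal_inD(2)[OF nN]] N(4) by simp
      then show ?thesis unfolding K_def using G.core_max[OF nN] N(2) Kp(2) by blast
    qed
    with N(2) show False by blast
  qed
  \<comment> \<open>With \<open>?M = K\<close> the section of \<open>?W\<close> over
    \<open>P\<close> is a p'-section, so \<open>?W\<close> lies in \<open>K\<close>, and G / K
    inherits p-power exponents from the quotient by \<open>?W\<close>.\<close>
  then have "pi_section G p False ?W P" using G.pi_section_trans[OF _ Kp(3)] W2(1) by simp
  moreover have "K \<subseteq> ?W" using Wq(2) K.subset by blast
  then have "P \<subseteq> ?W" using Kp(2) by (rule subset_trans[rotated])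
  ultimately have "?W \<subseteq> G.core p False (carrier G) P" by (intro G.core_max[OF nW])
  then have "?W \<subseteq> K" unfolding K_def[symmetric] .
  then have "pi_section G p True (carrier G) K" by (rule pi_section_mono[OF W1(1) order_refl])
  then show ?thesis unfolding K_def P_def .
qed

lemma reduced_theorem:
  assumes p: "Factorial_Ring.prime p" and sol: "G.p_sections p"
    and O: "G.core p False (carrier G) {\<one>} = {\<one>}"
    and nilp: "\<And>x. nontriv x \<Longrightarrow> \<exists>R. G.normal_in R (fixed_pts x) \<and> pi_section G p False R {\<one>} \<and> pi_section G p True (fixed_pts x) R"
  shows "\<exists>P K. P \<lhd> G \<and> pi_section G p True P {\<one>} \<and> K \<lhd> G \<and> pi_section G p False K P \<and> pi_section G p True (carrier G) K"
proof -
  let ?P = "G.core p True (carrier G) {\<one>}"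
  have P: "?P \<lhd> G" "pi_section G p True ?P {\<one>}" using G.one_core[OF finG] by blast+
  have nP: "G.normal_in ?P (carrier G)" using P(1) G.normal_in_carrier by blast
  show ?thesis
  proof (cases "p = r")
    case True
    then have "pi_section G p True (carrier G) ?P" using r_case sol O nilp by simp
    \<comment> \<open>For \<open>p = r\<close> the middle layer collapses and \<open>K\<close> is
      taken to be \<open>P\<close>.\<close>
    moreover have "pi_section G p False ?P ?P" by (rule G.pi_section_refl[OF G.normal_inD(2)[OF nP]])
    ultimately show ?thesis using P by blast
  next
    case False
    let ?K = "G.core p False (carrier G) ?P"
    have "?K \<lhd> G" "pi_section G p False ?K ?P"
      using G.core_props[OF finG G.subgroup_self nP] G.normal_in_carrier by blast+
    moreover have "pi_section G p True (carrier G) ?K" by (rule coprime_case[OF p False sol O nilp])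
    ultimately show ?thesis using P by blast
  qed
qed

end

theorem theoremC:
  fixes G :: "('a, 'd) monoid_scheme" and A :: "('b, 'c) monoid_scheme"
    and phi :: "'b \<Rightarrow> 'a \<Rightarrow> 'a" and p r :: nat
  assumes "Factorial_Ring.prime p" and "Factorial_Ring.prime r"
    and "group G" and "finite (carrier G)"
    and "group A" and "elementary_abelian r A" and "order A = r ^ 2"
    and "p_solvable p G"
    and "aut_action A G phi"
    and "good_action A G phi"
    and "\<And>a. a \<in> carrier A \<Longrightarrow> a \<noteq> \<one>\<^bsub>A\<^esub> \<Longrightarrow>
           p_nilpotent p (G\<lparr>carrier := fixed_by phi (carrier G) {a}\<rparr>)"
  shows "\<exists>N. N \<lhd> G \<and> p_nilpotent p (G\<lparr>carrier := N\<rparr>) \<and> p_nilpotent p (G Mod N)"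
proof -
  note p = assms(1)
  have "comm_group A" "\<And>x. x \<in> carrier A \<Longrightarrow> x [^]\<^bsub>A\<^esub> r = \<one>\<^bsub>A\<^esub>"
    using assms(6) unfolding elementary_abelian_def by blast+
  then have "rank_two A r" using assms(2,7) by (intro rank_two.intro rank_two_axioms.intro)
  moreover have "finite (carrier A)" by (rule rank_two.finite_A[OF calculation])
  moreover have "finite_good_action G A phi"
    by (intro finite_good_action.intro finite_good_action_axioms.intro assms calculation(2))
  ultimately interpret rank_two_action G A phi r by (intro rank_two_action.intro)
  have sol: "G.p_sections p"
    unfolding G.p_sections_def using G.p_solvable_normal_section[OF assms(4,1,8)] by simp
  define M where "M = G.core p False (carrier G) {\<one>\<^bsub>G\<^esub>}"
  have M: "M \<lhd> G" "pi_section G p False M {\<one>\<^bsub>G\<^esub>}" unfolding M_def using G.one_core[OF finG] by blast+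
  have AM: "A_invariant M" unfolding M_def by (rule core_A_invariant[OF G.normal_in_one[OF G.subgroup_self] one_A_invariant])
  interpret Q: rank_two_action "G Mod M" A "\<lambda>a R. phi a ` R" r by (rule quotient_action[OF M(1) AM])
  have nilp: "\<exists>R. Q.G.normal_in R (Q.fixed_pts x) \<and> pi_section (G Mod M) p False R {\<one>\<^bsub>G Mod M\<^esub>} \<and> pi_section (G Mod M) p True (Q.fixed_pts x) R"
    if x: "nontriv x" for x
  proof -
    have xA: "x \<in> carrier A" using x by simp
    let ?F = "fixed_pts x"
    interpret F: subgroup ?F G by (rule fixed_pts_subgroup[OF xA])
    interpret FG: group "G\<lparr>carrier := ?F\<rparr>" by (rule F.subgroup_is_group[OF G.is_group])
    have "fixed_by phi (carrier G) {x} = ?F" unfolding fixed_by_def fixed_pts_def by simp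
    then have "p_nilpotent p (G\<lparr>carrier := ?F\<rparr>)" using assms(11)[of x] x by simp
    moreover have "finite ?F" using G.subgroup_pos_card[OF finG F.subgroup_axioms] by simp
    ultimately obtain R where R: "R \<lhd> G\<lparr>carrier := ?F\<rparr>" "pi_section G p False R {\<one>\<^bsub>G\<^esub>}" "pi_section G p True ?F R"
      using FG.p_nilpotent_iff[OF _ p] by auto
    have nR: "G.normal_in R ?F" using R(1) G.normal_in_restrict[OF F.subgroup_axioms] by blast
    have RG: "R \<subseteq> carrier G" using G.normal_inD(2)[OF nR] F.subset by blast
    let ?f = "\<lambda>g. M #>\<^bsub>G\<^esub> g"
    have "?f ` {\<one>\<^bsub>G\<^esub>} = {\<one>\<^bsub>G Mod M\<^esub>}"
      using group_hom.hom_one[OF G.quot_hom[OF M(1)]] by simp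
    then have "pi_section (G Mod M) p False (?f ` R) {\<one>\<^bsub>G Mod M\<^esub>}" using G.image_pi_section[OF M(1) RG R(2)] by simp
    moreover have "pi_section (G Mod M) p True (Q.fixed_pts x) (?f ` R)"
      unfolding quotient_fixed_pts[OF M(1) AM xA] by (rule G.image_pi_section[OF M(1) F.subset R(3)])
    moreover have "Q.G.normal_in (?f ` R) (Q.fixed_pts x)"
      unfolding quotient_fixed_pts[OF M(1) AM xA] by (rule G.image_normal_in[OF M(1) F.subgroup_axioms nR])
    ultimately show ?thesis by blast
  qed
  obtain P K where PK: "P \<lhd> G Mod M" "pi_section (G Mod M) p True P {\<one>\<^bsub>G Mod M\<^esub>}" "K \<lhd> G Mod M"
    "pi_section (G Mod M) p False K P" "pi_section (G Mod M) p True (carrier (G Mod M)) K"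
    using Q.reduced_theorem[OF p G.quotient_p_sections[OF finG M(1) sol] G.quotient_core[OF finG, of p, folded M_def] nilp]
    by blast
  let ?P = "G.preimage M P" and ?K = "G.preimage M K"
  have nPK: "?P \<lhd> G" "?K \<lhd> G" using G.preimage_normal[OF M(1) finG] PK by blast+
  interpret P: subgroup ?P G by (rule normal_imp_subgroup[OF nPK(1)])
  interpret PG: group "G\<lparr>carrier := ?P\<rparr>" by (rule P.subgroup_is_group[OF G.is_group])
  have sPM: "pi_section G p True ?P M" using G.preimage_pi_section[OF M(1) PK(2)] G.preimage_one[OF M(1)] by simp
  have sKP: "pi_section G p False ?K ?P" by (rule G.preimage_pi_section[OF M(1) PK(4)])
  have "G.preimage M (carrier (G Mod M)) = carrier G" unfolding G.preimage_def G.quot_carrier by blast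
  then have sGK: "pi_section G p True (carrier G) ?K" using G.preimage_pi_section[OF M(1) PK(5)] by simp
  have MP: "M \<subseteq> ?P"
  proof -
    have "{M} \<subseteq> P" using subgroup.one_closed[OF normal_imp_subgroup[OF PK(1)]] by simp
    then have "G.preimage M {M} \<subseteq> ?P" unfolding G.preimage_def by blast
    then show ?thesis using G.preimage_one[OF M(1)] by simp
  qed
  have nM: "G.normal_in M (carrier G)" using M(1) G.normal_in_carrier by blast
  have "G.normal_in M ?P" unfolding G.normal_in_def using G.normal_inD(1)[OF nM] MP G.normal_inD(3)[OF nM] P.mem_carrier by blast
  then have "M \<lhd> G\<lparr>carrier := ?P\<rparr>" using G.normal_in_restrict[OF P.subgroup_axioms] by blast
  moreover have "finite ?P" using G.subgroup_pos_card[OF finG P.subgroup_axioms] by simp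
  \<comment> \<open>\<open>M\<close> is the normal p-complement of the preimage of
    \<open>P\<close>.\<close>
  ultimately have "p_nilpotent p (G\<lparr>carrier := ?P\<rparr>)"
    using PG.p_nilpotent_iff[OF _ p] M(2) sPM by auto
  moreover have "p_nilpotent p (G Mod ?P)" by (rule G.quotient_p_nilpotent[OF finG p nPK sKP sGK])
  ultimately show ?thesis using nPK(1) by blast
qed

end
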